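(* Let $\{(\mathcal{P}_n,\mathcal{E}_n)\}_{n\in\mathbb{N}}$ be a sequence with $\mathcal{P}_n,\mathcal{E}_n\subseteq\mathcal{D}(\mathcal{H}^{\otimes n})$. Assume that for each $n$, $\mathcal{P}_n$ is convex, compact and permutation-invariant, and that for all $m,k\in\mathbb{N}$, $\mathcal{P}_m\otimes\mathcal{P}_k\subseteq\mathcal{P}_{m+k}$ and $(\mathcal{P}_m)^{\circ}_{+}\otimes(\mathcal{P}_k)^{\circ}_{+}\subseteq(\mathcal{P}_{m+k})^{\circ}_{+}$; assume $\{\mathcal{E}_n\}$ satisfies the same conditions. Suppose further there is a constant $c>0$ with $D_{\max}(\mathcal{P}_n\|\mathcal{E}_n)\le cn$ for all $n$. Then for every $\varepsilon\in(0,1)$, $$\lim_{n\to\infty}\frac1n\beta\overline{W}_{\mathrm{GPO},\varepsilon}(\mathcal{P}_n,\mathcal{E}_n)=\lim_{n\to\infty}\frac1n D(\mathcal{P}_n\|\mathcal{E}_n),\qquad \lim_{n\to\infty}\frac1n\beta C_{\mathrm{GPO},\varepsilon}(\mathcal{P}_n,\mathcal{E}_n)=\lim_{n\to\infty}\frac1n D(\mathcal{P}_n\|\mathcal{E}_n).$$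
   Context: $\mathcal{H}$ is a finite-dimensional Hilbert space, $\mathcal{D}(\cdot)$ the set of density operators. A set $\mathcal{S}\subseteq\mathcal{D}(\mathcal{H}^{\otimes n})$ is permutation-invariant if $W_\pi\rho W_\pi^\dagger\in\mathcal{S}$ for every $\rho\in\mathcal{S}$ and every unitary $W_\pi$ permuting the $n$ tensor factors. The PSD-restricted polar set is $\mathcal{S}^{\circ}_{+}=\{X\ge0:\operatorname{tr}[X\rho]\le1\ \forall\rho\in\mathcal{S}\}$; $\mathcal{A}\otimes\mathcal{B}=\{a\otimes b:a\in\mathcal{A},b\in\mathcal{B}\}$. $T(X,Y)=\tfrac12\|X-Y\|_1$, $\mathcal{B}_\varepsilon(\mathcal{P})=\{\omega\in\mathcal{D}:T(\omega,\rho)\le\varepsilon\text{ for some }\rho\in\mathcal{P}\}$, $D_{\max,\varepsilon}(\mathcal{P}\|\mathcal{E})=\log\inf\{M>1:\tau\in\mathcal{E},\omega\in\mathcal{B}_\varepsilon(\mathcal{P}),M\tau\ge\omega\}$ and $D_{\max}=D_{\max,0}$. Umegaki relative entropy: $D(\rho\|\tau)=\operatorname{tr}[\rho(\log\rho-\log\tau)]$ if $\operatorname{supp}\rho\subseteq\operatorname{supp}\tau$, else $+\infty$; $D(\mathcal{P}\|\mathcal{E})=\inf_{\rho\in\mathcal{P},\tau\in\mathcal{E}}D(\rho\|\tau)$. Battery: qubit with basis $\{|0\rangle,|1\rangle\}$, $\pi_M=(1-\tfrac1M)|0\rangle\langle0|+\tfrac1M|1\rangle\langle1|$, $\Pi_M=\{\pi_{M'}:M'\ge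 M\}$. With GPO meaning CPTP maps: $\beta\overline{W}_{\mathrm{GPO},\varepsilon}(\mathcal{P},\mathcal{E})=\log\sup\{M>1:\exists\text{ CPTP }\mathcal{F},\ T(\mathcal{F}(\rho),|1\rangle\langle1|)\le\varepsilon\ \forall\rho\in\mathcal{P},\ \mathcal{F}(\tau)\in\Pi_M\ \forall\tau\in\mathcal{E}\}$, and $\beta C_{\mathrm{GPO},\varepsilon}(\mathcal{P},\mathcal{E})=\log\inf\{M>1:\exists\text{ CPTP }\mathcal{F},\ \exists(\rho,\tau)\in\mathcal{P}\times\mathcal{E},\ T(\mathcal{F}(|1\rangle\langle1|),\rho)\le\varepsilon,\ \mathcal{F}(\pi_M)=\tau\}$. *)

theory Defs
  imports "HOL-Analysis.Analysis" "HOL-Combinatorics.Permutations"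
    "Jordan_Normal_Form.Matrix" "Jordan_Normal_Form.Schur_Decomposition"
begin

text \<open>Operators on \<open>H^{\<otimes>n}\<close> with \<open>dim H = d\<close> are represented as complex
  \<open>d^n \<times> d^n\<close> matrices; the computational basis index of \<open>H^{\<otimes>n}\<close> is the base-d
  number whose digits (most significant first) are the local basis indices.\<close>

definition mtrace :: "complex mat \<Rightarrow> complex" where
  "mtrace A = (\<Sum>i<dim_row A. A $$ (i, i))"

definition hermitian :: "complex mat \<Rightarrow> bool" where
  "hermitian A \<longleftrightarrow> dim_row A = dim_col A \<and> mat_adjoint A = A"

definition psd :: "complex mat \<Rightarrow> bool" where
  "psd A \<longleftrightarrow> hermitian A \<and>
     (\<forall>v \<in> carrier_vec (dim_row A). 0 \<le> Re ((A *\<^sub>v v) \<bullet>c v))"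

definition loewner_ge :: "complex mat \<Rightarrow> complex mat \<Rightarrow> bool" where
  "loewner_ge A B \<longleftrightarrow> dim_row A = dim_row B \<and> dim_col A = dim_col B \<and> psd (A - B)"

definition dens :: "nat \<Rightarrow> complex mat set" where
  "dens N = {\<rho> \<in> carrier_mat N N. psd \<rho> \<and> mtrace \<rho> = 1}"

definition kron :: "complex mat \<Rightarrow> complex mat \<Rightarrow> complex mat" where
  "kron A B = mat (dim_row A * dim_row B) (dim_col A * dim_col B)
     (\<lambda>(i, j). A $$ (i div dim_row B, j div dim_col B) * B $$ (i mod dim_row B, j mod dim_col B))"

definition set_tensor :: "complex mat set \<Rightarrow> complex mat set \<Rightarrow> complex mat set" where
  "set_tensor A B = {kron a b | a b. a \<in> A \<and> b \<in> B}"

text \<open>k-th tensor factor digit (0-based, most significant first) of a basis index x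
  of \<open>H^{\<otimes>n}\<close>, \<open>dim H = d\<close>\<close>
definition digit :: "nat \<Rightarrow> nat \<Rightarrow> nat \<Rightarrow> nat \<Rightarrow> nat" where
  "digit d n x k = (x div d ^ (n - 1 - k)) mod d"

text \<open>the unitary \<open>W_\<pi>\<close> permuting the n tensor factors:
  \<open>W_\<pi> |x_0 \<dots> x_{n-1}\<rangle> = |x_{\<pi> 0} \<dots> x_{\<pi> (n-1)}\<rangle>\<close>\<close>
definition perm_unitary :: "nat \<Rightarrow> nat \<Rightarrow> (nat \<Rightarrow> nat) \<Rightarrow> complex mat" where
  "perm_unitary d n \<pi> = mat (d ^ n) (d ^ n)
     (\<lambda>(i, j). if (\<forall>k<n. digit d n i k = digit d n j (\<pi> k)) then 1 else 0)"

definition perm_invariant :: "nat \<Rightarrow> nat \<Rightarrow> complex mat set \<Rightarrow> bool" where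
  "perm_invariant d n S \<longleftrightarrow>
     (\<forall>\<pi>. \<pi> permutes {..<n} \<longrightarrow>
        (\<forall>\<rho>\<in>S. perm_unitary d n \<pi> * \<rho> * mat_adjoint (perm_unitary d n \<pi>) \<in> S))"

definition polar_plus :: "nat \<Rightarrow> complex mat set \<Rightarrow> complex mat set" where
  "polar_plus N S = {X \<in> carrier_mat N N. psd X \<and> (\<forall>\<rho>\<in>S. Re (mtrace (X * \<rho>)) \<le> 1)}"

definition convex_mat :: "complex mat set \<Rightarrow> bool" where
  "convex_mat S \<longleftrightarrow> (\<forall>a\<in>S. \<forall>b\<in>S. \<forall>t::real. 0 \<le> t \<and> t \<le> 1 \<longrightarrow>
      complex_of_real t \<cdot>\<^sub>m a + complex_of_real (1 - t) \<cdot>\<^sub>m b \<in> S)"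

text \<open>Compactness: w.r.t. the (unique Hausdorff vector space) topology of the space of
  \<open>N \<times> N\<close> matrices, realised by the entrywise embedding into
  \<open>nat \<times> nat \<Rightarrow> complex\<close> (product topology) extended by zero.\<close>
definition mat_fun :: "nat \<Rightarrow> complex mat \<Rightarrow> (nat \<times> nat \<Rightarrow> complex)" where
  "mat_fun N A = (\<lambda>(i, j). if i < N \<and> j < N then A $$ (i, j) else 0)"

definition compact_mat :: "nat \<Rightarrow> complex mat set \<Rightarrow> bool" where
  "compact_mat N S \<longleftrightarrow> compact (mat_fun N ` S)"

definition hfun :: "(real \<Rightarrow> real) \<Rightarrow> complex mat \<Rightarrow> complex mat" where
  "hfun f A = (SOME B. \<exists>U D. U \<in> carrier_mat (dim_row A) (dim_row A) \<and>
      mat_adjoint U * U = 1\<^sub>m (dim_row A) \<and>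
      D \<in> carrier_mat (dim_row A) (dim_row A) \<and> diagonal_mat D \<and>
      A = U * D * mat_adjoint U \<and>
      B = U * mat (dim_row A) (dim_row A)
             (\<lambda>(i, j). if i = j then complex_of_real (f (Re (D $$ (i, i)))) else 0)
          * mat_adjoint U)"

definition trace_norm :: "complex mat \<Rightarrow> real" where
  "trace_norm X = Re (mtrace (hfun sqrt (mat_adjoint X * X)))"

definition tdist :: "complex mat \<Rightarrow> complex mat \<Rightarrow> real" where
  "tdist X Y = trace_norm (X - Y) / 2"

definition eps_ball :: "nat \<Rightarrow> real \<Rightarrow> complex mat set \<Rightarrow> complex mat set" where
  "eps_ball N \<epsilon> P = {\<omega> \<in> dens N. \<exists>\<rho>\<in>P. tdist \<omega> \<rho> \<le> \<epsilon>}"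

definition elog :: "ereal \<Rightarrow> ereal" where
  "elog x = (if x = \<infinity> then \<infinity> else if 0 < x then ereal (ln (real_of_ereal x)) else -\<infinity>)"

definition Dmax_eps :: "nat \<Rightarrow> real \<Rightarrow> complex mat set \<Rightarrow> complex mat set \<Rightarrow> ereal" where
  "Dmax_eps N \<epsilon> P E = elog (Inf {ereal M | M. M > 1 \<and>
      (\<exists>\<tau>\<in>E. \<exists>\<omega>\<in>eps_ball N \<epsilon> P. loewner_ge (complex_of_real M \<cdot>\<^sub>m \<tau>) \<omega>)})"

definition Dmax :: "nat \<Rightarrow> complex mat set \<Rightarrow> complex mat set \<Rightarrow> ereal" where
  "Dmax N P E = Dmax_eps N 0 P E"

text \<open>log on the support (value 0 on the kernel; irrelevant under the support condition,
  and giving \<open>0 log 0 = 0\<close>)\<close>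
definition log0 :: "real \<Rightarrow> real" where
  "log0 x = (if 0 < x then ln x else 0)"

text \<open>support = range\<close>
definition supp_le :: "complex mat \<Rightarrow> complex mat \<Rightarrow> bool" where
  "supp_le \<rho> \<tau> \<longleftrightarrow> (\<forall>v\<in>carrier_vec (dim_col \<rho>). \<exists>w\<in>carrier_vec (dim_col \<tau>). \<rho> *\<^sub>v v = \<tau> *\<^sub>v w)"

definition rel_ent :: "complex mat \<Rightarrow> complex mat \<Rightarrow> ereal" where
  "rel_ent \<rho> \<tau> = (if supp_le \<rho> \<tau>
      then ereal (Re (mtrace (\<rho> * (hfun log0 \<rho> - hfun log0 \<tau>)))) else \<infinity>)"

definition rel_ent_set :: "complex mat set \<Rightarrow> complex mat set \<Rightarrow> ereal" where
  "rel_ent_set P E = (INF \<rho>\<in>P. INF \<tau>\<in>E. rel_ent \<rho> \<tau>)"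

text \<open>Completely positive trace-preserving maps from \<open>N \<times> N\<close> to \<open>K \<times> K\<close> matrices.
  \<open>ampliate k N K F\<close> is \<open>id_k \<otimes> F\<close> acting on \<open>\<complex>^k \<otimes> \<complex>^N\<close>.\<close>
definition ampliate :: "nat \<Rightarrow> nat \<Rightarrow> nat \<Rightarrow> (complex mat \<Rightarrow> complex mat) \<Rightarrow> complex mat \<Rightarrow> complex mat" where
  "ampliate k N K F X = mat (k * K) (k * K) (\<lambda>(i, j).
      F (mat N N (\<lambda>(p, q). X $$ ((i div K) * N + p, (j div K) * N + q))) $$ (i mod K, j mod K))"

definition cptp :: "nat \<Rightarrow> nat \<Rightarrow> (complex mat \<Rightarrow> complex mat) \<Rightarrow> bool" where
  "cptp N K F \<longleftrightarrow>
     (\<forall>A \<in> carrier_mat N N. F A \<in> carrier_mat K K) \<and>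
     (\<forall>A \<in> carrier_mat N N. \<forall>B \<in> carrier_mat N N. \<forall>c::complex. F (c \<cdot>\<^sub>m A + B) = c \<cdot>\<^sub>m F A + F B) \<and>
     (\<forall>A \<in> carrier_mat N N. mtrace (F A) = mtrace A) \<and>
     (\<forall>k. \<forall>X \<in> carrier_mat (k * N) (k * N). psd X \<longrightarrow> psd (ampliate k N K F X))"

definition ket1 :: "complex mat" where
  "ket1 = mat 2 2 (\<lambda>(i, j). if i = 1 \<and> j = 1 then 1 else 0)"

definition battery :: "real \<Rightarrow> complex mat" where
  "battery M = mat 2 2 (\<lambda>(i, j). if i = 0 \<and> j = 0 then complex_of_real (1 - 1 / M)
      else if i = 1 \<and> j = 1 then complex_of_real (1 / M) else 0)"

definition battery_set :: "real \<Rightarrow> complex mat set" where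
  "battery_set M = {battery M' | M'. M' \<ge> M}"

definition betaW :: "nat \<Rightarrow> real \<Rightarrow> complex mat set \<Rightarrow> complex mat set \<Rightarrow> ereal" where
  "betaW N \<epsilon> P E = elog (Sup {ereal M | M. M > 1 \<and> (\<exists>F. cptp N 2 F \<and>
      (\<forall>\<rho>\<in>P. tdist (F \<rho>) ket1 \<le> \<epsilon>) \<and> (\<forall>\<tau>\<in>E. F \<tau> \<in> battery_set M))})"

definition betaC :: "nat \<Rightarrow> real \<Rightarrow> complex mat set \<Rightarrow> complex mat set \<Rightarrow> ereal" where
  "betaC N \<epsilon> P E = elog (Inf {ereal M | M. M > 1 \<and> (\<exists>F. cptp 2 N F \<and>
      (\<exists>\<rho>\<in>P. \<exists>\<tau>\<in>E. tdist (F ket1) \<rho> \<le> \<epsilon> \<and> F (battery M) = \<tau>))})"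

definition good_family :: "nat \<Rightarrow> (nat \<Rightarrow> complex mat set) \<Rightarrow> bool" where
  "good_family d S \<longleftrightarrow>
     (\<forall>n\<ge>1. S n \<subseteq> dens (d ^ n) \<and> convex_mat (S n) \<and> compact_mat (d ^ n) (S n)
              \<and> perm_invariant d n (S n)) \<and>
     (\<forall>m\<ge>1. \<forall>k\<ge>1. set_tensor (S m) (S k) \<subseteq> S (m + k) \<and>
        set_tensor (polar_plus (d ^ m) (S m)) (polar_plus (d ^ k) (S k))
          \<subseteq> polar_plus (d ^ (m + k)) (S (m + k)))"

end

theory Submission
  imports Defs
begin

text \<open>
  With \<open>\<epsilon>\<close>-smoothing, \<open>\<beta>C\<close> is a smoothed max-relative entropy and \<open>\<beta>W\<close> a hypothesis testing
  relative entropy; composing a distillation with a formation channel gives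
  \<open>\<beta>W\<^sub>\<epsilon> \<le> \<beta>C\<^sub>\<epsilon>\<^sub>' + const\<close> whenever \<open>\<epsilon> + \<epsilon>' < 1\<close>. It remains to bound \<open>\<beta>C\<close> above and
  \<open>\<beta>W\<close> below by the block values \<open>D(P\<^sub>m\<parallel>E\<^sub>m)/m\<close>.

  Upper bound: near-optimal \<open>\<rho> \<in> P\<^sub>m\<close>, \<open>\<sigma> \<in> E\<^sub>m\<close> have tensor powers in \<open>P\<^sub>m\<^sub>k\<close>, \<open>E\<^sub>m\<^sub>k\<close>. Cutting
  \<open>\<rho>\<^sup>\<otimes>\<^sup>k\<close> to its typical eigenvalues and then to the typical eigenspaces of \<open>\<sigma>\<^sup>\<otimes>\<^sup>k\<close> disturbs it little
  and yields an operator below \<open>exp (k (D + \<delta>)) \<sigma>\<^sup>\<otimes>\<^sup>k\<close>.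

  Lower bound: grouping the eigenvalues of \<open>\<sigma>\<close> logarithmically and pinching costs a fraction
  \<open>ln 2/\<Delta>\<close> of the entropies plus a constant independent of the dimension, so every pair admits a
  measurement with nearly the full relative entropy. Measurements labelled by likelihood ratios \<open>w\<close>
  have payoffs affine in the pair of states and closed under mixing, so a minimax theorem gives a single
  measurement good for all of \<open>P\<^sub>m \<times> E\<^sub>m\<close>. By the polar set condition the bounds on the moments
  \<open>w\<close> and \<open>w\<^sup>-\<^sup>s\<close> tensorise, and thresholding the product measurement is the required test.
\<close>

section \<open>Inner products and the spectral theorem\<close>

text \<open>The obstacle is the measurement within one block. Pinching in the eigenbasis of \<sigma>
  ordinarily costs the logarithm of the number of distinct eigenvalues, possibly
  \<open>m * ln d\<close>, which would survive division by \<open>m\<close>. Bins of logarithmic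
  width \<Delta> alone do not help: tiny eigenvalues make their number unbounded. Bin
  \<open>G\<close> is therefore charged \<open>(G + 1) * ln 2\<close>, as in a prefix code. The
  weights \<open>(1/2) ^ (G + 1)\<close> sum to at most 1 however many bins there are, and as
  \<open>\<Delta> * G\<close> is about minus the logarithm of the eigenvalue, the charge is a
  fraction \<open>ln 2 / \<Delta>\<close> of a term already present. Fixing \<Delta> first and then
  a large \<open>m\<close> makes all losses small against \<open>m\<close>. A single measurement for
  the whole block is forced by the polar condition, which speaks only of operators bounded on the
  entire set. Convergence of the relative entropy rate does not come from subadditivity: the work
  rate is eventually below every number above the infimum of the rates and eventually above every
  number below their limsup, so these two coincide.\<close>

lemma mult_entry:
  fixes A B :: "complex mat"
  assumes "A \<in> carrier_mat n m" "B \<in> carrier_mat m k" "i < n" "j < k"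
  shows "(A * B) $$ (i, j) = (\<Sum>l<m. A $$ (i, l) * B $$ (l, j))"
  using assms by (auto simp: scalar_prod_def lessThan_atLeast0 intro!: sum.cong)

lemma adjoint_carrier:
  fixes A :: "complex mat"
  assumes "A \<in> carrier_mat n m"
  shows "mat_adjoint A \<in> carrier_mat m n"
  using assms unfolding mat_adjoint_def by (auto intro!: mat_of_rows_carrier)

lemma adjoint_entry:
  fixes A :: "complex mat"
  assumes "A \<in> carrier_mat n m" "i < m" "j < n"
  shows "mat_adjoint A $$ (i, j) = cnj (A $$ (j, i))"
  using assms unfolding mat_adjoint_def by (auto simp: mat_of_rows_index)

text \<open>Conjugate-linear in the first argument. Vectors are plain functions of which only the
  values below \<open>N\<close> count, so that no carrier conditions arise.\<close>

definition ip :: "nat \<Rightarrow> (nat \<Rightarrow> complex) \<Rightarrow> (nat \<Rightarrow> complex) \<Rightarrow> complex" where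
  "ip N u v = (\<Sum>i<N. cnj (u i) * v i)"

definition nsq :: "nat \<Rightarrow> (nat \<Rightarrow> complex) \<Rightarrow> real" where
  "nsq N u = (\<Sum>i<N. (cmod (u i))\<^sup>2)"

definition mv :: "nat \<Rightarrow> complex mat \<Rightarrow> (nat \<Rightarrow> complex) \<Rightarrow> nat \<Rightarrow> complex" where
  "mv N A v = (\<lambda>i. \<Sum>j<N. A $$ (i, j) * v j)"

definition sesq :: "nat \<Rightarrow> complex mat \<Rightarrow> (nat \<Rightarrow> complex) \<Rightarrow> (nat \<Rightarrow> complex) \<Rightarrow> complex" where
  "sesq N A u v = ip N u (mv N A v)"

definition qf :: "nat \<Rightarrow> complex mat \<Rightarrow> (nat \<Rightarrow> complex) \<Rightarrow> real" where
  "qf N A u = Re (sesq N A u u)"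

definition herm :: "nat \<Rightarrow> complex mat \<Rightarrow> bool" where
  "herm N A \<longleftrightarrow> (\<forall>i<N. \<forall>j<N. A $$ (j, i) = cnj (A $$ (i, j)))"

lemma cnj_mult_self: "cnj z * z = of_real ((cmod z)\<^sup>2)"
  by (metis complex_norm_square mult.commute of_real_power)

lemma ip_commute: "ip N v u = cnj (ip N u v)"
  by (simp add: ip_def mult.commute)

lemma ip_self: "ip N u u = of_real (nsq N u)"
  by (simp add: ip_def nsq_def cnj_mult_self)

lemma nsq_nonneg: "0 \<le> nsq N u"
  by (simp add: nsq_def sum_nonneg)

lemma nsq_eq_0: "nsq N u = 0 \<Longrightarrow> i < N \<Longrightarrow> u i = 0"
  by (simp add: nsq_def sum_nonneg_eq_0_iff)

lemma ip_cong: "(\<And>i. i < N \<Longrightarrow> u i = u' i) \<Longrightarrow> (\<And>i. i < N \<Longrightarrow> v i = v' i) \<Longrightarrow> ip N u v = ip N u' v'"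
  by (simp add: ip_def)

lemma nsq_cong: "(\<And>i. i < N \<Longrightarrow> u i = u' i) \<Longrightarrow> nsq N u = nsq N u'"
  by (simp add: nsq_def)

lemma ip_add: "ip N u (\<lambda>i. v i + w i) = ip N u v + ip N u w"
  by (simp add: ip_def algebra_simps sum.distrib)

lemma ip_diff: "ip N u (\<lambda>i. v i - w i) = ip N u v - ip N u w"
  by (simp add: ip_def algebra_simps sum_subtractf)

lemma ip_scale: "ip N u (\<lambda>i. c * v i) = c * ip N u v"
  by (simp add: ip_def sum_distrib_left mult.left_commute)

lemma ip_scale_left: "ip N (\<lambda>i. c * u i) v = cnj c * ip N u v"
  by (simp add: ip_def sum_distrib_left mult.assoc)

lemma ip_add_left: "ip N (\<lambda>i. v i + w i) u = ip N v u + ip N w u"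
  by (simp add: ip_def algebra_simps sum.distrib)

lemma ip_diff_left: "ip N (\<lambda>i. v i - w i) u = ip N v u - ip N w u"
  by (simp add: ip_def algebra_simps sum_subtractf)

lemma ip_sum: "ip N u (\<lambda>i. \<Sum>k\<in>K. c k * v k i) = (\<Sum>k\<in>K. c k * ip N u (v k))"
proof -
  have "ip N u (\<lambda>i. \<Sum>k\<in>K. c k * v k i) = (\<Sum>i<N. \<Sum>k\<in>K. c k * (cnj (u i) * v k i))"
    unfolding ip_def by (simp add: sum_distrib_left mult.left_commute)
  also have "\<dots> = (\<Sum>k\<in>K. \<Sum>i<N. c k * (cnj (u i) * v k i))" by (rule sum.swap)
  finally show ?thesis by (simp add: ip_def sum_distrib_left)
qed

lemma ip_sum_left: "ip N (\<lambda>i. \<Sum>k\<in>K. c k * v k i) u = (\<Sum>k\<in>K. cnj (c k) * ip N (v k) u)"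
  by (subst ip_commute, subst ip_sum) (simp add: ip_commute[of N u])

lemma mv_add: "mv N A (\<lambda>i. v i + w i) = (\<lambda>i. mv N A v i + mv N A w i)"
  by (simp add: mv_def algebra_simps sum.distrib)

lemma mv_scale: "mv N A (\<lambda>i. c * v i) = (\<lambda>i. c * mv N A v i)"
  by (simp add: mv_def sum_distrib_left mult.left_commute)

lemma mv_cong: "(\<And>i. i < N \<Longrightarrow> v i = v' i) \<Longrightarrow> mv N A v = mv N A v'"
  by (simp add: mv_def)

lemma sesq_eq: "sesq N A u v = (\<Sum>i<N. \<Sum>j<N. cnj (u i) * A $$ (i, j) * v j)"
  by (simp add: sesq_def ip_def mv_def sum_distrib_left mult.assoc)

lemma herm_mv: assumes "herm N A" shows "ip N u (mv N A v) = ip N (mv N A u) v"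
proof -
  have "ip N (mv N A u) v = (\<Sum>i<N. \<Sum>j<N. cnj (A $$ (i, j)) * cnj (u j) * v i)"
    by (simp add: ip_def mv_def sum_distrib_right)
  also have "\<dots> = (\<Sum>j<N. \<Sum>i<N. cnj (A $$ (i, j)) * cnj (u j) * v i)" by (rule sum.swap)
  also have "\<dots> = (\<Sum>j<N. \<Sum>i<N. cnj (u j) * A $$ (j, i) * v i)"
  proof (intro sum.cong refl)
    fix i j assume "i \<in> {..<N}" "j \<in> {..<N}"
    hence "A $$ (j, i) = cnj (A $$ (i, j))" using assms unfolding herm_def by blast
    thus "cnj (A $$ (i, j)) * cnj (u j) * v i = cnj (u j) * A $$ (j, i) * v i"
      by (simp only: mult.commute)
  qed
  finally show ?thesis using sesq_eq[of N A u v] by (simp add: sesq_def)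
qed

lemma sesq_commute: "herm N A \<Longrightarrow> sesq N A v u = cnj (sesq N A u v)"
  unfolding sesq_def by (metis herm_mv ip_commute)

section \<open>Eigenvectors by minimising the Rayleigh quotient\<close>

lemma continuous_coord [continuous_intros]: "continuous_on S (\<lambda>x::nat \<Rightarrow> complex. x i)"
  by (rule continuous_on_product_coordinates[THEN continuous_on_subset]) simp

text \<open>Forcing the coordinates from \<open>N\<close> on to vanish places the set inside a
  product of discs and singletons, which is compact by Tychonoff's theorem.\<close>

lemma compact_unit_vectors:
  "compact {x::nat \<Rightarrow> complex. (\<forall>i\<ge>N. x i = 0) \<and> nsq N x = 1 \<and> (\<forall>j<k. ip N (e j) x = 0)}"
  (is "compact ?S")
proof -
  let ?C = "PiE UNIV (\<lambda>i. if i < N then cball 0 1 else {0::complex})"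
  have "compactin (product_topology (\<lambda>i. euclidean) UNIV) ?C"
    by (subst compactin_PiE) (auto simp: compactin_euclidean_iff)
  hence C: "compact ?C"
    by (simp add: euclidean_product_topology compactin_euclidean_iff)
  have cl: "closed ?S"
    unfolding nsq_def ip_def
    by (intro closed_Collect_conj closed_Collect_all closed_Collect_imp closed_Collect_eq
        continuous_intros) auto
  have sub: "?S \<subseteq> ?C"
  proof
    fix x assume x: "x \<in> ?S"
    have "cmod (x i) \<le> 1" if "i < N" for i
    proof -
      have "(cmod (x i))\<^sup>2 \<le> nsq N x" unfolding nsq_def
        using that by (intro member_le_sum) auto
      thus ?thesis using x by (simp add: power_le_one_iff)
    qed
    thus "x \<in> ?C" using x by (auto simp: PiE_UNIV_domain)
  qed
  have "?S = ?C \<inter> ?S" using sub by blast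
  thus ?thesis using compact_Int_closed[OF C cl] by simp
qed

text \<open>The squared moduli of all \<open>e j\<close> add up to \<open>k < N\<close> over the
  coordinates, so some standard basis vector has a projection of squared norm below 1 onto their
  span; what remains of it is nonzero and gets normalised.\<close>

lemma unit_vector_orthogonal_exists:
  assumes k: "k < N"
    and on: "\<And>j l. j < k \<Longrightarrow> l < k \<Longrightarrow> ip N (e j) (e l) = (if j = l then 1 else 0)"
  shows "\<exists>x. (\<forall>i\<ge>N. x i = 0) \<and> nsq N x = 1 \<and> (\<forall>j<k. ip N (e j) x = 0)"
proof -
  have "(\<Sum>a<N. \<Sum>j<k. (cmod (e j a))\<^sup>2) = (\<Sum>j<k. \<Sum>a<N. (cmod (e j a))\<^sup>2)" by (rule sum.swap)
  also have "\<dots> = (\<Sum>j<k. 1)"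
  proof (intro sum.cong refl)
    fix j assume "j \<in> {..<k}"
    hence "complex_of_real (nsq N (e j)) = 1" using on[of j j] by (simp add: ip_self)
    hence "nsq N (e j) = 1" by (simp only: of_real_eq_1_iff)
    thus "(\<Sum>a<N. (cmod (e j a))\<^sup>2) = 1" by (simp add: nsq_def)
  qed
  also have "\<dots> < (\<Sum>a<N. 1)" using k by simp
  finally have "\<exists>a<N. (\<Sum>j<k. (cmod (e j a))\<^sup>2) < 1"
    by (metis (no_types, lifting) lessThan_iff linorder_not_le sum_mono)
  then obtain a where a: "a < N" "(\<Sum>j<k. (cmod (e j a))\<^sup>2) < 1" by blast
  define d :: "nat \<Rightarrow> complex" where "d = (\<lambda>i. if i = a then 1 else 0)"
  define y where "y = (\<lambda>i. d i - (\<Sum>j<k. cnj (e j a) * e j i))"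
  have orth: "ip N (e l) y = 0" if "l < k" for l
  proof -
    have "ip N (e l) d = cnj (e l a)"
      using a unfolding ip_def d_def by (simp add: if_distrib[of "\<lambda>x. _ * x"] cong: if_cong)
    moreover have "(\<Sum>j<k. cnj (e j a) * ip N (e l) (e j)) = (\<Sum>j<k. if j = l then cnj (e l a) else 0)"
      using on that by (intro sum.cong) auto
    ultimately show ?thesis using that unfolding y_def ip_diff ip_sum by simp
  qed
  have "y a = 1 - of_real (\<Sum>j<k. (cmod (e j a))\<^sup>2)"
    unfolding y_def d_def by (simp add: cnj_mult_self)
  hence "y a \<noteq> 0" using a by (metis eq_iff_diff_eq_0 less_irrefl of_real_1 of_real_eq_iff)
  hence "nsq N y \<noteq> 0" using nsq_eq_0 a by blast
  hence pos: "nsq N y > 0" using nsq_nonneg[of N y] by simp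
  define x where "x = (\<lambda>i. if i < N then of_real (1 / sqrt (nsq N y)) * y i else 0)"
  have "nsq N x = (\<Sum>i<N. (1 / sqrt (nsq N y))\<^sup>2 * (cmod (y i))\<^sup>2)"
    unfolding nsq_def[of N x]
    using pos by (intro sum.cong) (auto simp: x_def norm_divide power_divide)
  hence "nsq N x = (1 / sqrt (nsq N y))\<^sup>2 * nsq N y"
    by (simp add: nsq_def sum_distrib_left)
  hence "nsq N x = 1" using pos by (simp add: power_divide)
  moreover have "ip N (e j) x = of_real (1 / sqrt (nsq N y)) * ip N (e j) y" for j
    unfolding ip_scale[symmetric] by (rule ip_cong) (auto simp: x_def)
  ultimately show ?thesis using orth by (intro exI[of _ x]) (auto simp: x_def)
qed

text \<open>A minimiser of the Rayleigh quotient over the unit vectors orthogonal to the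
  eigenvectors found so far is again an eigenvector.\<close>
lemma next_eigenvector:
  assumes h: "herm N A" and k: "k < N"
    and on: "\<And>j l. j < k \<Longrightarrow> l < k \<Longrightarrow> ip N (e j) (e l) = (if j = l then 1 else 0)"
    and ev: "\<And>j i. j < k \<Longrightarrow> i < N \<Longrightarrow> mv N A (e j) i = of_real (lam j) * e j i"
  shows "\<exists>x l. ip N x x = 1 \<and> (\<forall>j<k. ip N (e j) x = 0) \<and> (\<forall>i<N. mv N A x i = of_real l * x i)"
proof -
  let ?S = "{x. (\<forall>i\<ge>N. x i = 0) \<and> nsq N x = 1 \<and> (\<forall>j<k. ip N (e j) x = 0)}"
  have ne: "?S \<noteq> {}" using unit_vector_orthogonal_exists[OF k on] by auto
  have "continuous_on ?S (\<lambda>x. qf N A x)"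
    unfolding qf_def sesq_eq by (intro continuous_intros)
  from continuous_attains_inf[OF compact_unit_vectors ne this]
  obtain x where x: "x \<in> ?S" and min: "\<And>y. y \<in> ?S \<Longrightarrow> qf N A x \<le> qf N A y" by blast
  define l where "l = qf N A x"
  \<comment> \<open>Homogeneity extends minimality from unit vectors to all vectors orthogonal to
    the earlier eigenvectors.\<close>
  have ge: "l * nsq N y \<le> qf N A y" if y: "\<And>j. j < k \<Longrightarrow> ip N (e j) y = 0" for y
  proof (cases "nsq N y = 0")
    case True
    hence "mv N A y = mv N A (\<lambda>i. 0)" using nsq_eq_0 by (intro mv_cong) auto
    hence "qf N A y = 0" by (simp add: qf_def sesq_def ip_def mv_def)
    thus ?thesis using True by simp
  next
    case False
    hence pos: "nsq N y > 0" using nsq_nonneg[of N y] by simp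
    define c where "c = 1 / sqrt (nsq N y)"
    have c2: "c * c * nsq N y = 1" using pos by (simp add: c_def)
    define z where "z = (\<lambda>i. if i < N then of_real c * y i else 0)"
    have ipz: "ip N u z = of_real c * ip N u y" for u
      unfolding ip_scale[symmetric] by (rule ip_cong) (auto simp: z_def)
    have ipz': "ip N z u = of_real c * ip N y u" for u
      using ipz[of u] ip_commute[of N z u] ip_commute[of N y u] by simp
    have "complex_of_real (nsq N z) = of_real (c * c * nsq N y)"
      unfolding ip_self[symmetric] ipz' ipz by (simp add: ip_self)
    hence "nsq N z = 1" using c2 by (metis of_real_eq_iff)
    hence "z \<in> ?S" using y ipz by (auto simp: z_def)
    hence "l \<le> qf N A z" using min unfolding l_def by simp
    moreover have "mv N A z = mv N A (\<lambda>i. of_real c * y i)" by (rule mv_cong) (auto simp: z_def)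
    hence "sesq N A z z = of_real (c * c) * sesq N A y y"
      unfolding sesq_def by (simp add: ipz' mv_scale ip_scale)
    hence "qf N A z = c * c * qf N A y" by (simp add: qf_def)
    ultimately have "l * nsq N y \<le> (c * c * nsq N y) * qf N A y"
      using pos mult_right_mono[of l "qf N A z" "nsq N y"] by (simp add: mult_ac)
    thus ?thesis using c2 by simp
  qed
  define z where "z = (\<lambda>i. mv N A x i - of_real l * x i)"
  have orthx: "ip N (e j) x = 0" if "j < k" for j using x that by auto
  have orthz: "ip N (e j) z = 0" if "j < k" for j
  proof -
    have "ip N (e j) (mv N A x) = ip N (mv N A (e j)) x" by (rule herm_mv[OF h])
    also have "\<dots> = ip N (\<lambda>i. of_real (lam j) * e j i) x" using ev that by (intro ip_cong) auto
    also have "\<dots> = 0" using orthx that by (simp add: ip_scale_left)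
    finally show ?thesis using orthx that by (simp add: z_def ip_diff ip_scale)
  qed
  have "nsq N z = 0"
  proof (rule ccontr)
    assume "nsq N z \<noteq> 0"
    hence pos: "nsq N z > 0" using nsq_nonneg[of N z] by simp
    define c where "c = qf N A z - l * nsq N z"
    \<comment> \<open>First variation: moving from the minimiser by \<open>t\<close> times the
      residual \<open>z\<close> changes \<open>qf N A - l * nsq N\<close> by exactly this amount, so
      the linear coefficient must vanish.\<close>
    have key: "0 \<le> 2 * t * nsq N z + t * t * c" for t :: real
    proof -
      define y where "y = (\<lambda>i. x i + of_real t * z i)"
      have "l * nsq N y \<le> qf N A y" using orthx orthz by (intro ge) (simp add: y_def ip_add ip_scale)
      moreover have "sesq N A y y = sesq N A x x + of_real t * sesq N A z x
          + of_real t * sesq N A x z + of_real (t * t) * sesq N A z z"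
        unfolding sesq_def y_def mv_add mv_scale
        by (simp add: ip_add ip_scale ip_add_left ip_scale_left algebra_simps)
      hence "qf N A y = l + 2 * t * Re (sesq N A z x) + t * t * qf N A z"
        using sesq_commute[OF h, of x z] by (simp add: qf_def l_def)
      moreover have "ip N y y = ip N x x + of_real t * ip N z x + of_real t * ip N x z
          + of_real (t * t) * ip N z z"
        unfolding y_def by (simp add: ip_add ip_scale ip_add_left ip_scale_left algebra_simps)
      hence "Re (ip N y y) = Re (ip N x x) + 2 * t * Re (ip N z x) + t * t * Re (ip N z z)"
        using ip_commute[of N x z] by simp
      hence ny: "nsq N y = 1 + 2 * t * Re (ip N z x) + t * t * nsq N z"
        using x by (simp add: ip_self)
      moreover have "ip N z z = sesq N A z x - of_real l * ip N z x"
        by (subst (2) z_def) (simp add: ip_diff ip_scale sesq_def)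
      hence nz: "nsq N z = Re (sesq N A z x) - l * Re (ip N z x)"
        by (simp add: ip_self complex_eq_iff)
      moreover have "2 * t * nsq N z = 2 * t * Re (sesq N A z x) - 2 * t * (l * Re (ip N z x))"
        unfolding nz by (simp only: right_diff_distrib)
      moreover have "l * nsq N y
          = l + 2 * t * (l * Re (ip N z x)) + t * t * (l * nsq N z)"
        unfolding ny by (simp add: algebra_simps)
      moreover have "t * t * c = t * t * qf N A z - t * t * (l * nsq N z)"
        unfolding c_def by (simp only: right_diff_distrib)
      ultimately show ?thesis by linarith
    qed
    \<comment> \<open>Negative, and so small that \<open>t * c\<close> cannot outweigh
      \<open>2 * nsq N z\<close>.\<close>
    define t where "t = - nsq N z / (\<bar>c\<bar> + 1)"
    have t: "t < 0" using pos by (simp add: t_def divide_neg_pos)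
    have "\<bar>t * c\<bar> = nsq N z * (\<bar>c\<bar> / (\<bar>c\<bar> + 1))" using pos by (simp add: t_def abs_mult)
    also have "\<dots> \<le> nsq N z * 1" using pos by (intro mult_left_mono) auto
    finally have "0 < 2 * nsq N z + t * c" using pos by linarith
    hence "t * (2 * nsq N z + t * c) < 0" using t by (simp add: mult_neg_pos)
    thus False using key[of t] by (simp add: algebra_simps)
  qed
  hence "\<forall>i<N. mv N A x i = of_real l * x i" using nsq_eq_0[of N z] by (auto simp: z_def)
  thus ?thesis using x orthx by (intro exI[of _ x] exI[of _ l]) (auto simp: ip_self)
qed

definition onb :: "nat \<Rightarrow> (nat \<Rightarrow> nat \<Rightarrow> complex) \<Rightarrow> bool" where
  "onb N e \<longleftrightarrow> (\<forall>k<N. \<forall>l<N. ip N (e k) (e l) = (if k = l then 1 else 0)) \<and>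
     (\<forall>i<N. \<forall>j<N. (\<Sum>k<N. e k i * cnj (e k j)) = (if i = j then 1 else 0))"

text \<open>A relation, because the decomposition is not unique; no order of the eigenvalues is
  imposed.\<close>

definition spec :: "nat \<Rightarrow> complex mat \<Rightarrow> (nat \<Rightarrow> real) \<Rightarrow> (nat \<Rightarrow> nat \<Rightarrow> complex) \<Rightarrow> bool" where
  "spec N A lam e \<longleftrightarrow> A \<in> carrier_mat N N \<and> onb N e \<and>
     (\<forall>i<N. \<forall>j<N. A $$ (i, j) = (\<Sum>k<N. of_real (lam k) * (e k i * cnj (e k j))))"

text \<open>Completeness follows from orthonormality: a left inverse of a square matrix is also a
  right inverse.\<close>

lemma onbI:
  assumes on: "\<And>k l. k < N \<Longrightarrow> l < N \<Longrightarrow> ip N (e k) (e l) = (if k = l then 1 else 0)"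
  shows "onb N e"
proof -
  define U where "U = mat N N (\<lambda>(i, k). e k i)"
  define V where "V = mat N N (\<lambda>(k, i). cnj (e k i))"
  have U: "U \<in> carrier_mat N N" and V: "V \<in> carrier_mat N N" by (auto simp: U_def V_def)
  have "V * U = 1\<^sub>m N"
  proof (rule eq_matI)
    fix i j assume "i < dim_row (1\<^sub>m N :: complex mat)" "j < dim_col (1\<^sub>m N :: complex mat)"
    hence ij: "i < N" "j < N" by auto
    have "(V * U) $$ (i, j) = ip N (e i) (e j)"
      using mult_entry[OF V U ij] ij by (simp add: ip_def U_def V_def)
    thus "(V * U) $$ (i, j) = 1\<^sub>m N $$ (i, j)" using on ij by simp
  qed (use U V in auto)
  hence UV: "U * V = 1\<^sub>m N" using mat_mult_left_right_inverse[OF V U] by simp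
  have "(\<Sum>k<N. e k i * cnj (e k j)) = (if i = j then 1 else 0)" if ij: "i < N" "j < N" for i j
    using mult_entry[OF U V ij] ij unfolding UV by (simp add: U_def V_def)
  thus ?thesis using on by (simp add: onb_def)
qed

text \<open>\<open>next_eigenvector\<close> is repeated until the space is exhausted; applying
  \<open>A\<close> to the completeness relation then gives the expansion.\<close>

theorem spec_exists:
  assumes A: "A \<in> carrier_mat N N" and h: "herm N A"
  shows "\<exists>lam e. spec N A lam e"
proof -
  have "\<exists>e lam. (\<forall>j<k. \<forall>l<k. ip N (e j) (e l) = (if j = l then 1 else 0)) \<and>
      (\<forall>j<k. \<forall>i<N. mv N A (e j) i = of_real (lam j) * e j i)" if "k \<le> N" for k
    using that
  proof (induction k)
    case 0 show ?case by simp
  next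
    case (Suc k)
    then obtain e lam where e: "\<forall>j<k. \<forall>l<k. ip N (e j) (e l) = (if j = l then 1 else 0)"
      "\<forall>j<k. \<forall>i<N. mv N A (e j) i = of_real (lam j) * e j i" by auto
    obtain x l where x: "ip N x x = 1" "\<forall>j<k. ip N (e j) x = 0"
      "\<forall>i<N. mv N A x i = of_real l * x i"
      using next_eigenvector[OF h, of k e lam] e Suc.prems by auto
    have x': "\<forall>j<k. ip N x (e j) = 0" using x(2) by (subst ip_commute) simp
    show ?case
      by (rule exI[of _ "e(k := x)"], rule exI[of _ "lam(k := l)"])
        (use e x x' in \<open>auto simp: less_Suc_eq\<close>)
  qed
  from this[of N] obtain e lam where on: "\<forall>j<N. \<forall>l<N. ip N (e j) (e l) = (if j = l then 1 else 0)"
    and ev: "\<forall>j<N. \<forall>i<N. mv N A (e j) i = of_real (lam j) * e j i" by auto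
  have onb: "onb N e" by (rule onbI) (use on in auto)
  have "A $$ (i, j) = (\<Sum>k<N. of_real (lam k) * (e k i * cnj (e k j)))" if ij: "i < N" "j < N" for i j
  proof -
    have "(\<Sum>k<N. of_real (lam k) * (e k i * cnj (e k j))) = (\<Sum>k<N. mv N A (e k) i * cnj (e k j))"
      using ev ij by (simp add: mult.assoc)
    also have "\<dots> = (\<Sum>k<N. \<Sum>l<N. A $$ (i, l) * (e k l * cnj (e k j)))"
      by (simp add: mv_def sum_distrib_right mult.assoc)
    also have "\<dots> = (\<Sum>l<N. \<Sum>k<N. A $$ (i, l) * (e k l * cnj (e k j)))" by (rule sum.swap)
    also have "\<dots> = (\<Sum>l<N. A $$ (i, l) * (if l = j then 1 else 0))"
      using onb ij by (intro sum.cong refl) (simp add: sum_distrib_left[symmetric] onb_def)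
    also have "\<dots> = A $$ (i, j)" using ij by (simp add: if_distrib[of "\<lambda>x. _ * x"] cong: if_cong)
    finally show ?thesis by simp
  qed
  thus ?thesis using A onb by (auto simp: spec_def)
qed

section \<open>Positive semidefiniteness through quadratic forms\<close>

lemma hermitian_imp_herm: "A \<in> carrier_mat N N \<Longrightarrow> hermitian A \<Longrightarrow> herm N A"
  unfolding hermitian_def herm_def using adjoint_entry[of A N N]
  by (metis complex_cnj_cnj)

lemma herm_imp_hermitian:
  assumes A: "A \<in> carrier_mat N N" and "herm N A" shows "hermitian A"
proof -
  have "mat_adjoint A = A"
  proof (rule eq_matI)
    fix i j assume "i < dim_row A" "j < dim_col A"
    hence ij: "i < N" "j < N" using A by auto
    hence "A $$ (i, j) = cnj (A $$ (j, i))" using assms(2) unfolding herm_def by blast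
    thus "mat_adjoint A $$ (i, j) = A $$ (i, j)" using adjoint_entry[OF A ij] by (simp only:)
  qed (use adjoint_carrier[OF A] A in auto)
  thus ?thesis using A by (auto simp: hermitian_def)
qed

lemma cscalar_qf:
  assumes A: "A \<in> carrier_mat N N" and v: "v \<in> carrier_vec N"
  shows "(A *\<^sub>v v) \<bullet>c v = sesq N A (\<lambda>i. v $ i) (\<lambda>i. v $ i)"
proof -
  have "(A *\<^sub>v v) \<bullet>c v = (\<Sum>i<N. (\<Sum>j<N. A $$ (i, j) * v $ j) * cnj (v $ i))"
    using assms by (auto simp: scalar_prod_def lessThan_atLeast0 intro!: sum.cong)
  thus ?thesis by (simp add: sesq_def ip_def mv_def mult.commute)
qed

lemma qf_cong: "(\<And>i. i < N \<Longrightarrow> u i = u' i) \<Longrightarrow> qf N A u = qf N A u'"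
  unfolding qf_def sesq_eq by simp

lemma psd_iff:
  assumes A: "A \<in> carrier_mat N N"
  shows "psd A \<longleftrightarrow> herm N A \<and> (\<forall>u. 0 \<le> qf N A u)"
proof
  assume p: "psd A"
  have "0 \<le> qf N A u" for u
  proof -
    define v where "v = vec N u"
    have "0 \<le> Re ((A *\<^sub>v v) \<bullet>c v)" using p A by (auto simp: psd_def v_def)
    hence "0 \<le> qf N A (\<lambda>i. v $ i)" using cscalar_qf[OF A, of v] by (simp add: v_def qf_def)
    also have "qf N A (\<lambda>i. v $ i) = qf N A u" by (rule qf_cong) (simp add: v_def)
    finally show ?thesis .
  qed
  thus "herm N A \<and> (\<forall>u. 0 \<le> qf N A u)" using p A hermitian_imp_herm by (auto simp: psd_def)
next
  assume "herm N A \<and> (\<forall>u. 0 \<le> qf N A u)"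
  thus "psd A" using A cscalar_qf[OF A] herm_imp_hermitian[OF A] by (auto simp: psd_def qf_def)
qed

lemma psd_herm: "A \<in> carrier_mat N N \<Longrightarrow> psd A \<Longrightarrow> herm N A"
  by (simp add: psd_iff)

lemma psd_qf: "A \<in> carrier_mat N N \<Longrightarrow> psd A \<Longrightarrow> 0 \<le> qf N A u"
  by (simp add: psd_iff)

section \<open>Functional calculus and trace distance\<close>

lemma onb_orth: "onb N e \<Longrightarrow> k < N \<Longrightarrow> l < N \<Longrightarrow> ip N (e k) (e l) = (if k = l then 1 else 0)"
  by (simp add: onb_def)

lemma onb_complete: "onb N e \<Longrightarrow> i < N \<Longrightarrow> j < N \<Longrightarrow> (\<Sum>k<N. e k i * cnj (e k j)) = (if i = j then 1 else 0)"
  by (simp add: onb_def)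

lemma onb_nsq: "onb N e \<Longrightarrow> k < N \<Longrightarrow> nsq N (e k) = 1"
  using onb_orth[of N e k k] by (simp add: ip_self)

lemma onb_expand:
  assumes "onb N e" "i < N"
  shows "u i = (\<Sum>k<N. ip N (e k) u * e k i)"
proof -
  have "(\<Sum>k<N. ip N (e k) u * e k i) = (\<Sum>k<N. \<Sum>j<N. u j * (e k i * cnj (e k j)))"
    unfolding ip_def sum_distrib_right by (intro sum.cong refl) (simp add: mult_ac)
  also have "\<dots> = (\<Sum>j<N. \<Sum>k<N. u j * (e k i * cnj (e k j)))" by (rule sum.swap)
  also have "\<dots> = (\<Sum>j<N. u j * (if i = j then 1 else 0))"
    using assms by (intro sum.cong refl) (simp add: sum_distrib_left[symmetric] onb_complete)
  also have "\<dots> = u i" using assms by (simp add: if_distrib[of "\<lambda>x. _ * x"] cong: if_cong)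
  finally show ?thesis by simp
qed

lemma parseval_ip:
  assumes "onb N e"
  shows "ip N u v = (\<Sum>k<N. ip N u (e k) * ip N (e k) v)"
proof -
  have "ip N u v = ip N u (\<lambda>i. \<Sum>k<N. ip N (e k) v * e k i)"
    by (intro ip_cong refl onb_expand[OF assms])
  thus ?thesis unfolding ip_sum by (simp add: mult.commute)
qed

lemma ip_mult_swap: "ip N u v * ip N v u = of_real ((cmod (ip N v u))\<^sup>2)"
  by (subst ip_commute) (simp add: cnj_mult_self)

lemma parseval:
  assumes "onb N e"
  shows "nsq N u = (\<Sum>k<N. (cmod (ip N (e k) u))\<^sup>2)"
proof -
  have "complex_of_real (nsq N u) = of_real (\<Sum>k<N. (cmod (ip N (e k) u))\<^sup>2)"
    unfolding ip_self[symmetric] parseval_ip[OF assms, of u u] by (simp only: ip_mult_swap of_real_sum)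
  thus ?thesis by (simp only: of_real_eq_iff)
qed

text \<open>Complex coefficients are allowed because the diagonal matrix in \<open>hfun\<close> is
  not known to be real beforehand.\<close>

lemma sesq_outer_sum:
  assumes "\<And>i j. i < N \<Longrightarrow> j < N \<Longrightarrow> A $$ (i, j) = (\<Sum>k\<in>K. c k * (e k i * cnj (e k j)))"
  shows "sesq N A u v = (\<Sum>k\<in>K. c k * (ip N u (e k) * ip N (e k) v))"
proof -
  have "mv N A v i = (\<Sum>k\<in>K. (c k * ip N (e k) v) * e k i)" if "i < N" for i
  proof -
    have "mv N A v i = (\<Sum>j<N. \<Sum>k\<in>K. (c k * (e k i * cnj (e k j))) * v j)"
      unfolding mv_def using assms that by (intro sum.cong refl) (simp add: sum_distrib_right)
    also have "\<dots> = (\<Sum>k\<in>K. \<Sum>j<N. (c k * (e k i * cnj (e k j))) * v j)" by (rule sum.swap)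
    finally show ?thesis by (simp add: ip_def sum_distrib_left sum_distrib_right mult_ac)
  qed
  hence "sesq N A u v = ip N u (\<lambda>i. \<Sum>k\<in>K. (c k * ip N (e k) v) * e k i)"
    unfolding sesq_def by (intro ip_cong) auto
  thus ?thesis unfolding ip_sum by (simp add: mult_ac)
qed

lemma spec_carrier: "spec N A lam e \<Longrightarrow> A \<in> carrier_mat N N"
  and spec_onb: "spec N A lam e \<Longrightarrow> onb N e"
  by (simp_all add: spec_def)

lemma sesq_spec:
  assumes "spec N A lam e"
  shows "sesq N A u v = (\<Sum>k<N. of_real (lam k) * (ip N u (e k) * ip N (e k) v))"
  by (rule sesq_outer_sum) (use assms in \<open>auto simp: spec_def\<close>)

lemma qf_spec:
  assumes "spec N A lam e"
  shows "qf N A u = (\<Sum>k<N. lam k * (cmod (ip N (e k) u))\<^sup>2)"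
  unfolding qf_def sesq_spec[OF assms] ip_mult_swap by (simp flip: of_real_mult)

lemma sesq_spec_right:
  assumes s: "spec N A lam e" and l: "l < N"
  shows "sesq N A u (e l) = of_real (lam l) * ip N u (e l)"
proof -
  have "sesq N A u (e l) = (\<Sum>k<N. if k = l then of_real (lam l) * ip N u (e l) else 0)"
    unfolding sesq_spec[OF s] using s l by (intro sum.cong refl) (auto simp: spec_def onb_orth)
  thus ?thesis using l by simp
qed

lemma sesq_spec_left:
  assumes s: "spec N A lam e" and l: "l < N"
  shows "sesq N A (e l) u = of_real (lam l) * ip N (e l) u"
proof -
  have "sesq N A (e l) u = (\<Sum>k<N. if k = l then of_real (lam l) * ip N (e l) u else 0)"
    unfolding sesq_spec[OF s] using s l by (intro sum.cong refl) (auto simp: spec_def onb_orth)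
  thus ?thesis using l by simp
qed

lemma qf_spec_vec: "spec N A lam e \<Longrightarrow> k < N \<Longrightarrow> qf N A (e k) = lam k"
  using sesq_spec_right[of N A lam e k "e k"] spec_onb[of N A lam e] by (simp add: qf_def onb_orth)

definition smat :: "nat \<Rightarrow> (nat \<Rightarrow> real) \<Rightarrow> (nat \<Rightarrow> nat \<Rightarrow> complex) \<Rightarrow> complex mat" where
  "smat N lam e = mat N N (\<lambda>(i, j). \<Sum>k<N. of_real (lam k) * (e k i * cnj (e k j)))"

lemma smat_carrier [simp]: "smat N lam e \<in> carrier_mat N N"
  by (simp add: smat_def)

lemma spec_smat: "onb N e \<Longrightarrow> spec N (smat N lam e) lam e"
  by (simp add: spec_def smat_def)

lemma spec_eq_smat: "spec N A lam e \<Longrightarrow> A = smat N lam e"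
  by (rule eq_matI) (auto simp: spec_def smat_def)

lemma mtrace_smat: assumes "onb N e" shows "mtrace (smat N lam e) = of_real (\<Sum>k<N. lam k)"
proof -
  have "mtrace (smat N lam e) = (\<Sum>i<N. \<Sum>k<N. of_real (lam k) * (e k i * cnj (e k i)))"
    by (simp add: mtrace_def smat_def)
  also have "\<dots> = (\<Sum>k<N. \<Sum>i<N. of_real (lam k) * (e k i * cnj (e k i)))" by (rule sum.swap)
  also have "\<dots> = (\<Sum>k<N. of_real (lam k) * ip N (e k) (e k))"
    by (simp add: ip_def sum_distrib_left mult.commute)
  also have "\<dots> = (\<Sum>k<N. of_real (lam k))" using assms by (intro sum.cong) (auto simp: onb_orth)
  finally show ?thesis by simp
qed

lemma herm_smat: "herm N (smat N lam e)"
  by (simp add: herm_def smat_def mult.commute)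

lemma spec_herm: "spec N A lam e \<Longrightarrow> herm N A"
  using herm_smat spec_eq_smat by metis

lemma qf_smat: "onb N e \<Longrightarrow> qf N (smat N lam e) u = (\<Sum>k<N. lam k * (cmod (ip N (e k) u))\<^sup>2)"
  by (rule qf_spec[OF spec_smat])

lemma psd_smat: "onb N e \<Longrightarrow> (\<And>k. k < N \<Longrightarrow> 0 \<le> lam k) \<Longrightarrow> psd (smat N lam e)"
  by (subst psd_iff[of _ N]) (auto simp: herm_smat qf_smat intro!: sum_nonneg)

text \<open>Evaluating \<open>A\<close> between \<open>e k\<close> and \<open>e' l\<close> from
  either side shows that \<open>lam k = lam' l\<close> whenever the two vectors overlap, so
  \<open>f\<close> agrees there as well. This makes the choice in \<open>hfun\<close>
  immaterial.\<close>

lemma smat_unique: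
  assumes s: "spec N A lam e" and s': "spec N A lam' e'"
  shows "smat N (\<lambda>k. f (lam k)) e = smat N (\<lambda>k. f (lam' k)) e'"
proof (rule eq_matI)
  fix i j assume "i < dim_row (smat N (\<lambda>k. f (lam' k)) e')" "j < dim_col (smat N (\<lambda>k. f (lam' k)) e')"
  hence ij: "i < N" "j < N" by (auto simp: smat_def)
  have o: "onb N e" and o': "onb N e'" using s s' spec_onb by auto
  have sw: "of_real (f (lam k)) * ip N (e k) (e' l) = of_real (f (lam' l)) * ip N (e k) (e' l)"
    if "k < N" "l < N" for k l
  proof -
    have "of_real (lam k) * ip N (e k) (e' l) = of_real (lam' l) * ip N (e k) (e' l)"
      using sesq_spec_left[OF s that(1), of "e' l"] sesq_spec_right[OF s' that(2), of "e k"] by argo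
    thus ?thesis by auto
  qed
  have ex: "cnj (e k j) = (\<Sum>l<N. ip N (e k) (e' l) * cnj (e' l j))" if "k < N" for k
    by (subst onb_expand[OF o' ij(2), of "e k"]) (simp add: ip_commute[of N "e k"])
  have ex2: "e' l i = (\<Sum>k<N. ip N (e k) (e' l) * e k i)" for l
    by (rule onb_expand[OF o ij(1)])
  have "smat N (\<lambda>k. f (lam k)) e $$ (i, j)
      = (\<Sum>k<N. \<Sum>l<N. (of_real (f (lam k)) * ip N (e k) (e' l)) * (e k i * cnj (e' l j)))"
    using ij ex by (simp add: smat_def sum_distrib_left mult_ac)
  also have "\<dots> = (\<Sum>k<N. \<Sum>l<N. (of_real (f (lam' l)) * ip N (e k) (e' l)) * (e k i * cnj (e' l j)))"
    using sw by (intro sum.cong refl) auto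
  also have "\<dots> = (\<Sum>l<N. \<Sum>k<N. (of_real (f (lam' l)) * ip N (e k) (e' l)) * (e k i * cnj (e' l j)))"
    by (rule sum.swap)
  also have "\<dots> = (\<Sum>l<N. of_real (f (lam' l)) * (e' l i * cnj (e' l j)))"
    by (subst ex2) (simp add: sum_distrib_left sum_distrib_right mult_ac)
  finally show "smat N (\<lambda>k. f (lam k)) e $$ (i, j) = smat N (\<lambda>k. f (lam' k)) e' $$ (i, j)"
    using ij by (simp add: smat_def)
qed (auto simp: smat_def)

lemma conj_diag_entry:
  assumes U: "U \<in> carrier_mat N N" and D: "D \<in> carrier_mat N N" and d: "diagonal_mat D"
    and ij: "i < N" "j < N"
  shows "(U * D * mat_adjoint U) $$ (i, j) = (\<Sum>k<N. D $$ (k, k) * (U $$ (i, k) * cnj (U $$ (j, k))))"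
proof -
  have "(U * D) $$ (i, k) = U $$ (i, k) * D $$ (k, k)" if "k < N" for k
  proof -
    have "(U * D) $$ (i, k) = (\<Sum>l<N. if l = k then U $$ (i, k) * D $$ (k, k) else 0)"
      unfolding mult_entry[OF U D ij(1) that]
      using d D that by (intro sum.cong refl) (auto simp: diagonal_mat_def)
    thus ?thesis using that by simp
  qed
  thus ?thesis
    using mult_entry[OF mult_carrier_mat[OF U D] adjoint_carrier[OF U] ij] adjoint_entry[OF U] ij
    by (simp add: mult_ac)
qed

lemma conj_diag_smat:
  assumes o: "onb N e"
  shows "mat N N (\<lambda>(i, k). e k i) * mat N N (\<lambda>(i, j). if i = j then of_real (lam i) else 0)
      * mat_adjoint (mat N N (\<lambda>(i, k). e k i)) = smat N lam e" (is "?U * ?D * _ = _")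
proof (rule eq_matI)
  fix i j assume "i < dim_row (smat N lam e)" "j < dim_col (smat N lam e)"
  hence ij: "i < N" "j < N" by (auto simp: smat_def)
  have U: "?U \<in> carrier_mat N N" and D: "?D \<in> carrier_mat N N" and d: "diagonal_mat ?D"
    by (auto simp: diagonal_mat_def)
  show "(?U * ?D * mat_adjoint ?U) $$ (i, j) = smat N lam e $$ (i, j)"
    unfolding conj_diag_entry[OF U D d ij] using ij by (simp add: smat_def)
next
  have "?U \<in> carrier_mat N N" by simp
  from adjoint_carrier[OF this]
  show "dim_row (?U * ?D * mat_adjoint ?U) = dim_row (smat N lam e)"
    "dim_col (?U * ?D * mat_adjoint ?U) = dim_col (smat N lam e)"
    by (auto simp: smat_def)
qed

lemma hfun_spec:
  assumes s: "spec N A lam e"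
  shows "hfun f A = smat N (\<lambda>k. f (lam k)) e"
proof -
  have A: "A \<in> carrier_mat N N" and o: "onb N e" using s spec_carrier spec_onb by auto
  hence dA: "dim_row A = N" by simp
  let ?Q = "\<lambda>B. \<exists>U D. U \<in> carrier_mat N N \<and> mat_adjoint U * U = 1\<^sub>m N \<and>
      D \<in> carrier_mat N N \<and> diagonal_mat D \<and> A = U * D * mat_adjoint U \<and>
      B = U * mat N N (\<lambda>(i, j). if i = j then complex_of_real (f (Re (D $$ (i, i)))) else 0)
        * mat_adjoint U"
  have uniq: "B = smat N (\<lambda>k. f (lam k)) e" if "?Q B" for B
  proof -
    from that obtain U D where U: "U \<in> carrier_mat N N" and UU: "mat_adjoint U * U = 1\<^sub>m N"
      and D: "D \<in> carrier_mat N N" and d: "diagonal_mat D" and AU: "A = U * D * mat_adjoint U"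
      and B: "B = U * mat N N (\<lambda>(i, j). if i = j then complex_of_real (f (Re (D $$ (i, i)))) else 0)
        * mat_adjoint U" by blast
    define e' where "e' = (\<lambda>k i. U $$ (i, k))"
    have Ue: "U = mat N N (\<lambda>(i, k). e' k i)" using U by (auto simp: e'_def)
    have o': "onb N e'"
    proof (rule onbI)
      fix k l assume kl: "k < N" "l < N"
      have "ip N (e' k) (e' l) = (mat_adjoint U * U) $$ (k, l)"
        unfolding mult_entry[OF adjoint_carrier[OF U] U kl] ip_def e'_def
        using adjoint_entry[OF U kl(1)] by simp
      thus "ip N (e' k) (e' l) = (if k = l then 1 else 0)" using kl by (simp add: UU)
    qed
    have Aij: "A $$ (i, j) = (\<Sum>k<N. D $$ (k, k) * (e' k i * cnj (e' k j)))" if "i < N" "j < N" for i j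
      unfolding AU e'_def by (rule conj_diag_entry[OF U D d that])
    \<comment> \<open>\<open>hfun\<close> applies \<open>f\<close> to real parts. Nothing is lost,
      since the diagonal consists of expectation values of a Hermitian matrix.\<close>
    have real: "D $$ (l, l) = of_real (Re (D $$ (l, l)))" if l: "l < N" for l
    proof -
      have "sesq N A (e' l) (e' l) = (\<Sum>k<N. D $$ (k, k) * (ip N (e' l) (e' k) * ip N (e' k) (e' l)))"
        by (rule sesq_outer_sum) (rule Aij)
      also have "\<dots> = (\<Sum>k<N. if k = l then D $$ (l, l) else 0)"
        using o' l by (intro sum.cong refl) (auto simp: onb_orth)
      finally have "sesq N A (e' l) (e' l) = D $$ (l, l)" using l by simp
      moreover have "cnj (sesq N A (e' l) (e' l)) = sesq N A (e' l) (e' l)"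
        using sesq_commute[OF spec_herm[OF s]] by metis
      ultimately show ?thesis by (simp add: complex_eq_iff)
    qed
    have s': "spec N A (\<lambda>k. Re (D $$ (k, k))) e'"
      unfolding spec_def using A o' Aij real by (auto intro!: sum.cong)
    have "B = smat N (\<lambda>k. f (Re (D $$ (k, k)))) e'"
      using conj_diag_smat[OF o', of "\<lambda>k. f (Re (D $$ (k, k)))"] unfolding B Ue[symmetric] .
    thus ?thesis using smat_unique[OF s s', of f] by simp
  qed
  define U where "U = mat N N (\<lambda>(i, k). e k i)"
  define D where "D = mat N N (\<lambda>(i, j). if i = j then complex_of_real (lam i) else 0)"
  have U: "U \<in> carrier_mat N N" by (simp add: U_def)
  have "mat_adjoint U * U = 1\<^sub>m N"
  proof (rule eq_matI)
    fix k l assume "k < dim_row (1\<^sub>m N :: complex mat)" "l < dim_col (1\<^sub>m N :: complex mat)"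
    hence kl: "k < N" "l < N" by auto
    have "(mat_adjoint U * U) $$ (k, l) = ip N (e k) (e l)"
      unfolding mult_entry[OF adjoint_carrier[OF U] U kl] ip_def
      using adjoint_entry[OF U kl(1)] kl by (simp add: U_def)
    thus "(mat_adjoint U * U) $$ (k, l) = 1\<^sub>m N $$ (k, l)" using kl o by (simp add: onb_orth)
  qed (use U adjoint_carrier[OF U] in auto)
  moreover have "A = U * D * mat_adjoint U"
    using conj_diag_smat[OF o, of lam] spec_eq_smat[OF s] unfolding U_def D_def by simp
  moreover have "diagonal_mat D" "D \<in> carrier_mat N N" by (auto simp: diagonal_mat_def D_def)
  ultimately have "\<exists>B. ?Q B" using U by blast
  hence "?Q (SOME B. ?Q B)" by (rule someI_ex)
  thus ?thesis unfolding hfun_def dA by (rule uniq)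
qed

section \<open>Trace norm and trace distance\<close>

lemma trace_norm_spec:
  assumes s: "spec N X lam e"
  shows "trace_norm X = (\<Sum>k<N. \<bar>lam k\<bar>)"
proof -
  have X: "X \<in> carrier_mat N N" and o: "onb N e" using s spec_carrier spec_onb by auto
  have "hermitian X" using herm_imp_hermitian[OF X spec_herm[OF s]] .
  hence adj: "mat_adjoint X = X" by (simp add: hermitian_def)
  have "spec N (X * X) (\<lambda>k. (lam k)\<^sup>2) e"
    unfolding spec_def
  proof (intro conjI allI impI)
    fix i j assume ij: "i < N" "j < N"
    have Xij: "X $$ (i, l) = (\<Sum>k<N. of_real (lam k) * (e k i * cnj (e k l)))"
      "X $$ (l, j) = (\<Sum>k<N. of_real (lam k) * (e k l * cnj (e k j)))" if "l < N" for l
      using s ij that by (auto simp: spec_def)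
    have "(X * X) $$ (i, j) = (\<Sum>l<N. \<Sum>k<N. X $$ (i, l) * (of_real (lam k) * (e k l * cnj (e k j))))"
      unfolding mult_entry[OF X X ij] by (simp add: Xij(2) sum_distrib_left)
    also have "\<dots> = (\<Sum>k<N. \<Sum>l<N. X $$ (i, l) * (of_real (lam k) * (e k l * cnj (e k j))))"
      by (rule sum.swap)
    also have "\<dots> = (\<Sum>k<N. mv N X (e k) i * (of_real (lam k) * cnj (e k j)))"
      by (simp add: mv_def sum_distrib_right sum_distrib_left mult_ac)
    also have "\<dots> = (\<Sum>k<N. of_real ((lam k)\<^sup>2) * (e k i * cnj (e k j)))"
    proof (intro sum.cong refl)
      fix k assume "k \<in> {..<N}"
      hence k: "k < N" by simp
      have d: "ip N (\<lambda>l. if l = i then 1 else 0) u = u i" for u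
        using ij by (simp add: ip_def if_distrib[of cnj] if_distrib[of "\<lambda>x. x * _"] cong: if_cong)
      have "mv N X (e k) i = of_real (lam k) * e k i"
        using sesq_spec_right[OF s k, of "\<lambda>l. if l = i then 1 else 0"] by (simp add: sesq_def d)
      thus "mv N X (e k) i * (of_real (lam k) * cnj (e k j)) = of_real ((lam k)\<^sup>2) * (e k i * cnj (e k j))"
        by (simp add: power2_eq_square)
    qed
    finally show "(X * X) $$ (i, j) = (\<Sum>k<N. of_real ((lam k)\<^sup>2) * (e k i * cnj (e k j)))" .
  qed (use X o in auto)
  thus ?thesis unfolding trace_norm_def adj
    by (simp add: hfun_spec mtrace_smat[OF o] flip: of_real_sum)
qed

lemma qf_add: "A \<in> carrier_mat N N \<Longrightarrow> B \<in> carrier_mat N N \<Longrightarrow> qf N (A + B) u = qf N A u + qf N B u"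
  by (simp add: qf_def sesq_eq algebra_simps sum.distrib)

lemma qf_diff: "A \<in> carrier_mat N N \<Longrightarrow> B \<in> carrier_mat N N \<Longrightarrow> qf N (A - B) u = qf N A u - qf N B u"
  by (simp add: qf_def sesq_eq algebra_simps sum_subtractf)

lemma qf_smult: "A \<in> carrier_mat N N \<Longrightarrow> qf N (of_real c \<cdot>\<^sub>m A) u = c * qf N A u"
proof -
  assume "A \<in> carrier_mat N N"
  hence "sesq N (of_real c \<cdot>\<^sub>m A) u u = of_real c * sesq N A u u"
    by (simp add: sesq_eq sum_distrib_left mult_ac)
  thus ?thesis by (simp add: qf_def)
qed

lemma mtrace_add: "A \<in> carrier_mat N N \<Longrightarrow> B \<in> carrier_mat N N \<Longrightarrow> mtrace (A + B) = mtrace A + mtrace B"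
  by (simp add: mtrace_def sum.distrib)

lemma mtrace_diff: "A \<in> carrier_mat N N \<Longrightarrow> B \<in> carrier_mat N N \<Longrightarrow> mtrace (A - B) = mtrace A - mtrace B"
  by (simp add: mtrace_def sum_subtractf)

lemma mtrace_smult: "mtrace (c \<cdot>\<^sub>m A) = c * mtrace A" if "A \<in> carrier_mat N N"
  using that by (simp add: mtrace_def sum_distrib_left)

lemma herm_add: "A \<in> carrier_mat N N \<Longrightarrow> B \<in> carrier_mat N N \<Longrightarrow> herm N A \<Longrightarrow> herm N B \<Longrightarrow> herm N (A + B)"
  unfolding herm_def by (metis (no_types, lifting) carrier_matD index_add_mat(1) complex_cnj_add)

lemma herm_diff: "A \<in> carrier_mat N N \<Longrightarrow> B \<in> carrier_mat N N \<Longrightarrow> herm N A \<Longrightarrow> herm N B \<Longrightarrow> herm N (A - B)"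
  unfolding herm_def by (metis (no_types, lifting) carrier_matD index_minus_mat(1) complex_cnj_diff)

lemma herm_smult: "A \<in> carrier_mat N N \<Longrightarrow> herm N A \<Longrightarrow> herm N (of_real c \<cdot>\<^sub>m A)"
  unfolding herm_def
  by (metis (no_types, lifting) carrier_matD index_smult_mat(1) complex_cnj_mult complex_cnj_complex_of_real)

lemma dens_carrier: "\<rho> \<in> dens N \<Longrightarrow> \<rho> \<in> carrier_mat N N"
  and dens_psd: "\<rho> \<in> dens N \<Longrightarrow> psd \<rho>"
  and dens_trace: "\<rho> \<in> dens N \<Longrightarrow> mtrace \<rho> = 1"
  by (auto simp: dens_def)

lemma dens_herm: "\<rho> \<in> dens N \<Longrightarrow> herm N \<rho>"
  using psd_herm dens_carrier dens_psd by blast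

lemma dens_qf: "\<rho> \<in> dens N \<Longrightarrow> 0 \<le> qf N \<rho> u"
  using psd_qf dens_carrier dens_psd by blast

lemma spec_trace: "spec N A lam e \<Longrightarrow> mtrace A = of_real (\<Sum>k<N. lam k)"
  using spec_eq_smat mtrace_smat spec_onb by metis

lemma dens_spec:
  assumes "\<rho> \<in> dens N"
  obtains r f where "spec N \<rho> r f" "\<And>k. k < N \<Longrightarrow> 0 \<le> r k" "(\<Sum>k<N. r k) = 1" "\<And>k. k < N \<Longrightarrow> r k \<le> 1"
proof -
  from spec_exists[OF dens_carrier[OF assms] dens_herm[OF assms]]
  obtain r f where s: "spec N \<rho> r f" by blast
  have nn: "0 \<le> r k" if "k < N" for k
    using qf_spec_vec[OF s that] dens_qf[OF assms, of "f k"] by simp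
  have "complex_of_real (\<Sum>k<N. r k) = 1" using spec_trace[OF s] dens_trace[OF assms] by simp
  hence one: "(\<Sum>k<N. r k) = 1" by (simp only: of_real_eq_1_iff)
  have "r k \<le> 1" if "k < N" for k
    using member_le_sum[of k "{..<N}" r] nn that one by auto
  thus ?thesis using that s nn one by blast
qed

text \<open>Both traces are 1, so the positive and negative eigenvalues of the difference balance,
  and half the trace norm is the positive part.\<close>

lemma tdist_eq_pos_part:
  assumes w: "\<omega> \<in> dens N" and r: "\<rho> \<in> dens N" and s: "spec N (\<omega> - \<rho>) lam e"
  shows "tdist \<omega> \<rho> = (\<Sum>k<N. max 0 (lam k))"
proof -
  have "complex_of_real (\<Sum>k<N. lam k) = mtrace \<omega> - mtrace \<rho>"
    using spec_trace[OF s] mtrace_diff[OF dens_carrier[OF w] dens_carrier[OF r]] by simp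
  also have "\<dots> = 0" using w r dens_trace by auto
  finally have "(\<Sum>k<N. lam k) = 0" by (simp only: of_real_eq_0_iff)
  hence "(\<Sum>k<N. \<bar>lam k\<bar>) = (\<Sum>k<N. \<bar>lam k\<bar> + lam k)" by (simp add: sum.distrib)
  also have "\<dots> = (\<Sum>k<N. 2 * max 0 (lam k))" by (intro sum.cong) (auto simp: max_def)
  finally show ?thesis unfolding tdist_def trace_norm_spec[OF s] by (simp flip: sum_distrib_left)
qed

lemma dens_diff_spec:
  assumes "\<omega> \<in> dens N" "\<rho> \<in> dens N"
  obtains lam e where "spec N (\<omega> - \<rho>) lam e"
  using spec_exists[of "\<omega> - \<rho>" N] herm_diff[of \<omega> N \<rho>] assms dens_carrier dens_herm
  by (metis minus_carrier_mat)

text \<open>Jordan decomposition: \<open>\<omega>\<close> plus the negative part of the difference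
  equals \<open>\<rho>\<close> plus the positive part. As an equation between sums it can be
  evaluated with additivity of \<phi> alone.\<close>

lemma effect_diff_le_tdist:
  assumes w: "\<omega> \<in> dens N" and r: "\<rho> \<in> dens N"
    and add: "\<And>A B. A \<in> carrier_mat N N \<Longrightarrow> B \<in> carrier_mat N N \<Longrightarrow> \<phi> (A + B) = \<phi> A + \<phi> B"
    and pos: "\<And>A. A \<in> carrier_mat N N \<Longrightarrow> psd A \<Longrightarrow> 0 \<le> \<phi> A \<and> \<phi> A \<le> Re (mtrace A)"
  shows "\<phi> \<omega> - \<phi> \<rho> \<le> tdist \<omega> \<rho>"
proof -
  obtain lam e where s: "spec N (\<omega> - \<rho>) lam e" using dens_diff_spec[OF w r] .
  note o = spec_onb[OF s]
  define Xp where "Xp = smat N (\<lambda>k. max 0 (lam k)) e"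
  define Xn where "Xn = smat N (\<lambda>k. max 0 (- lam k)) e"
  have eq: "\<omega> + Xn = \<rho> + Xp"
  proof (rule eq_matI)
    fix i j assume "i < dim_row (\<rho> + Xp)" "j < dim_col (\<rho> + Xp)"
    hence ij: "i < N" "j < N" by (auto simp: Xp_def smat_def)
    have "(\<omega> - \<rho>) $$ (i, j) = Xp $$ (i, j) - Xn $$ (i, j)"
      using ij s by (simp add: spec_def Xp_def Xn_def smat_def sum_subtractf[symmetric] del: index_minus_mat)
        (intro sum.cong, auto simp: max_def)
    thus "(\<omega> + Xn) $$ (i, j) = (\<rho> + Xp) $$ (i, j)"
      using ij dens_carrier[OF w] dens_carrier[OF r] by (simp add: Xp_def Xn_def smat_def algebra_simps)
  qed (use dens_carrier[OF w] dens_carrier[OF r] in \<open>auto simp: Xp_def Xn_def smat_def\<close>)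
  have "psd Xp" "psd Xn" unfolding Xp_def Xn_def by (auto intro!: psd_smat[OF o])
  moreover have "\<phi> \<omega> + \<phi> Xn = \<phi> \<rho> + \<phi> Xp"
    using eq add[OF dens_carrier[OF w], of Xn] add[OF dens_carrier[OF r], of Xp]
    by (simp add: Xp_def Xn_def)
  moreover have "Re (mtrace Xp) = tdist \<omega> \<rho>"
    unfolding Xp_def mtrace_smat[OF o] tdist_eq_pos_part[OF w r s] by (simp flip: of_real_sum)
  ultimately show ?thesis using pos[of Xp] pos[of Xn] by (simp add: Xp_def Xn_def)
qed

text \<open>The distance is attained on the eigenvectors of the difference with positive eigenvalue,
  which form one of the families in the assumption.\<close>

lemma tdist_leI:
  assumes w: "\<omega> \<in> dens N" and r: "\<rho> \<in> dens N"
    and le: "\<And>e J. onb N e \<Longrightarrow> J \<subseteq> {..<N} \<Longrightarrow> (\<Sum>k\<in>J. qf N \<omega> (e k) - qf N \<rho> (e k)) \<le> \<delta>"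
  shows "tdist \<omega> \<rho> \<le> \<delta>"
proof -
  obtain lam e where s: "spec N (\<omega> - \<rho>) lam e" using dens_diff_spec[OF w r] .
  have l: "lam k = qf N \<omega> (e k) - qf N \<rho> (e k)" if "k < N" for k
    using qf_spec_vec[OF s that] qf_diff[OF dens_carrier[OF w] dens_carrier[OF r]] by simp
  have "tdist \<omega> \<rho> = (\<Sum>k<N. max 0 (lam k))" by (rule tdist_eq_pos_part[OF w r s])
  also have "\<dots> = (\<Sum>k\<in>{k\<in>{..<N}. 0 < lam k}. lam k)"
    by (subst sum.inter_filter) (auto intro!: sum.cong simp: max_def)
  also have "\<dots> = (\<Sum>k\<in>{k\<in>{..<N}. 0 < lam k}. qf N \<omega> (e k) - qf N \<rho> (e k))"
    using l by (intro sum.cong) auto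
  also have "\<dots> \<le> \<delta>" by (rule le[OF spec_onb[OF s]]) auto
  finally show ?thesis .
qed

section \<open>Weighted frames and tensor products\<close>

lemma mult_cnj_self: "z * cnj z = of_real ((cmod z)\<^sup>2)"
  by (metis cnj_mult_self mult.commute)

text \<open>A list of pairs \<open>(w, u)\<close> encodes the rank-one operators \<open>u u\<^sup>*\<close> (the norm of \<open>u\<close> being
  absorbed), each with a real label \<open>w\<close>: an eigenvalue or the outcome of a measurement.\<close>
definition lsum :: "(real \<times> (nat \<Rightarrow> complex)) list \<Rightarrow> (real \<Rightarrow> (nat \<Rightarrow> complex) \<Rightarrow> 'a::comm_monoid_add) \<Rightarrow> 'a" where
  "lsum S f = (\<Sum>p\<leftarrow>S. f (fst p) (snd p))"

lemma lsum_simps [simp]: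
  "lsum [] f = 0" "lsum (p # S) f = f (fst p) (snd p) + lsum S f"
  "lsum (S @ T) f = lsum S f + lsum T f"
  by (simp_all add: lsum_def)

lemma lsum_add: "lsum S (\<lambda>w u. f w u + g w u) = lsum S f + lsum S g"
  by (induction S) (auto simp: algebra_simps)

lemma lsum_diff: "lsum S (\<lambda>w u. f w u - g w u) = lsum S f - (lsum S g :: 'a::ab_group_add)"
  by (induction S) (auto simp: algebra_simps)

lemma lsum_cmult: "lsum S (\<lambda>w u. c * f w u) = c * (lsum S f :: 'a::semiring_0)"
  by (induction S) (auto simp: algebra_simps)

lemma lsum_multc: "lsum S (\<lambda>w u. f w u * c) = (lsum S f :: 'a::semiring_0) * c"
  by (induction S) (auto simp: algebra_simps)

lemma lsum_sum: "(\<Sum>i\<in>I. lsum S (f i)) = lsum S (\<lambda>w u. \<Sum>i\<in>I. f i w u)"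
  by (induction S) (auto simp: sum.distrib)

lemma lsum_cong: "(\<And>w u. (w, u) \<in> set S \<Longrightarrow> f w u = g w u) \<Longrightarrow> lsum S f = lsum S g"
  unfolding lsum_def by (rule arg_cong[where f = sum_list]) auto

lemma lsum_mono: "(\<And>w u. (w, u) \<in> set S \<Longrightarrow> f w u \<le> g w u) \<Longrightarrow> lsum S f \<le> (lsum S g :: real)"
  unfolding lsum_def by (rule sum_list_mono) auto

lemma lsum_nonneg: "(\<And>w u. (w, u) \<in> set S \<Longrightarrow> 0 \<le> f w u) \<Longrightarrow> 0 \<le> (lsum S f :: real)"
  unfolding lsum_def by (rule sum_list_nonneg) auto

lemma lsum_of_real: "lsum S (\<lambda>w u. complex_of_real (f w u)) = of_real (lsum S f)"
  by (induction S) auto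

lemma lsum_nth: "lsum S f = (\<Sum>k<length S. f (fst (S ! k)) (snd (S ! k)))"
  by (simp add: lsum_def sum_list_sum_nth lessThan_atLeast0)

text \<open>For a spectral list this is functional calculus (\<open>opl_spec_list\<close>); for a
  measurement it is the operator whose expectation is the mean of \<phi> of the outcome.\<close>

definition opl :: "nat \<Rightarrow> (real \<Rightarrow> real) \<Rightarrow> (real \<times> (nat \<Rightarrow> complex)) list \<Rightarrow> complex mat" where
  "opl N \<phi> S = mat N N (\<lambda>(i, j). lsum S (\<lambda>w u. of_real (\<phi> w) * (u i * cnj (u j))))"

lemma opl_carrier [simp]: "opl N \<phi> S \<in> carrier_mat N N"
  by (simp add: opl_def)

lemma sesq_opl:
  "sesq N (opl N \<phi> S) x y = lsum S (\<lambda>w u. of_real (\<phi> w) * (ip N x u * ip N u y))"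
  unfolding lsum_nth
  by (rule sesq_outer_sum[where e = "\<lambda>k. snd (S ! k)"]) (simp add: opl_def lsum_nth)

lemma qf_opl: "qf N (opl N \<phi> S) x = lsum S (\<lambda>w u. \<phi> w * (cmod (ip N u x))\<^sup>2)"
  unfolding qf_def sesq_opl ip_mult_swap
  by (simp only: of_real_mult[symmetric] lsum_of_real Re_complex_of_real)

lemma herm_opl: "herm N (opl N \<phi> S)"
  by (simp add: herm_def opl_def lsum_nth mult.commute)

lemma psd_opl: "(\<And>w u. (w, u) \<in> set S \<Longrightarrow> 0 \<le> \<phi> w) \<Longrightarrow> psd (opl N \<phi> S)"
  by (subst psd_iff[of _ N]) (auto simp: herm_opl qf_opl intro!: lsum_nonneg)

lemma mtrace_mult:
  assumes "A \<in> carrier_mat N N" "B \<in> carrier_mat N N"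
  shows "mtrace (A * B) = (\<Sum>i<N. \<Sum>j<N. A $$ (i, j) * B $$ (j, i))"
proof -
  have "mtrace (A * B) = (\<Sum>i<N. (A * B) $$ (i, i))" using assms by (simp add: mtrace_def)
  thus ?thesis using mult_entry[OF assms] by simp
qed

lemma mtrace_opl_mult:
  assumes B: "B \<in> carrier_mat N N"
  shows "mtrace (opl N \<phi> S * B) = lsum S (\<lambda>w u. of_real (\<phi> w) * sesq N B u u)"
proof -
  have s: "sesq N B u u = (\<Sum>i<N. \<Sum>j<N. u i * cnj (u j) * B $$ (j, i))" for u
    unfolding sesq_eq by (subst sum.swap) (intro sum.cong refl, simp add: mult_ac)
  have "mtrace (opl N \<phi> S * B)
      = (\<Sum>i<N. \<Sum>j<N. lsum S (\<lambda>w u. of_real (\<phi> w) * (u i * cnj (u j)) * B $$ (j, i)))"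
    unfolding mtrace_mult[OF opl_carrier B] by (simp add: opl_def lsum_multc)
  also have "\<dots> = lsum S (\<lambda>w u. \<Sum>i<N. \<Sum>j<N. of_real (\<phi> w) * (u i * cnj (u j)) * B $$ (j, i))"
    by (simp add: lsum_sum)
  finally show ?thesis by (simp add: s sum_distrib_left mult.assoc)
qed

lemma Re_lsum: "Re (lsum S f) = lsum S (\<lambda>w u. Re (f w u))"
  by (induction S) auto

lemma trace_opl_mult:
  "B \<in> carrier_mat N N \<Longrightarrow> Re (mtrace (opl N \<phi> S * B)) = lsum S (\<lambda>w u. \<phi> w * qf N B u)"
  by (simp add: mtrace_opl_mult Re_lsum qf_def)

lemma mtrace_opl: "mtrace (opl N \<phi> S) = of_real (lsum S (\<lambda>w u. \<phi> w * nsq N u))"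
proof -
  have "mtrace (opl N \<phi> S) = lsum S (\<lambda>w u. \<Sum>i<N. of_real (\<phi> w) * (u i * cnj (u i)))"
    by (simp add: mtrace_def opl_def lsum_sum)
  also have "\<dots> = lsum S (\<lambda>w u. of_real (\<phi> w * nsq N u))"
    by (intro lsum_cong) (simp add: nsq_def sum_distrib_left mult_cnj_self)
  finally show ?thesis by (simp only: lsum_of_real)
qed

text \<open>A resolution of the identity into rank-one operators, hence a measurement (POVM) with
  real outcomes.\<close>

definition frame :: "nat \<Rightarrow> (real \<times> (nat \<Rightarrow> complex)) list \<Rightarrow> bool" where
  "frame N S \<longleftrightarrow> opl N (\<lambda>_. 1) S = 1\<^sub>m N"

lemma qf_one: "qf N (1\<^sub>m N) x = nsq N x"
proof -
  have "mv N (1\<^sub>m N) x i = x i" if "i < N" for i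
    using that by (simp add: mv_def if_distrib[of "\<lambda>x. x * _"] cong: if_cong)
  hence "sesq N (1\<^sub>m N) x x = ip N x x" unfolding sesq_def by (intro ip_cong) auto
  thus ?thesis by (simp add: qf_def ip_self)
qed

lemma frame_parseval: "frame N S \<Longrightarrow> lsum S (\<lambda>w u. (cmod (ip N u x))\<^sup>2) = nsq N x"
  using qf_opl[of N "\<lambda>_. 1" S x] by (simp add: frame_def qf_one)

lemma frame_trace: "frame N S \<Longrightarrow> B \<in> carrier_mat N N \<Longrightarrow> lsum S (\<lambda>w u. qf N B u) = Re (mtrace B)"
  using trace_opl_mult[of B N "\<lambda>_. 1" S] by (simp add: frame_def)

definition spec_list :: "nat \<Rightarrow> (nat \<Rightarrow> real) \<Rightarrow> (nat \<Rightarrow> nat \<Rightarrow> complex) \<Rightarrow> (real \<times> (nat \<Rightarrow> complex)) list" where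
  "spec_list N lam e = map (\<lambda>k. (lam k, e k)) [0..<N]"

lemma set_spec_list: "set (spec_list N lam e) = (\<lambda>k. (lam k, e k)) ` {..<N}"
  by (auto simp: spec_list_def)

lemma lsum_spec_list: "lsum (spec_list N lam e) f = (\<Sum>k<N. f (lam k) (e k))"
  by (simp add: lsum_def spec_list_def sum_list_sum_nth lessThan_atLeast0)

lemma opl_spec_list: "opl N \<phi> (spec_list N lam e) = smat N (\<lambda>k. \<phi> (lam k)) e"
  by (simp add: opl_def smat_def lsum_spec_list)

lemma frame_spec_list: "onb N e \<Longrightarrow> frame N (spec_list N lam e)"
  unfolding frame_def opl_spec_list
  by (rule eq_matI) (auto simp: smat_def onb_complete)

lemma opl_spec: "spec N A lam e \<Longrightarrow> opl N (\<lambda>w. w) (spec_list N lam e) = A"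
  using spec_eq_smat opl_spec_list by simp

section \<open>Tensor products of vectors, matrices and labelled lists\<close>

lemma div_mod_less: "i < m * n \<Longrightarrow> i div n < m \<and> i mod n < (n::nat)"
  by (cases "n = 0") (auto simp: less_mult_imp_div_less)

lemma sum_div_mod:
  fixes f :: "nat \<Rightarrow> nat \<Rightarrow> 'a::comm_monoid_add"
  shows "(\<Sum>i<m * n. f (i div n) (i mod n)) = (\<Sum>a<m. \<Sum>b<n. f a b)"
proof -
  have lt: "a * n + b < m * n" if "a < m" "b < n" for a b
  proof -
    have "a * n + b < Suc a * n" using that by simp
    also have "\<dots> \<le> m * n" using that by (intro mult_right_mono) auto
    finally show ?thesis .
  qed
  have "(\<Sum>i<m * n. f (i div n) (i mod n)) = (\<Sum>(a, b)\<in>{..<m} \<times> {..<n}. f a b)"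
    by (rule sum.reindex_bij_witness[of _ "\<lambda>(a, b). a * n + b" "\<lambda>i. (i div n, i mod n)"])
      (auto simp: div_mod_less lt)
  thus ?thesis by (simp add: sum.cartesian_product)
qed

definition tv :: "nat \<Rightarrow> (nat \<Rightarrow> complex) \<Rightarrow> (nat \<Rightarrow> complex) \<Rightarrow> nat \<Rightarrow> complex" where
  "tv n u v = (\<lambda>i. u (i div n) * v (i mod n))"

lemma kron_carrier: "A \<in> carrier_mat m m \<Longrightarrow> B \<in> carrier_mat n n \<Longrightarrow> kron A B \<in> carrier_mat (m * n) (m * n)"
  by (auto simp: kron_def)

lemma kron_entry: "A \<in> carrier_mat m m \<Longrightarrow> B \<in> carrier_mat n n \<Longrightarrow> i < m * n \<Longrightarrow> j < m * n \<Longrightarrow>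
  kron A B $$ (i, j) = A $$ (i div n, j div n) * B $$ (i mod n, j mod n)"
  by (auto simp: kron_def)

lemma sesq_kron:
  assumes A: "A \<in> carrier_mat m m" and B: "B \<in> carrier_mat n n"
  shows "sesq (m * n) (kron A B) (tv n u u') (tv n v v') = sesq m A u v * sesq n B u' v'"
proof -
  have "sesq (m * n) (kron A B) (tv n u u') (tv n v v')
    = (\<Sum>i<m * n. \<Sum>j<m * n. (cnj (u (i div n)) * cnj (u' (i mod n)))
        * (A $$ (i div n, j div n) * B $$ (i mod n, j mod n)) * (v (j div n) * v' (j mod n)))"
    unfolding sesq_eq using kron_entry[OF A B] by (intro sum.cong refl) (simp add: tv_def)
  also have "\<dots> = (\<Sum>i<m * n. \<Sum>c<m. \<Sum>d<n. (cnj (u (i div n)) * cnj (u' (i mod n)))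
        * (A $$ (i div n, c) * B $$ (i mod n, d)) * (v c * v' d))"
    by (subst sum_div_mod) simp
  also have "\<dots> = (\<Sum>a<m. \<Sum>b<n. \<Sum>c<m. \<Sum>d<n. (cnj (u a) * cnj (u' b))
        * (A $$ (a, c) * B $$ (b, d)) * (v c * v' d))"
    by (subst sum_div_mod) simp
  also have "\<dots> = (\<Sum>a<m. \<Sum>c<m. \<Sum>b<n. \<Sum>d<n. (cnj (u a) * cnj (u' b))
        * (A $$ (a, c) * B $$ (b, d)) * (v c * v' d))"
    by (intro sum.cong refl sum.swap)
  also have "\<dots> = sesq m A u v * sesq n B u' v'"
    unfolding sesq_eq unfolding sum_distrib_right unfolding sum_distrib_left
    by (intro sum.cong refl) (simp add: mult_ac)
  finally show ?thesis .
qed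

lemma sesq_self_real: "herm N A \<Longrightarrow> sesq N A u u = of_real (qf N A u)"
  using sesq_commute[of N A u u] by (simp add: qf_def complex_eq_iff)

lemma qf_kron:
  assumes "A \<in> carrier_mat m m" "B \<in> carrier_mat n n" "herm m A" "herm n B"
  shows "qf (m * n) (kron A B) (tv n u u') = qf m A u * qf n B u'"
  using sesq_kron[OF assms(1,2)] sesq_self_real assms(3,4)
  by (simp add: qf_def[of "m * n"] flip: of_real_mult)

text \<open>Multiplying the labels suits both uses: eigenvalues of product operators and likelihood
  ratios of product measurements.\<close>

definition tens :: "nat \<Rightarrow> (real \<times> (nat \<Rightarrow> complex)) list \<Rightarrow> (real \<times> (nat \<Rightarrow> complex)) list
    \<Rightarrow> (real \<times> (nat \<Rightarrow> complex)) list" where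
  "tens n S T = concat (map (\<lambda>p. map (\<lambda>q. (fst p * fst q, tv n (snd p) (snd q))) T) S)"

lemma set_tens: "(w, u) \<in> set (tens n S T) \<Longrightarrow>
  \<exists>a v b v'. (a, v) \<in> set S \<and> (b, v') \<in> set T \<and> w = a * b \<and> u = tv n v v'"
  unfolding tens_def by fastforce

lemma lsum_tens: "lsum (tens n S T) f = lsum S (\<lambda>w u. lsum T (\<lambda>w' u'. f (w * w') (tv n u u')))"
proof (induction S)
  case (Cons p S)
  have "lsum (map (\<lambda>q. (fst p * fst q, tv n (snd p) (snd q))) T) f
      = lsum T (\<lambda>w' u'. f (fst p * w') (tv n (snd p) u'))"
    by (simp add: lsum_def comp_def)
  thus ?case using Cons by (simp add: tens_def)
qed (simp add: tens_def)

lemma opl_tens: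
  assumes "\<And>w u w' u'. (w, u) \<in> set S \<Longrightarrow> (w', u') \<in> set T \<Longrightarrow> \<phi> (w * w') = \<phi> w * \<phi> w'"
  shows "opl (m * n) \<phi> (tens n S T) = kron (opl m \<phi> S) (opl n \<phi> T)"
proof (rule eq_matI)
  fix i j assume "i < dim_row (kron (opl m \<phi> S) (opl n \<phi> T))" "j < dim_col (kron (opl m \<phi> S) (opl n \<phi> T))"
  hence ij: "i < m * n" "j < m * n"
    using kron_carrier[OF opl_carrier[of m \<phi> S] opl_carrier[of n \<phi> T]] by auto
  note dm = div_mod_less[OF ij(1)] div_mod_less[OF ij(2)]
  have "opl (m * n) \<phi> (tens n S T) $$ (i, j)
      = lsum S (\<lambda>w u. lsum T (\<lambda>w' u'. (of_real (\<phi> w) * (u (i div n) * cnj (u (j div n))))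
          * (of_real (\<phi> w') * (u' (i mod n) * cnj (u' (j mod n))))))"
    using ij by (simp add: opl_def lsum_tens) (intro lsum_cong, simp add: assms tv_def mult_ac)
  thus "opl (m * n) \<phi> (tens n S T) $$ (i, j) = kron (opl m \<phi> S) (opl n \<phi> T) $$ (i, j)"
    unfolding kron_entry[OF opl_carrier opl_carrier ij]
    using dm by (simp add: opl_def lsum_cmult lsum_multc)
qed (auto simp: kron_def opl_def)

lemma kron_one: "kron (1\<^sub>m m) (1\<^sub>m n) = 1\<^sub>m (m * n)"
proof (rule eq_matI)
  fix i j assume "i < dim_row (1\<^sub>m (m * n) :: complex mat)" "j < dim_col (1\<^sub>m (m * n) :: complex mat)"
  hence ij: "i < m * n" "j < m * n" by auto
  have "i = j \<longleftrightarrow> i div n = j div n \<and> i mod n = j mod n" by (metis div_mult_mod_eq)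
  thus "kron (1\<^sub>m m) (1\<^sub>m n) $$ (i, j) = 1\<^sub>m (m * n) $$ (i, j)"
    unfolding kron_entry[OF one_carrier_mat one_carrier_mat ij]
    using ij div_mod_less[OF ij(1)] div_mod_less[OF ij(2)] by simp
qed (auto simp: kron_def)

lemma frame_tens: "frame m S \<Longrightarrow> frame n T \<Longrightarrow> frame (m * n) (tens n S T)"
  unfolding frame_def by (subst opl_tens) (auto simp: kron_one)

lemma lsum_kron:
  assumes A: "A \<in> carrier_mat m m" "herm m A" and B: "B \<in> carrier_mat n n" "herm n B"
    and mult: "\<And>w u w' u'. (w, u) \<in> set S \<Longrightarrow> (w', u') \<in> set T \<Longrightarrow> \<phi> (w * w') = \<phi> w * \<phi> w'"
  shows "lsum (tens n S T) (\<lambda>w u. \<phi> w * qf (m * n) (kron A B) u)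
      = lsum S (\<lambda>w u. \<phi> w * qf m A u) * lsum T (\<lambda>w u. \<phi> w * qf n B u)"
proof -
  have "lsum (tens n S T) (\<lambda>w u. \<phi> w * qf (m * n) (kron A B) u)
      = lsum S (\<lambda>w u. lsum T (\<lambda>w' u'. (\<phi> w * qf m A u) * (\<phi> w' * qf n B u')))"
    unfolding lsum_tens
    by (intro lsum_cong) (simp add: mult qf_kron[OF A(1) B(1) A(2) B(2)])
  thus ?thesis by (simp add: lsum_cmult lsum_multc)
qed

lemma kron_smult:
  assumes "A \<in> carrier_mat m m" "B \<in> carrier_mat n n"
  shows "kron (a \<cdot>\<^sub>m A) (b \<cdot>\<^sub>m B) = (a * b) \<cdot>\<^sub>m kron A B"
  by (rule eq_matI) (use assms in \<open>auto simp: kron_def div_mod_less\<close>)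

text \<open>The spectral lists of the factors tensor to a list with nonnegative labels.\<close>

lemma psd_kron:
  assumes A: "A \<in> carrier_mat m m" "psd A" and B: "B \<in> carrier_mat n n" "psd B"
  shows "psd (kron A B)"
proof -
  obtain a e where sA: "spec m A a e" using spec_exists A psd_herm by blast
  obtain b f where sB: "spec n B b f" using spec_exists B psd_herm by blast
  have a: "0 \<le> a k" if "k < m" for k using qf_spec_vec[OF sA that] psd_qf[OF A, of "e k"] by simp
  have b: "0 \<le> b k" if "k < n" for k using qf_spec_vec[OF sB that] psd_qf[OF B, of "f k"] by simp
  have "kron A B = opl (m * n) (\<lambda>w. w) (tens n (spec_list m a e) (spec_list n b f))"
    by (subst opl_tens) (auto simp: opl_spec[OF sA] opl_spec[OF sB])
  moreover have "0 \<le> w" if "(w, u) \<in> set (tens n (spec_list m a e) (spec_list n b f))" for w u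
    using set_tens[OF that] a b by (auto simp: set_spec_list)
  ultimately show ?thesis using psd_opl by metis
qed

section \<open>A minimax theorem for convexlike families\<close>

text \<open>The image of \<open>K\<close> under \<open>(f, g)\<close> is convex and compact and
  avoids the quadrant where both coordinates are at most \<open>c\<close>. The quadrant is unbounded
  below, so a separating functional has nonpositive coefficients \<open>p\<close> and
  \<open>q\<close>; normalised, they are the mixing weights.\<close>

lemma convexlike_two:
  fixes f g :: "'a::topological_space \<Rightarrow> real"
  assumes K: "compact K" and f: "continuous_on K f" and g: "continuous_on K g"
    and conv: "\<And>x y t. x \<in> K \<Longrightarrow> y \<in> K \<Longrightarrow> 0 \<le> t \<Longrightarrow> t \<le> 1 \<Longrightarrow>
      \<exists>z\<in>K. f z = t * f x + (1 - t) * f y \<and> g z = t * g x + (1 - t) * g y"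
    and max: "\<And>x. x \<in> K \<Longrightarrow> c < f x \<or> c < g x"
  shows "\<exists>t. 0 \<le> t \<and> t \<le> 1 \<and> (\<forall>x\<in>K. c < t * f x + (1 - t) * g x)"
proof (cases "K = {}")
  case False
  let ?C = "(\<lambda>x. (f x, g x)) ` K" and ?D = "{..c} \<times> {..c}"
  have "compact ?C" by (intro compact_continuous_image continuous_intros f g K)
  moreover have "convex ?C"
  proof (rule convexI)
    fix p q and u v :: real
    assume "p \<in> ?C" "q \<in> ?C" and uv: "0 \<le> u" "0 \<le> v" "u + v = 1"
    then obtain x y where xy: "x \<in> K" "y \<in> K" "p = (f x, g x)" "q = (f y, g y)" by auto
    from uv have v: "v = 1 - u" "u \<le> 1" by auto
    obtain z where z: "z \<in> K" "f z = u * f x + v * f y" "g z = u * g x + v * g y"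
      using conv[OF xy(1,2) uv(1)] v by auto
    show "u *\<^sub>R p + v *\<^sub>R q \<in> ?C" using z xy by (intro image_eqI[of _ _ z]) auto
  qed
  moreover have "convex ?D" "closed ?D" by (auto intro!: convex_Times closed_Times)
  moreover have "?C \<inter> ?D = {}" using max by force
  ultimately obtain a b where ab: "\<forall>x\<in>?C. inner a x < b" "\<forall>x\<in>?D. inner a x > b"
    using separating_hyperplane_compact_closed[of ?C ?D] False by auto
  obtain p q where a: "a = (p, q)" by force
  have D: "b < p * s + q * r" if "s \<le> c" "r \<le> c" for s r using ab(2) that a by auto
  have p: "p \<le> 0"
  proof (rule ccontr)
    assume "\<not> p \<le> 0"
    define s where "s = min c ((b - q * c) / p)"
    have "p * s \<le> p * ((b - q * c) / p)" using \<open>\<not> p \<le> 0\<close> by (intro mult_left_mono) (auto simp: s_def)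
    hence "p * s \<le> b - q * c" using \<open>\<not> p \<le> 0\<close> by simp
    thus False using D[of s c] by (simp add: s_def)
  qed
  have q: "q \<le> 0"
  proof (rule ccontr)
    assume "\<not> q \<le> 0"
    define s where "s = min c ((b - p * c) / q)"
    have "q * s \<le> q * ((b - p * c) / q)" using \<open>\<not> q \<le> 0\<close> by (intro mult_left_mono) (auto simp: s_def)
    hence "q * s \<le> b - p * c" using \<open>\<not> q \<le> 0\<close> by simp
    thus False using D[of c s] by (simp add: s_def)
  qed
  have C: "p * f x + q * g x < (p + q) * c" if "x \<in> K" for x
    using ab(1) that a D[of c c] by (force simp: algebra_simps)
  from False obtain x0 where "x0 \<in> K" by blast
  hence "p \<noteq> 0 \<or> q \<noteq> 0" using C[of x0] by auto
  hence pq: "p + q < 0" using p q by auto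
  define t where "t = p / (p + q)"
  have t: "0 \<le> t" "t \<le> 1" using p q pq by (auto simp: t_def divide_nonpos_neg field_simps)
  have t1: "t * (p + q) = p" "(1 - t) * (p + q) = q" using pq by (auto simp: t_def field_simps)
  have "c < t * f x + (1 - t) * g x" if "x \<in> K" for x
  proof -
    have "(t * f x + (1 - t) * g x) * (p + q) = (t * (p + q)) * f x + ((1 - t) * (p + q)) * g x"
      by (simp add: algebra_simps)
    also have "\<dots> < (p + q) * c" using C[OF that] t1 by simp
    finally have "(t * f x + (1 - t) * g x) * (p + q) < c * (p + q)" by (simp add: mult.commute)
    thus ?thesis using pq by (simp add: mult_less_cancel_right)
  qed
  thus ?thesis using t by blast
qed (auto intro: exI[of _ 0])

text \<open>Where \<open>f\<close> exceeds \<open>c\<close> the other functions are free. The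
  induction hypothesis is therefore applied on the sublevel set of \<open>f\<close>, again compact
  and closed under mixing, and the case of two functions joins the result with \<open>f\<close>.
  \<open>K\<close> carries no linear structure; \<open>conv\<close> replaces it by a point at which
  every function takes the mixed value.\<close>

lemma convexlike_finite:
  fixes F :: "('a::topological_space \<Rightarrow> real) set"
  assumes "finite G" "G \<noteq> {}" "G \<subseteq> F" and K: "compact K"
    and cont: "\<And>f. f \<in> F \<Longrightarrow> continuous_on K f"
    and mix: "\<And>f g t. f \<in> F \<Longrightarrow> g \<in> F \<Longrightarrow> 0 \<le> t \<Longrightarrow> t \<le> 1 \<Longrightarrow> (\<lambda>x. t * f x + (1 - t) * g x) \<in> F"
    and conv: "\<And>x y t. x \<in> K \<Longrightarrow> y \<in> K \<Longrightarrow> 0 \<le> t \<Longrightarrow> t \<le> 1 \<Longrightarrow>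
      \<exists>z\<in>K. \<forall>f\<in>F. f z = t * f x + (1 - t) * f y"
    and ex: "\<And>x. x \<in> K \<Longrightarrow> \<exists>f\<in>G. c < f x"
  shows "\<exists>f\<in>F. \<forall>x\<in>K. c < f x"
  using assms(1-3) K cont conv ex
proof (induction G arbitrary: K rule: finite_ne_induct)
  case (singleton f)
  thus ?case by (intro bexI[of _ f]) auto
next
  case (insert f G)
  have fF: "f \<in> F" using insert.prems by simp
  let ?K = "K \<inter> f -` {..c}"
  have "closedin (top_of_set K) ?K"
    by (rule continuous_closedin_preimage[OF insert.prems(3)[OF fF]]) simp
  hence comp: "compact ?K" using closedin_compact[OF insert.prems(2)] by blast
  have conv': "\<exists>z\<in>?K. \<forall>f\<in>F. f z = t * f x + (1 - t) * f y"
    if xy: "x \<in> ?K" "y \<in> ?K" "0 \<le> t" "t \<le> 1" for x y t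
  proof -
    obtain z where z: "z \<in> K" "\<forall>f\<in>F. f z = t * f x + (1 - t) * f y"
      using insert.prems(4)[OF IntD1[OF xy(1)] IntD1[OF xy(2)] xy(3,4)] by blast
    have "t * f x + (1 - t) * f y \<le> t * c + (1 - t) * c"
      using xy by (intro add_mono mult_left_mono) auto
    hence "f z \<le> t * c + (1 - t) * c" using z(2) fF by metis
    thus ?thesis using z by (auto simp: algebra_simps)
  qed
  have "\<exists>h\<in>F. \<forall>x\<in>?K. c < h x"
  proof (rule insert.IH[OF _ comp _ conv'])
    show "G \<subseteq> F" using insert.prems by simp
    show "continuous_on ?K h" if "h \<in> F" for h
      using insert.prems(3)[OF that] by (rule continuous_on_subset) auto
    show "\<exists>h\<in>G. c < h x" if "x \<in> ?K" for x using insert.prems(5)[of x] that by auto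
  qed
  then obtain h where h: "h \<in> F" "\<forall>x\<in>?K. c < h x" by blast
  have "\<exists>t. 0 \<le> t \<and> t \<le> 1 \<and> (\<forall>x\<in>K. c < t * f x + (1 - t) * h x)"
  proof (rule convexlike_two[OF insert.prems(2)])
    show "continuous_on K f" "continuous_on K h" using insert.prems(3) fF h by auto
    show "\<exists>z\<in>K. f z = t * f x + (1 - t) * f y \<and> h z = t * h x + (1 - t) * h y"
      if "x \<in> K" "y \<in> K" "0 \<le> t" "t \<le> 1" for x y t
      using insert.prems(4)[OF that] fF h by blast
    show "c < f x \<or> c < h x" if "x \<in> K" for x using h that by force
  qed
  then obtain t where "0 \<le> t" "t \<le> 1" "\<forall>x\<in>K. c < t * f x + (1 - t) * h x" by blast
  thus ?case using mix[OF fF h(1)] by (intro bexI[of _ "\<lambda>x. t * f x + (1 - t) * h x"]) auto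
qed

text \<open>Compactness reduces the choice of \<open>f\<close> depending on \<open>x\<close> to
  finitely many members of \<open>F\<close>, whose superlevel sets cover \<open>K\<close>.\<close>

theorem convexlike_minimax:
  fixes F :: "('a::topological_space \<Rightarrow> real) set"
  assumes K: "compact K" and ne: "K \<noteq> {}"
    and cont: "\<And>f. f \<in> F \<Longrightarrow> continuous_on K f"
    and mix: "\<And>f g t. f \<in> F \<Longrightarrow> g \<in> F \<Longrightarrow> 0 \<le> t \<Longrightarrow> t \<le> 1 \<Longrightarrow> (\<lambda>x. t * f x + (1 - t) * g x) \<in> F"
    and conv: "\<And>x y t. x \<in> K \<Longrightarrow> y \<in> K \<Longrightarrow> 0 \<le> t \<Longrightarrow> t \<le> 1 \<Longrightarrow>
      \<exists>z\<in>K. \<forall>f\<in>F. f z = t * f x + (1 - t) * f y"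
    and ex: "\<And>x. x \<in> K \<Longrightarrow> \<exists>f\<in>F. c < f x"
  shows "\<exists>f\<in>F. \<forall>x\<in>K. c < f x"
proof -
  let ?U = "\<lambda>f. K \<inter> f -` {c<..}"
  have "\<forall>U\<in>?U ` F. openin (top_of_set K) U"
    using cont by (auto intro!: continuous_openin_preimage_gen)
  moreover have "K \<subseteq> \<Union> (?U ` F)" using ex by auto
  ultimately obtain D where D: "D \<subseteq> ?U ` F" "finite D" "K \<subseteq> \<Union> D"
    using K unfolding compact_eq_openin_cover by meson
  then obtain G where G: "G \<subseteq> F" "finite G" "D = ?U ` G" by (meson finite_subset_image)
  have Gne: "G \<noteq> {}" using D(3) G(3) ne by blast
  have exG: "\<exists>f\<in>G. c < f x" if "x \<in> K" for x
    using that D(3) unfolding G(3) by blast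
  show ?thesis by (rule convexlike_finite[OF G(2) Gne G(1) K cont mix conv exG])
qed

section \<open>Relative entropy and pinching\<close>

lemma mv_spec:
  assumes s: "spec N A lam e" and i: "i < N"
  shows "mv N A w i = (\<Sum>k<N. of_real (lam k) * ip N (e k) w * e k i)"
proof -
  have "mv N A w i = (\<Sum>k<N. sesq N A (e k) w * e k i)"
    unfolding sesq_def by (rule onb_expand[OF spec_onb[OF s] i])
  thus ?thesis using sesq_spec_left[OF s] by simp
qed

lemma mult_vec_entry:
  "A \<in> carrier_mat N N \<Longrightarrow> v \<in> carrier_vec N \<Longrightarrow> i < N \<Longrightarrow> (A *\<^sub>v v) $ i = mv N A (vec_index v) i"
  by (auto simp: mv_def scalar_prod_def lessThan_atLeast0 intro!: sum.cong)

lemma psd_null: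
  assumes \<rho>: "\<rho> \<in> dens N" and z: "qf N \<rho> u = 0"
  shows "sesq N \<rho> u x = 0"
proof -
  obtain r f where s: "spec N \<rho> r f" and r: "\<And>k. k < N \<Longrightarrow> 0 \<le> r k" using dens_spec[OF \<rho>] by metis
  have "(\<Sum>k<N. r k * (cmod (ip N (f k) u))\<^sup>2) = 0" using z qf_spec[OF s] by simp
  hence "\<forall>k\<in>{..<N}. r k * (cmod (ip N (f k) u))\<^sup>2 = 0"
    by (subst (asm) sum_nonneg_eq_0_iff) (auto simp: r)
  hence "of_real (r k) * ip N u (f k) = 0" if "k < N" for k
    using that by (subst ip_commute) auto
  hence "of_real (r k) * (ip N u (f k) * ip N (f k) x) = 0" if "k < N" for k
    using that by (metis mult.assoc mult_zero_left)
  thus ?thesis unfolding sesq_spec[OF s] by (intro sum.neutral) auto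
qed

text \<open>Turns inclusion of ranges into a condition on the kernel vectors of an eigenbasis of
  \<tau>, the form in which relative entropy meets it.\<close>

lemma supp_le_iff:
  assumes \<rho>: "\<rho> \<in> dens N" and s: "spec N \<tau> q v"
  shows "supp_le \<rho> \<tau> \<longleftrightarrow> (\<forall>k<N. q k = 0 \<longrightarrow> qf N \<rho> (v k) = 0)"
proof
  have R: "\<rho> \<in> carrier_mat N N" and T: "\<tau> \<in> carrier_mat N N" using dens_carrier[OF \<rho>] spec_carrier[OF s] by auto
  {
    assume su: "supp_le \<rho> \<tau>"
    show "\<forall>k<N. q k = 0 \<longrightarrow> qf N \<rho> (v k) = 0"
    proof (intro allI impI)
      fix k assume k: "k < N" "q k = 0"
      obtain w where w: "w \<in> carrier_vec N" "\<rho> *\<^sub>v vec N (v k) = \<tau> *\<^sub>v w"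
        using su R T unfolding supp_le_def by (metis carrier_matD(2) vec_carrier)
      have "mv N \<rho> (v k) i = mv N \<tau> (vec_index w) i" if i: "i < N" for i
      proof -
        have "mv N \<rho> (v k) i = (\<rho> *\<^sub>v vec N (v k)) $ i"
          by (subst mult_vec_entry[OF R _ i]) (auto intro!: fun_cong[OF mv_cong])
        also have "\<dots> = mv N \<tau> (vec_index w) i" unfolding w(2) by (rule mult_vec_entry[OF T w(1) i])
        finally show ?thesis .
      qed
      hence "sesq N \<rho> (v k) (v k) = sesq N \<tau> (v k) (vec_index w)"
        unfolding sesq_def by (intro ip_cong) auto
      also have "\<dots> = 0" using sesq_spec_left[OF s k(1)] k by simp
      finally show "qf N \<rho> (v k) = 0" by (simp add: qf_def)
    qed
  }
  assume z: "\<forall>k<N. q k = 0 \<longrightarrow> qf N \<rho> (v k) = 0"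
  have o: "onb N v" by (rule spec_onb[OF s])
  show "supp_le \<rho> \<tau>" unfolding supp_le_def
  proof
    fix x :: "complex Matrix.vec" assume "x \<in> carrier_vec (dim_col \<rho>)"
    hence x: "x \<in> carrier_vec N" using R by simp
    define c where "c = (\<lambda>l. ip N (v l) (mv N \<rho> (vec_index x)))"
    \<comment> \<open>A preimage under \<tau>: coefficients are divided by eigenvalues. Where
      \<open>q l = 0\<close> the numerator vanishes too, so division by zero does no harm.\<close>
    define y where "y = (\<lambda>a. \<Sum>l<N. (c l / of_real (q l)) * v l a)"
    have c0: "c l = 0" if "l < N" "q l = 0" for l
      using psd_null[OF \<rho>, of "v l" "vec_index x"] z that unfolding c_def sesq_def by blast
    have ipy: "ip N (v k) y = c k / of_real (q k)" if k: "k < N" for k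
    proof -
      have "ip N (v k) y = (\<Sum>l<N. if l = k then c k / of_real (q k) else 0)"
        unfolding y_def ip_sum using o k by (intro sum.cong refl) (auto simp: onb_orth)
      thus ?thesis using k by simp
    qed
    have "\<rho> *\<^sub>v x = \<tau> *\<^sub>v vec N y"
    proof (rule eq_vecI)
      fix i assume "i < dim_vec (\<tau> *\<^sub>v vec N y)"
      hence i: "i < N" using T by simp
      have "(\<tau> *\<^sub>v vec N y) $ i = mv N \<tau> y i"
        by (subst mult_vec_entry[OF T _ i]) (auto intro!: fun_cong[OF mv_cong])
      also have "\<dots> = (\<Sum>k<N. c k * v k i)"
        unfolding mv_spec[OF s i] using ipy c0 by (intro sum.cong refl) auto
      also have "\<dots> = mv N \<rho> (vec_index x) i"
        unfolding c_def by (rule onb_expand[OF o i, symmetric])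
      also have "\<dots> = (\<rho> *\<^sub>v x) $ i" by (rule mult_vec_entry[OF R x i, symmetric])
      finally show "(\<rho> *\<^sub>v x) $ i = (\<tau> *\<^sub>v vec N y) $ i" by simp
    qed (use R T in auto)
    thus "\<exists>w\<in>carrier_vec (dim_col \<tau>). \<rho> *\<^sub>v x = \<tau> *\<^sub>v w"
      using T by (intro bexI[of _ "vec N y"]) auto
  qed
qed

lemma mtrace_comm:
  "A \<in> carrier_mat N N \<Longrightarrow> B \<in> carrier_mat N N \<Longrightarrow> mtrace (A * B) = mtrace (B * A)"
  by (simp add: mtrace_mult) (subst sum.swap, simp add: mult.commute)

lemma rel_ent_eq:
  assumes \<rho>: "\<rho> \<in> dens N" and sr: "spec N \<rho> r f" and st: "spec N \<tau> q v" and su: "supp_le \<rho> \<tau>"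
  shows "rel_ent \<rho> \<tau> = ereal ((\<Sum>k<N. r k * log0 (r k)) - (\<Sum>k<N. qf N \<rho> (v k) * log0 (q k)))"
proof -
  have R: "\<rho> \<in> carrier_mat N N" by (rule dens_carrier[OF \<rho>])
  have tr: "Re (mtrace (\<rho> * smat N (\<lambda>k. log0 (lam k)) e)) = (\<Sum>k<N. qf N \<rho> (e k) * log0 (lam k))"
    for lam e
    using trace_opl_mult[OF R, of log0 "spec_list N lam e"]
    by (subst mtrace_comm[OF R]) (auto simp: opl_spec_list lsum_spec_list mult.commute)
  have "mtrace (\<rho> * (smat N (\<lambda>k. log0 (r k)) f - smat N (\<lambda>k. log0 (q k)) v))
      = mtrace (\<rho> * smat N (\<lambda>k. log0 (r k)) f) - mtrace (\<rho> * smat N (\<lambda>k. log0 (q k)) v)"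
    by (subst mult_minus_distrib_mat[OF R])
      (auto intro!: mtrace_diff[of _ N] mult_carrier_mat[OF R] intro: smat_carrier)
  moreover have "(\<Sum>k<N. qf N \<rho> (f k) * log0 (r k)) = (\<Sum>k<N. r k * log0 (r k))"
    using qf_spec_vec[OF sr] by simp
  ultimately show ?thesis
    using su unfolding rel_ent_def hfun_spec[OF sr] hfun_spec[OF st] by (simp add: tr)
qed

section \<open>Pinching with logarithmic bins\<close>

lemma dens_dim_pos: "\<rho> \<in> dens N \<Longrightarrow> 0 < N"
  by (rule ccontr) (auto simp: dens_def mtrace_def)

lemma onb_synthesis_ip:
  assumes "onb N v" "k < N"
  shows "ip N (v k) (\<lambda>a. \<Sum>i<N. x i * v i a) = x k"
proof -
  have "ip N (v k) (\<lambda>a. \<Sum>i<N. x i * v i a) = (\<Sum>i<N. if i = k then x k else 0)"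
    unfolding ip_sum using assms by (intro sum.cong refl) (auto simp: onb_orth)
  thus ?thesis using assms by simp
qed

lemma ip_synthesis:
  assumes "onb N v"
  shows "ip N (\<lambda>a. \<Sum>i<N. x i * v i a) (\<lambda>a. \<Sum>i<N. y i * v i a) = ip N x y"
  unfolding ip_sum_left using onb_synthesis_ip[OF assms] by (simp add: ip_def)

lemma mv_sum: "mv N A (\<lambda>a. \<Sum>j\<in>J. y j * v j a) = (\<lambda>i. \<Sum>j\<in>J. y j * mv N A (v j) i)"
proof
  fix i
  have "mv N A (\<lambda>a. \<Sum>j\<in>J. y j * v j a) i = (\<Sum>a<N. \<Sum>j\<in>J. A $$ (i, a) * (y j * v j a))"
    by (simp add: mv_def sum_distrib_left)
  also have "\<dots> = (\<Sum>j\<in>J. \<Sum>a<N. A $$ (i, a) * (y j * v j a))" by (rule sum.swap)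
  finally show "mv N A (\<lambda>a. \<Sum>j\<in>J. y j * v j a) i = (\<Sum>j\<in>J. y j * mv N A (v j) i)"
    by (simp add: mv_def sum_distrib_left mult.left_commute)
qed

lemma sesq_synthesis:
  "sesq N A (\<lambda>a. \<Sum>i\<in>I. x i * v i a) (\<lambda>a. \<Sum>j\<in>J. y j * v j a)
    = (\<Sum>i\<in>I. \<Sum>j\<in>J. cnj (x i) * sesq N A (v i) (v j) * y j)"
  unfolding sesq_def mv_sum ip_sum_left ip_sum
  by (simp add: sum_distrib_left mult_ac)

lemma dens_qf_le: assumes "\<rho> \<in> dens N" shows "qf N \<rho> u \<le> nsq N u"
proof -
  obtain r f where s: "spec N \<rho> r f" and r: "\<And>k. k < N \<Longrightarrow> 0 \<le> r k" "\<And>k. k < N \<Longrightarrow> r k \<le> 1"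
    using dens_spec[OF assms] by metis
  have "r k * (cmod (ip N (f k) u))\<^sup>2 \<le> 1 * (cmod (ip N (f k) u))\<^sup>2" if "k < N" for k
    using r[OF that] by (intro mult_right_mono) auto
  thus ?thesis unfolding qf_spec[OF s] parseval[OF spec_onb[OF s], of u]
    by (intro sum_mono) auto
qed

text \<open>The pinched state \<open>\<Sum>\<^sub>G P\<^sub>G \<rho> P\<^sub>G\<close> of the bins \<open>G\<close> is diagonalised together with the bin
  projectors: adding \<open>2 G\<close> on bin \<open>G\<close> separates the spectra of the blocks, which lie in \<open>[0,1]\<close>.\<close>
lemma pinched_basis:
  fixes g :: "nat \<Rightarrow> nat"
  assumes \<rho>: "\<rho> \<in> dens N" and o: "onb N v"
  shows "\<exists>z G. onb N z \<and> (\<forall>k<N. \<forall>i<N. z k i \<noteq> 0 \<longrightarrow> g i = G k) \<and>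
    (\<forall>k<N. \<forall>l<N. k \<noteq> l \<longrightarrow> G k = G l \<longrightarrow>
      sesq N \<rho> (\<lambda>a. \<Sum>i<N. z k i * v i a) (\<lambda>a. \<Sum>i<N. z l i * v i a) = 0)"
proof -
  define c where "c = (\<lambda>i j. sesq N \<rho> (v i) (v j))"
  define R where "R = mat N N (\<lambda>(i, j). (if g i = g j then c i j else 0) + (if i = j then 2 * of_nat (g i) else 0))"
  have RN: "R \<in> carrier_mat N N" by (simp add: R_def)
  have cc: "c j i = cnj (c i j)" for i j unfolding c_def by (rule sesq_commute[OF dens_herm[OF \<rho>]])
  have "herm N R" unfolding herm_def R_def by (auto simp: cc[symmetric])
  then obtain lam z where s: "spec N R lam z" using spec_exists[OF RN] by blast
  have oz: "onb N z" by (rule spec_onb[OF s])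
  have block: "sesq N R x y = sesq N \<rho> (\<lambda>a. \<Sum>i<N. x i * v i a) (\<lambda>a. \<Sum>i<N. y i * v i a) + of_nat (2 * H) * ip N x y"
    if x: "\<And>i. i < N \<Longrightarrow> x i \<noteq> 0 \<Longrightarrow> g i = H" and y: "\<And>i. i < N \<Longrightarrow> y i \<noteq> 0 \<Longrightarrow> g i = H" for x y H
  proof -
    have "sesq N R x y = (\<Sum>i<N. \<Sum>j<N. cnj (x i) * c i j * y j + (if i = j then of_nat (2 * H) * (cnj (x i) * y j) else 0))"
      unfolding sesq_eq
    proof (intro sum.cong refl)
      fix i j assume "i \<in> {..<N}" "j \<in> {..<N}"
      thus "cnj (x i) * R $$ (i, j) * y j
          = cnj (x i) * c i j * y j + (if i = j then of_nat (2 * H) * (cnj (x i) * y j) else 0)"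
        using x[of i] y[of j] by (cases "x i = 0 \<or> y j = 0") (auto simp: R_def algebra_simps)
    qed
    thus ?thesis unfolding sesq_synthesis by (simp add: sum.distrib c_def ip_def sum_distrib_left)
  qed
  \<comment> \<open>Comparing \<open>z k\<close> with its part \<open>y\<close> in one bin confines
    \<open>lam k\<close> to the interval of that bin. Intervals of different bins are disjoint, so
    \<open>z k\<close> lives in a single bin.\<close>
  have window: "2 * real (g i) \<le> lam k \<and> lam k \<le> 2 * real (g i) + 1" if k: "k < N" and i: "i < N" "z k i \<noteq> 0" for k i
  proof -
    define y where "y = (\<lambda>j. if g j = g i then z k j else 0)"
    define Y where "Y = (\<lambda>a. \<Sum>j<N. y j * v j a)"
    have "sesq N R y (z k) = sesq N R y y" unfolding sesq_eq
      by (intro sum.cong refl) (auto simp: y_def R_def)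
    moreover have "ip N y (z k) = ip N y y" by (auto simp: ip_def y_def intro!: sum.cong)
    ultimately have "sesq N R y y = of_real (lam k) * ip N y y"
      using sesq_spec_right[OF s k, of y] by simp
    moreover have "sesq N R y y = sesq N \<rho> Y Y + of_nat (2 * g i) * ip N y y"
      unfolding Y_def by (rule block) (auto simp: y_def split: if_splits)
    ultimately have "sesq N \<rho> Y Y = of_real (lam k * nsq N y - 2 * real (g i) * nsq N y)"
      by (simp add: ip_self eq_diff_eq)
    hence "qf N \<rho> Y = lam k * nsq N y - 2 * real (g i) * nsq N y"
      unfolding qf_def by (simp only: Re_complex_of_real)
    moreover have "nsq N Y = nsq N y"
      using ip_synthesis[OF o, of y y] unfolding Y_def[symmetric] ip_self by (simp only: of_real_eq_iff)
    hence "0 \<le> qf N \<rho> Y" "qf N \<rho> Y \<le> nsq N y" using dens_qf[OF \<rho>] dens_qf_le[OF \<rho>, of Y] by auto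
    moreover have "nsq N y > 0"
      using nsq_nonneg[of N y] nsq_eq_0[of N y i] i by (cases "nsq N y = 0") (auto simp: y_def)
    ultimately have "2 * real (g i) * nsq N y \<le> lam k * nsq N y" "lam k * nsq N y \<le> (2 * real (g i) + 1) * nsq N y"
      unfolding distrib_right by linarith+
    thus ?thesis using \<open>nsq N y > 0\<close> by (simp add: mult_le_cancel_right)
  qed
  have "\<exists>H. \<forall>i<N. z k i \<noteq> 0 \<longrightarrow> g i = H" if k: "k < N" for k
  proof (cases "\<exists>i<N. z k i \<noteq> 0")
    case True
    then obtain i where i: "i < N" "z k i \<noteq> 0" by blast
    have "g j = g i" if "j < N" "z k j \<noteq> 0" for j
      using window[OF k i] window[OF k that] by linarith
    thus ?thesis by blast
  qed blast
  then obtain G where G: "\<And>k i. k < N \<Longrightarrow> i < N \<Longrightarrow> z k i \<noteq> 0 \<Longrightarrow> g i = G k" by metis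
  have "sesq N \<rho> (\<lambda>a. \<Sum>i<N. z k i * v i a) (\<lambda>a. \<Sum>i<N. z l i * v i a) = 0"
    if kl: "k < N" "l < N" "k \<noteq> l" "G k = G l" for k l
  proof -
    have "sesq N R (z k) (z l) = sesq N \<rho> (\<lambda>a. \<Sum>i<N. z k i * v i a) (\<lambda>a. \<Sum>i<N. z l i * v i a)
        + of_nat (2 * G k) * ip N (z k) (z l)"
      using G kl by (intro block) auto
    moreover have "ip N (z k) (z l) = 0" using onb_orth[OF oz] kl by simp
    ultimately show ?thesis using sesq_spec_right[OF s kl(2), of "z k"] by simp
  qed
  thus ?thesis using oz G by blast
qed

text \<open>A Kraft sum; its independence of the number of bins keeps
  \<open>pinching_entropy\<close> free of the dimension.\<close>

lemma sum_geometric_bound: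
  assumes "finite A" shows "(\<Sum>G\<in>A. (1/2::real) ^ (G + 1)) \<le> 1"
proof -
  obtain M where M: "A \<subseteq> {..<M}" using finite_nat_iff_bounded[of A] assms by blast
  have "(\<Sum>G\<in>A. (1/2::real) ^ (G + 1)) \<le> (\<Sum>G<M. (1/2) ^ (G + 1))"
    using M by (intro sum_mono2) auto
  also have "\<dots> = 1 - (1/2) ^ M" by (induction M) auto
  also have "\<dots> \<le> 1" by simp
  finally show ?thesis .
qed

lemma cmod_ip_commute: "cmod (ip N u v) = cmod (ip N v u)"
  by (subst ip_commute) simp

text \<open>By \<open>off\<close>, the \<open>u k\<close> diagonalise the pinched state. As \<rho>
  dominates \<open>r j\<close> times the projector onto \<open>f j\<close>, within each bin
  \<open>r j\<close> times the inverse pinched state has form at most 1 at \<open>f j\<close>.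
  Weighting bin \<open>G\<close> by \<open>(1/2) ^ (G + 1)\<close> bounds the sum over all bins by
  1, and \<open>ln x \<le> x - 1\<close> converts this into entropies.\<close>

lemma pinching_entropy:
  fixes G :: "nat \<Rightarrow> nat"
  assumes \<rho>: "\<rho> \<in> dens N" and s: "spec N \<rho> r f" and o: "onb N u"
    and off: "\<And>k l. k < N \<Longrightarrow> l < N \<Longrightarrow> k \<noteq> l \<Longrightarrow> G k = G l \<Longrightarrow> sesq N \<rho> (u k) (u l) = 0"
  shows "(\<Sum>j<N. r j * ln (r j)) \<le> (\<Sum>k<N. qf N \<rho> (u k) * ln (qf N \<rho> (u k)))
    + ln 2 * (\<Sum>k<N. qf N \<rho> (u k) * (real (G k) + 1))"
proof -
  define p where "p = (\<lambda>k. qf N \<rho> (u k))"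
  define C where "C = (\<lambda>k j. (cmod (ip N (f j) (u k)))\<^sup>2)"
  have r0: "0 \<le> r k" if "k < N" for k
    using qf_spec_vec[OF s that] dens_qf[OF \<rho>, of "f k"] by simp
  have C0: "0 \<le> C k j" for k j by (simp add: C_def)
  have p0: "0 \<le> p k" for k by (simp add: p_def dens_qf[OF \<rho>])
  have p: "p k = (\<Sum>j<N. r j * C k j)" for k unfolding p_def C_def by (rule qf_spec[OF s])
  have C1: "(\<Sum>k<N. C k j) = 1" if "j < N" for j
    using parseval[OF o, of "f j"] onb_nsq[OF spec_onb[OF s] that]
    unfolding C_def by (subst (asm) ip_commute) simp
  have sumr: "(\<Sum>j<N. r j) = 1"
    using spec_trace[OF s] dens_trace[OF \<rho>] by (metis of_real_eq_1_iff)
  have bin: "r j * (\<Sum>k\<in>B. C k j / p k) \<le> 1"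
    if j: "j < N" and B: "B = {k \<in> {..<N}. G k = H}" for j H B
  proof -
    define x where "x = (\<Sum>k\<in>B. C k j / p k)"
    have fB: "finite B" using B by simp
    have x0: "0 \<le> x" unfolding x_def using C0 p0 by (intro sum_nonneg) auto
    \<comment> \<open>The inverse pinched state on the bin, applied to \<open>f j\<close>. Its
      \<rho>-form and its overlap with \<open>f j\<close> both equal \<open>x\<close>, whence
      \<open>r j * x\<^sup>2 \<le> x\<close>.\<close>
    define w where "w = (\<lambda>a. \<Sum>k\<in>B. (ip N (u k) (f j) / of_real (p k)) * u k a)"
    have "sesq N \<rho> w w = (\<Sum>k\<in>B. \<Sum>l\<in>B. if l = k then of_real (C k j / p k) else 0)"
      unfolding w_def sesq_synthesis
    proof (intro sum.cong refl)
      fix k l assume kl: "k \<in> B" "l \<in> B"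
      show "cnj (ip N (u k) (f j) / of_real (p k)) * sesq N \<rho> (u k) (u l) * (ip N (u l) (f j) / of_real (p l))
        = (if l = k then of_real (C k j / p k) else 0)"
      proof (cases "l = k")
        case True
        have "sesq N \<rho> (u k) (u k) = of_real (p k)" unfolding p_def by (rule sesq_self_real[OF dens_herm[OF \<rho>]])
        moreover have "cnj (ip N (u k) (f j)) * ip N (u k) (f j) = of_real (C k j)"
          unfolding cnj_mult_self C_def by (subst ip_commute) simp
        ultimately show ?thesis using True by (simp add: field_simps)
      next
        case False
        thus ?thesis using off[of k l] kl B by simp
      qed
    qed
    also have "\<dots> = of_real x" using fB by (simp add: x_def)
    finally have "qf N \<rho> w = x" by (simp add: qf_def)
    moreover have "r j * (cmod (ip N (f j) w))\<^sup>2 \<le> qf N \<rho> w"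
      unfolding qf_spec[OF s] using r0 j by (intro member_le_sum) auto
    moreover have "ip N (f j) w = of_real x"
    proof -
      have "ip N (f j) w = (\<Sum>k\<in>B. of_real (C k j / p k))"
        unfolding w_def ip_sum
        by (intro sum.cong refl) (simp add: C_def ip_mult_swap cmod_ip_commute[of N "u _"])
      thus ?thesis by (simp add: x_def)
    qed
    ultimately have le: "r j * x\<^sup>2 \<le> x" using x0 by simp
    show ?thesis
    proof (cases "x = 0")
      case False
      hence "0 < x" using x0 by simp
      thus ?thesis using le unfolding x_def[symmetric] by (simp add: power2_eq_square)
    qed (simp add: x_def[symmetric])
  qed
  have col: "(\<Sum>k<N. r j * (C k j / p k) * (1/2) ^ (G k + 1)) \<le> 1" if j: "j < N" for j
  proof -
    have "(\<Sum>k<N. r j * (C k j / p k) * (1/2) ^ (G k + 1))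
        = (\<Sum>H\<in>G ` {..<N}. \<Sum>k\<in>{k\<in>{..<N}. G k = H}. r j * (C k j / p k) * (1/2) ^ (G k + 1))"
      by (rule sum.image_gen) simp
    also have "\<dots> = (\<Sum>H\<in>G ` {..<N}. (r j * (\<Sum>k\<in>{k\<in>{..<N}. G k = H}. C k j / p k)) * (1/2) ^ (H + 1))"
      unfolding sum_distrib_left sum_distrib_right by (intro sum.cong refl) auto
    also have "\<dots> \<le> (\<Sum>H\<in>G ` {..<N}. 1 * (1/2) ^ (H + 1))"
      by (intro sum_mono mult_right_mono bin[OF j refl]) auto
    also have "\<dots> \<le> 1" using sum_geometric_bound[of "G ` {..<N}"] by simp
    finally show ?thesis .
  qed
  \<comment> \<open>This is \<open>ln y \<le> y - 1\<close> at
    \<open>y = r j / p k * (1/2) ^ (G k + 1)\<close>; when \<open>r j * C k j\<close> is nonzero,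
    \<open>p k\<close> is positive.\<close>
  have term_le: "r j * C k j * (ln (r j) - ln (p k) - (real (G k) + 1) * ln 2)
      \<le> r j * C k j * (r j / p k * (1/2) ^ (G k + 1) - 1)" if j: "j < N" and k: "k < N" for j k
  proof (cases "r j * C k j = 0")
    case False
    hence rp: "0 < r j" using r0[OF j] C0[of k j] by auto
    have "r j * C k j \<le> p k" unfolding p using r0 C0 j by (intro member_le_sum) auto
    hence pp: "0 < p k" using False r0[OF j] C0[of k j] by (smt (verit) mult_nonneg_nonneg)
    have "ln (r j / p k * (1/2) ^ (G k + 1)) = ln (r j) - ln (p k) - (real (G k) + 1) * ln 2"
      using rp pp by (simp add: ln_mult ln_div ln_realpow algebra_simps)
    moreover have "ln (r j / p k * (1/2) ^ (G k + 1)) \<le> r j / p k * (1/2) ^ (G k + 1) - 1"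
      using rp pp by (intro ln_le_minus_one) simp
    ultimately show ?thesis using r0[OF j] C0[of k j] by (intro mult_left_mono) auto
  qed auto
  have rC: "(\<Sum>j<N. \<Sum>k<N. r j * C k j * h j) = (\<Sum>j<N. r j * h j)" for h
  proof -
    have "(\<Sum>j<N. \<Sum>k<N. r j * C k j * h j) = (\<Sum>j<N. r j * h j * (\<Sum>k<N. C k j))"
      unfolding sum_distrib_left by (intro sum.cong refl) (simp add: mult_ac)
    thus ?thesis using C1 by simp
  qed
  have pC: "(\<Sum>j<N. \<Sum>k<N. r j * C k j * h k) = (\<Sum>k<N. p k * h k)" for h
    by (subst sum.swap) (simp add: p sum_distrib_right)
  have "(\<Sum>j<N. r j * ln (r j)) - (\<Sum>k<N. p k * ln (p k)) - (\<Sum>k<N. p k * ((real (G k) + 1) * ln 2))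
      = (\<Sum>j<N. \<Sum>k<N. r j * C k j * (ln (r j) - ln (p k) - (real (G k) + 1) * ln 2))"
    unfolding rC[symmetric, of "\<lambda>j. ln (r j)"] pC[symmetric] sum_subtractf[symmetric]
    by (intro sum.cong refl) (simp add: algebra_simps)
  also have "\<dots> \<le> (\<Sum>j<N. \<Sum>k<N. r j * C k j * (r j / p k * (1/2) ^ (G k + 1) - 1))"
    using term_le by (intro sum_mono) auto
  also have "\<dots> = (\<Sum>j<N. r j * (\<Sum>k<N. r j * (C k j / p k) * (1/2) ^ (G k + 1))) - (\<Sum>j<N. \<Sum>k<N. r j * C k j * 1)"
    unfolding sum_distrib_left sum_subtractf[symmetric] by (intro sum.cong refl) (simp add: algebra_simps)
  also have "\<dots> \<le> (\<Sum>j<N. r j * 1) - (\<Sum>j<N. \<Sum>k<N. r j * C k j * 1)"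
    using col r0 by (intro diff_right_mono sum_mono mult_left_mono) auto
  also have "\<dots> = 0" unfolding rC by simp
  finally show ?thesis unfolding p_def by (simp add: sum_distrib_left sum_distrib_right mult_ac)
qed

text \<open>\<open>l i\<close> stands for \<open>- ln (q i)\<close>; the inequality in its place
  lets kernel directions of \<sigma> receive any finite value. The label of an outcome is a
  likelihood ratio: an eigenvalue of the pinched state divided by the upper end
  \<open>exp (- \<Delta> * G k)\<close> of its bin.\<close>

lemma pinched_measurement:
  assumes \<rho>: "\<rho> \<in> dens N" and \<sigma>: "\<sigma> \<in> dens N" and s: "spec N \<rho> r f" and t: "spec N \<sigma> q v"
    and l: "\<And>i. i < N \<Longrightarrow> 0 \<le> l i \<and> q i \<le> exp (- l i)" and \<Delta>: "ln 2 < \<Delta>"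
  shows "\<exists>S. frame N S \<and> (\<forall>w u. (w, u) \<in> set S \<longrightarrow> 0 < w) \<and>
    (\<Sum>j<N. r j * ln (r j)) + (1 - ln 2 / \<Delta>) * (\<Sum>i<N. qf N \<rho> (v i) * l i) - \<Delta> - ln 2
      \<le> lsum S (\<lambda>w u. ln w * qf N \<rho> u) \<and>
    lsum S (\<lambda>w u. w * qf N \<sigma> u) \<le> 2"
proof -
  have D0: "0 < \<Delta>" using \<Delta> ln_gt_zero[of 2] by linarith
  have N: "0 < N" by (rule dens_dim_pos[OF \<rho>])
  have o: "onb N v" by (rule spec_onb[OF t])
  define g where "g = (\<lambda>i. nat \<lfloor>l i / \<Delta>\<rfloor>)"
  have g: "\<Delta> * real (g i) \<le> l i \<and> l i \<le> \<Delta> * real (g i) + \<Delta>" if "i < N" for i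
  proof -
    have "0 \<le> l i / \<Delta>" using l[OF that] D0 by simp
    hence "real (g i) = of_int \<lfloor>l i / \<Delta>\<rfloor>" by (simp add: g_def)
    hence "real (g i) \<le> l i / \<Delta>" "l i / \<Delta> \<le> real (g i) + 1" by linarith+
    thus ?thesis using D0 by (simp add: field_simps)
  qed
  from pinched_basis[OF \<rho> o, of g] obtain z G where oz: "onb N z"
    and zG': "\<forall>k<N. \<forall>i<N. z k i \<noteq> 0 \<longrightarrow> g i = G k"
    and off': "\<forall>k<N. \<forall>l<N. k \<noteq> l \<longrightarrow> G k = G l \<longrightarrow>
      sesq N \<rho> (\<lambda>a. \<Sum>i<N. z k i * v i a) (\<lambda>a. \<Sum>i<N. z l i * v i a) = 0" by blast
  note zG = zG'[rule_format] and off = off'[rule_format]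
  define u where "u = (\<lambda>k a. \<Sum>i<N. z k i * v i a)"
  have ou: "onb N u"
    by (rule onbI) (simp add: u_def ip_synthesis[OF o] onb_orth[OF oz])
  define p where "p = (\<lambda>k. qf N \<rho> (u k))"
  have p0: "0 \<le> p k" for k by (simp add: p_def dens_qf[OF \<rho>])
  have p1: "(\<Sum>k<N. p k) = 1"
    using frame_trace[OF frame_spec_list[OF ou] dens_carrier[OF \<rho>]] dens_trace[OF \<rho>]
    by (simp add: lsum_spec_list p_def)
  have v1: "(\<Sum>i<N. qf N \<rho> (v i)) = 1"
    using frame_trace[OF frame_spec_list[OF o] dens_carrier[OF \<rho>]] dens_trace[OF \<rho>]
    by (simp add: lsum_spec_list)
  have qs: "qf N \<sigma> (u k) \<le> exp (- \<Delta> * real (G k))" if k: "k < N" for k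
  proof -
    have "qf N \<sigma> (u k) = (\<Sum>i<N. q i * (cmod (z k i))\<^sup>2)"
      unfolding qf_spec[OF t] u_def using onb_synthesis_ip[OF o] by simp
    also have "\<dots> \<le> (\<Sum>i<N. exp (- \<Delta> * real (G k)) * (cmod (z k i))\<^sup>2)"
    proof (intro sum_mono)
      fix i assume "i \<in> {..<N}"
      hence i: "i < N" by simp
      show "q i * (cmod (z k i))\<^sup>2 \<le> exp (- \<Delta> * real (G k)) * (cmod (z k i))\<^sup>2"
      proof (cases "z k i = 0")
        case False
        have "q i \<le> exp (- l i)" using l[OF i] by simp
        also have "\<dots> \<le> exp (- \<Delta> * real (G k))" using g[OF i] zG[OF k i False] by simp
        finally show ?thesis by (intro mult_right_mono) auto
      qed simp
    qed
    also have "\<dots> = exp (- \<Delta> * real (G k)) * nsq N (z k)" by (simp add: nsq_def sum_distrib_left)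
    finally show ?thesis using onb_nsq[OF oz k] by simp
  qed
  \<comment> \<open>Pinching preserves the mean bin number, because each \<open>z k\<close> is
    supported where \<open>g\<close> equals \<open>G k\<close>.\<close>
  have moment: "(\<Sum>k<N. p k * real (G k)) = (\<Sum>i<N. qf N \<rho> (v i) * real (g i))"
  proof -
    define c where "c = (\<lambda>i j. sesq N \<rho> (v i) (v j))"
    have "complex_of_real (\<Sum>k<N. p k * real (G k)) = (\<Sum>k<N. of_nat (G k) * sesq N \<rho> (u k) (u k))"
      by (simp add: p_def sesq_self_real[OF dens_herm[OF \<rho>]] mult.commute)
    also have "\<dots> = (\<Sum>k<N. \<Sum>i<N. \<Sum>j<N. of_nat (G k) * (cnj (z k i) * c i j * z k j))"
      unfolding u_def sesq_synthesis c_def by (simp add: sum_distrib_left)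
    also have "\<dots> = (\<Sum>k<N. \<Sum>i<N. \<Sum>j<N. of_nat (g i) * c i j * (z k j * cnj (z k i)))"
    proof (intro sum.cong refl)
      fix k i j assume "k \<in> {..<N}" "i \<in> {..<N}" "j \<in> {..<N}"
      thus "of_nat (G k) * (cnj (z k i) * c i j * z k j) = of_nat (g i) * c i j * (z k j * cnj (z k i))"
        using zG[of k i] by (cases "z k i = 0") auto
    qed
    also have "\<dots> = (\<Sum>i<N. \<Sum>k<N. \<Sum>j<N. of_nat (g i) * c i j * (z k j * cnj (z k i)))" by (rule sum.swap)
    also have "\<dots> = (\<Sum>i<N. \<Sum>j<N. \<Sum>k<N. of_nat (g i) * c i j * (z k j * cnj (z k i)))"
      by (intro sum.cong refl sum.swap)
    also have "\<dots> = (\<Sum>i<N. \<Sum>j<N. if j = i then of_nat (g i) * c i i else 0)"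
      unfolding sum_distrib_left[symmetric] using onb_complete[OF oz] by (intro sum.cong refl) auto
    also have "\<dots> = (\<Sum>i<N. of_nat (g i) * c i i)" by simp
    also have "\<dots> = complex_of_real (\<Sum>i<N. qf N \<rho> (v i) * real (g i))"
      by (simp add: c_def sesq_self_real[OF dens_herm[OF \<rho>]] mult.commute)
    finally show ?thesis by (simp only: of_real_eq_iff)
  qed
  \<comment> \<open>Labels must be positive for \<open>ln\<close>. Outcomes that \<rho> never
    produces get \<open>1 / N\<close>, which adds at most 1 to the mean under \<sigma>; hence the
    bound 2.\<close>
  define w where "w = (\<lambda>k. if p k = 0 then 1 / real N else p k * exp (\<Delta> * real (G k)))"
  have wpos: "0 < w k" for k using N p0[of k] by (auto simp: w_def)
  define S where "S = spec_list N w u"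
  have "lsum S (\<lambda>w u. w * qf N \<sigma> u) = (\<Sum>k<N. w k * qf N \<sigma> (u k))" by (simp add: S_def lsum_spec_list)
  also have "\<dots> \<le> (\<Sum>k<N. p k + 1 / real N)"
  proof (intro sum_mono)
    fix k assume "k \<in> {..<N}"
    hence k: "k < N" by simp
    show "w k * qf N \<sigma> (u k) \<le> p k + 1 / real N"
    proof (cases "p k = 0")
      case True
      have "exp (- \<Delta> * real (G k)) \<le> 1" using D0 by simp
      hence "qf N \<sigma> (u k) \<le> 1" using qs[OF k] by linarith
      thus ?thesis using True N by (simp add: w_def divide_right_mono)
    next
      case False
      have "w k * qf N \<sigma> (u k) \<le> w k * exp (- \<Delta> * real (G k))"
        using qs[OF k] wpos[of k] by (intro mult_left_mono) auto
      also have "\<dots> = p k" using False by (simp add: w_def flip: exp_add)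
      finally show ?thesis by (simp add: add_increasing2)
    qed
  qed
  also have "\<dots> = 2" using p1 N by (simp add: sum.distrib)
  finally have two: "lsum S (\<lambda>w u. w * qf N \<sigma> u) \<le> 2" .
  have "lsum S (\<lambda>w u. ln w * qf N \<rho> u) = (\<Sum>k<N. ln (w k) * p k)" by (simp add: S_def lsum_spec_list p_def)
  also have "\<dots> = (\<Sum>k<N. p k * ln (p k) + \<Delta> * (p k * real (G k)))"
  proof (intro sum.cong refl)
    fix k
    show "ln (w k) * p k = p k * ln (p k) + \<Delta> * (p k * real (G k))"
      using p0[of k] by (cases "p k = 0") (auto simp: w_def ln_mult algebra_simps)
  qed
  also have "\<dots> = (\<Sum>k<N. p k * ln (p k)) + \<Delta> * (\<Sum>k<N. p k * real (G k))"
    by (simp add: sum.distrib sum_distrib_left)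
  finally have first: "lsum S (\<lambda>w u. ln w * qf N \<rho> u)
      = (\<Sum>k<N. p k * ln (p k)) + \<Delta> * (\<Sum>k<N. p k * real (G k))" .
  have "(\<Sum>j<N. r j * ln (r j)) \<le> (\<Sum>k<N. p k * ln (p k)) + ln 2 * (\<Sum>k<N. p k * (real (G k) + 1))"
    unfolding p_def using off by (intro pinching_entropy[OF \<rho> s ou]) (auto simp: u_def)
  also have "(\<Sum>k<N. p k * (real (G k) + 1)) = (\<Sum>k<N. p k * real (G k)) + 1"
    using p1 by (simp add: algebra_simps sum.distrib)
  finally have ent: "(\<Sum>j<N. r j * ln (r j))
      \<le> (\<Sum>k<N. p k * ln (p k)) + ln 2 * (\<Sum>k<N. p k * real (G k)) + ln 2" by (simp add: algebra_simps)
  define m where "m = (\<Sum>k<N. p k * real (G k))"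
  have "(\<Sum>i<N. qf N \<rho> (v i) * l i) \<le> (\<Sum>i<N. \<Delta> * (qf N \<rho> (v i) * real (g i)) + \<Delta> * qf N \<rho> (v i))"
  proof (intro sum_mono)
    fix i assume "i \<in> {..<N}"
    hence "qf N \<rho> (v i) * l i \<le> qf N \<rho> (v i) * (\<Delta> * real (g i) + \<Delta>)"
      using g dens_qf[OF \<rho>] by (intro mult_left_mono) auto
    thus "qf N \<rho> (v i) * l i \<le> \<Delta> * (qf N \<rho> (v i) * real (g i)) + \<Delta> * qf N \<rho> (v i)"
      by (simp add: algebra_simps)
  qed
  also have "\<dots> = \<Delta> * m + \<Delta>"
    using v1 unfolding m_def moment by (simp add: sum.distrib flip: sum_distrib_left)
  finally have "(1 - ln 2 / \<Delta>) * (\<Sum>i<N. qf N \<rho> (v i) * l i) \<le> (1 - ln 2 / \<Delta>) * (\<Delta> * m + \<Delta>)"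
    using \<Delta> D0 by (intro mult_left_mono) (auto simp: field_simps)
  also have "\<dots> = (\<Delta> - ln 2) * m + \<Delta> - ln 2" using D0 by (simp add: field_simps)
  also have "\<dots> \<le> (\<Delta> - ln 2) * m + \<Delta>" by simp
  finally have "(\<Sum>j<N. r j * ln (r j)) + (1 - ln 2 / \<Delta>) * (\<Sum>i<N. qf N \<rho> (v i) * l i) - \<Delta> - ln 2
      \<le> lsum S (\<lambda>w u. ln w * qf N \<rho> u)"
    using ent unfolding first m_def[symmetric] by (simp add: algebra_simps)
  thus ?thesis using two wpos frame_spec_list[OF ou, of w]
    by (intro exI[of _ S]) (auto simp: S_def set_spec_list)
qed

text \<open>Controls the share \<open>ln 2 / \<Delta>\<close> of the entropy that is given up in
  \<open>measured_payoff\<close>.\<close>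

lemma entropy_le_ln_dim:
  assumes \<rho>: "\<rho> \<in> dens N" and s: "spec N \<rho> r f"
  shows "- ln (real N) \<le> (\<Sum>j<N. r j * ln (r j))"
proof -
  have N: "0 < N" by (rule dens_dim_pos[OF \<rho>])
  have r0: "0 \<le> r k" if "k < N" for k
    using qf_spec_vec[OF s that] dens_qf[OF \<rho>, of "f k"] by simp
  have sumr: "(\<Sum>j<N. r j) = 1"
    using spec_trace[OF s] dens_trace[OF \<rho>] by (metis of_real_eq_1_iff)
  have "- (r j * ln (r j)) - r j * ln (real N) \<le> 1 / real N - r j" if "j < N" for j
  proof (cases "r j = 0")
    case False
    hence rp: "0 < r j" using r0[OF that] by simp
    have "ln (1 / (real N * r j)) \<le> 1 / (real N * r j) - 1" using rp N by (intro ln_le_minus_one) simp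
    hence "r j * ln (1 / (real N * r j)) \<le> r j * (1 / (real N * r j) - 1)" using rp by (intro mult_left_mono) auto
    thus ?thesis using rp N by (simp add: ln_div ln_mult algebra_simps)
  qed simp
  hence "(\<Sum>j<N. - (r j * ln (r j)) - r j * ln (real N)) \<le> (\<Sum>j<N. 1 / real N - r j)"
    by (intro sum_mono) auto
  also have "\<dots> = 0" using sumr N by (simp add: sum_subtractf)
  finally show ?thesis using sumr by (simp add: sum_subtractf sum_negf flip: sum_distrib_right)
qed

text \<open>In \<open>pinched_measurement\<close> only the cross term carries the factor
  \<open>1 - ln 2 / \<Delta>\<close>. Factoring it out of the whole relative entropy leaves
  \<open>ln 2 / \<Delta> * H\<close>, which the dimension bounds from below. The final
  \<open>- 1\<close> is \<open>1 - 2\<close>, from the mean under \<sigma>.\<close>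

lemma measured_payoff:
  assumes \<rho>: "\<rho> \<in> dens N" and \<sigma>: "\<sigma> \<in> dens N" and c0: "ereal c0 < rel_ent \<rho> \<sigma>" and \<Delta>: "ln 2 < \<Delta>"
  shows "\<exists>S. frame N S \<and> (\<forall>w u. (w, u) \<in> set S \<longrightarrow> 0 < w) \<and>
    (1 - ln 2 / \<Delta>) * c0 - ln 2 / \<Delta> * ln (real N) - \<Delta> - ln 2 - 1
      < lsum S (\<lambda>w u. ln w * qf N \<rho> u) + 1 - lsum S (\<lambda>w u. w * qf N \<sigma> u)"
proof -
  have D0: "0 < \<Delta>" using \<Delta> ln_gt_zero[of 2] by linarith
  obtain r f where s: "spec N \<rho> r f" and r: "\<And>k. k < N \<Longrightarrow> 0 \<le> r k" using dens_spec[OF \<rho>] by metis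
  obtain q v where t: "spec N \<sigma> q v" and q: "\<And>k. k < N \<Longrightarrow> 0 \<le> q k" "\<And>k. k < N \<Longrightarrow> q k \<le> 1"
    using dens_spec[OF \<sigma>] by metis
  define H where "H = (\<Sum>j<N. r j * ln (r j))"
  have Hlog: "H = (\<Sum>j<N. r j * log0 (r j))"
    unfolding H_def using r by (intro sum.cong refl) (force simp: log0_def)
  \<comment> \<open>On the kernel of \<sigma> a parameter \<open>A\<close> replaces the infinite
    \<open>- ln (q i)\<close>. If \<rho> has weight there, a large \<open>A\<close> beats any
    \<open>c0\<close>, which covers infinite relative entropy.\<close>
  define L where "L = (\<lambda>A i. if q i = 0 then A else - ln (q i))"
  have L: "0 \<le> L A i \<and> q i \<le> exp (- L A i)" if "i < N" "0 \<le> A" for A i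
    using q[OF that(1)] that(2) by (auto simp: L_def)
  have "\<exists>A\<ge>0. c0 < H + (\<Sum>i<N. qf N \<rho> (v i) * L A i)"
  proof (cases "supp_le \<rho> \<sigma>")
    case True
    have "(\<Sum>i<N. qf N \<rho> (v i) * L 0 i) = - (\<Sum>i<N. qf N \<rho> (v i) * log0 (q i))"
      unfolding sum_negf[symmetric] using q by (intro sum.cong refl) (force simp: L_def log0_def)
    thus ?thesis using c0 unfolding rel_ent_eq[OF \<rho> s t True] Hlog[symmetric] by auto
  next
    case False
    then obtain k where k: "k < N" "q k = 0" "qf N \<rho> (v k) \<noteq> 0" using supp_le_iff[OF \<rho> t] by blast
    hence kp: "0 < qf N \<rho> (v k)" using dens_qf[OF \<rho>, of "v k"] by simp
    define A where "A = max 0 ((c0 - H + 1) / qf N \<rho> (v k))"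
    have A0: "0 \<le> A" by (simp add: A_def)
    have "(c0 - H + 1) / qf N \<rho> (v k) \<le> A" by (simp add: A_def)
    hence "c0 - H + 1 \<le> qf N \<rho> (v k) * L A k" using kp k by (simp add: L_def pos_divide_le_eq mult.commute)
    also have "\<dots> \<le> (\<Sum>i<N. qf N \<rho> (v i) * L A i)"
      using k L[OF _ A0] dens_qf[OF \<rho>] by (intro member_le_sum) auto
    finally show ?thesis using A0 by (intro exI[of _ A]) auto
  qed
  then obtain A where A: "0 \<le> A" "c0 < H + (\<Sum>i<N. qf N \<rho> (v i) * L A i)" by blast
  define e where "e = (\<Sum>i<N. qf N \<rho> (v i) * L A i)"
  obtain S where S: "frame N S" "\<forall>w u. (w, u) \<in> set S \<longrightarrow> 0 < w"
    and pay: "H + (1 - ln 2 / \<Delta>) * e - \<Delta> - ln 2 \<le> lsum S (\<lambda>w u. ln w * qf N \<rho> u)"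
    and two: "lsum S (\<lambda>w u. w * qf N \<sigma> u) \<le> 2"
    using pinched_measurement[OF \<rho> \<sigma> s t L[OF _ A(1)] \<Delta>] unfolding H_def e_def by blast
  have d: "0 < 1 - ln 2 / \<Delta>" using \<Delta> D0 by (simp add: field_simps)
  have "(1 - ln 2 / \<Delta>) * c0 < (1 - ln 2 / \<Delta>) * (H + e)"
    using A(2) d unfolding e_def by (intro mult_strict_left_mono)
  moreover have "ln 2 / \<Delta> * (- ln (real N)) \<le> ln 2 / \<Delta> * H"
    using entropy_le_ln_dim[OF \<rho> s] D0 unfolding H_def by (intro mult_left_mono) auto
  moreover have "(1 - x) * (H + e) = H + (1 - x) * e - x * H" for x :: real
    by (simp add: algebra_simps)
  note this[of "ln 2 / \<Delta>"]
  moreover have "ln 2 / \<Delta> * (- ln (real N)) = - (ln 2 / \<Delta> * ln (real N))" by simp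
  ultimately have "(1 - ln 2 / \<Delta>) * c0 - ln 2 / \<Delta> * ln (real N) - \<Delta> - ln 2 - 1
      < lsum S (\<lambda>w u. ln w * qf N \<rho> u) + 1 - lsum S (\<lambda>w u. w * qf N \<sigma> u)"
    using pay two by linarith
  thus ?thesis using S by blast
qed

section \<open>Measurements uniform over the two sets\<close>

definition rescale :: "real \<Rightarrow> real \<Rightarrow> (real \<times> (nat \<Rightarrow> complex)) list \<Rightarrow> (real \<times> (nat \<Rightarrow> complex)) list" where
  "rescale a c S = map (\<lambda>p. (a * fst p, \<lambda>i. of_real c * snd p i)) S"

lemma lsum_rescale: "lsum (rescale a c S) f = lsum S (\<lambda>w u. f (a * w) (\<lambda>i. of_real c * u i))"
  by (simp add: lsum_def rescale_def comp_def)

lemma set_rescale: "(w, u) \<in> set (rescale a c S) \<Longrightarrow> \<exists>v x. (v, x) \<in> set S \<and> w = a * v"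
  by (auto simp: rescale_def)

lemma frame_iff: "frame N S \<longleftrightarrow> (\<forall>i<N. \<forall>j<N. lsum S (\<lambda>w u. u i * cnj (u j)) = (if i = j then 1 else 0))"
proof
  assume f: "frame N S"
  show "\<forall>i<N. \<forall>j<N. lsum S (\<lambda>w u. u i * cnj (u j)) = (if i = j then 1 else 0)"
  proof (intro allI impI)
    fix i j assume ij: "i < N" "j < N"
    have "opl N (\<lambda>_. 1) S $$ (i, j) = 1\<^sub>m N $$ (i, j)" using f by (simp add: frame_def)
    thus "lsum S (\<lambda>w u. u i * cnj (u j)) = (if i = j then 1 else 0)" using ij by (simp add: opl_def)
  qed
next
  assume "\<forall>i<N. \<forall>j<N. lsum S (\<lambda>w u. u i * cnj (u j)) = (if i = j then 1 else 0)"
  thus "frame N S" unfolding frame_def by (intro eq_matI) (auto simp: opl_def)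
qed

text \<open>One of two measurements is run at random; vectors enter quadratically, hence the square
  roots.\<close>

lemma frame_mix:
  assumes "frame N S" "frame N T" "0 \<le> t" "t \<le> 1"
  shows "frame N (rescale 1 (sqrt t) S @ rescale 1 (sqrt (1 - t)) T)"
proof -
  have q: "lsum (rescale 1 (sqrt s) R) (\<lambda>w u. u i * cnj (u j)) = of_real s * lsum R (\<lambda>w u. u i * cnj (u j))"
    if "0 \<le> s" for s R i j
  proof -
    have "complex_of_real (sqrt s) * complex_of_real (sqrt s) = of_real s"
      using that by (simp flip: of_real_mult)
    hence "(of_real (sqrt s) * a) * (of_real (sqrt s) * b) = of_real s * (a * b)" for a b :: complex
      by (metis mult.assoc mult.left_commute)
    thus ?thesis unfolding lsum_rescale lsum_cmult[symmetric]
      by (intro lsum_cong) (simp only: complex_cnj_mult complex_cnj_complex_of_real)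
  qed
  show ?thesis using assms unfolding frame_iff by (auto simp: q)
qed

lemma sesq_scale: "sesq N A (\<lambda>i. of_real c * u i) (\<lambda>i. of_real c * u i) = of_real (c\<^sup>2) * sesq N A u u"
  unfolding sesq_def mv_scale ip_scale ip_scale_left by (simp add: power2_eq_square)

text \<open>Minus the logarithm of the mean \<open>x\<close> of \<open>w\<close> under \<sigma> is
  replaced by its lower bound \<open>1 - x\<close>. This makes the payoff affine in the pair, as the
  minimax theorem demands; normalising the labels afterwards restores the logarithmic form.\<close>

definition payoff :: "nat \<Rightarrow> (real \<times> (nat \<Rightarrow> complex)) list \<Rightarrow> complex mat \<Rightarrow> complex mat \<Rightarrow> real" where
  "payoff N S \<rho> \<sigma> = lsum S (\<lambda>w u. ln w * qf N \<rho> u) + 1 - lsum S (\<lambda>w u. w * qf N \<sigma> u)"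

lemma payoff_mix:
  assumes "0 \<le> t" "t \<le> 1"
  shows "payoff N (rescale 1 (sqrt t) S @ rescale 1 (sqrt (1 - t)) T) \<rho> \<sigma>
    = t * payoff N S \<rho> \<sigma> + (1 - t) * payoff N T \<rho> \<sigma>"
proof -
  have q: "qf N A (\<lambda>i. of_real (sqrt s) * u i) = s * qf N A u" if "0 \<le> s" for s A u
    using that sesq_scale[of N A "sqrt s" u] by (simp add: qf_def)
  have l: "lsum R (\<lambda>w u. h w * (s * qf N A u)) = s * lsum R (\<lambda>w u. h w * qf N A u)" for R s A and h :: "real \<Rightarrow> real"
    by (simp add: lsum_cmult[symmetric] mult_ac)
  have q': "qf N A (\<lambda>i. of_real (sqrt t) * u i) = t * qf N A u"
    "qf N A (\<lambda>i. of_real (sqrt (1 - t)) * u i) = (1 - t) * qf N A u" for A u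
    using q assms by auto
  show ?thesis unfolding payoff_def lsum_simps lsum_rescale mult_1 q' l by (simp add: algebra_simps)
qed

lemma payoff_convex:
  assumes "\<rho> \<in> carrier_mat N N" "\<rho>' \<in> carrier_mat N N" "\<sigma> \<in> carrier_mat N N" "\<sigma>' \<in> carrier_mat N N"
  shows "payoff N S (of_real t \<cdot>\<^sub>m \<rho> + of_real (1 - t) \<cdot>\<^sub>m \<rho>') (of_real t \<cdot>\<^sub>m \<sigma> + of_real (1 - t) \<cdot>\<^sub>m \<sigma>')
    = t * payoff N S \<rho> \<sigma> + (1 - t) * payoff N S \<rho>' \<sigma>'"
proof -
  have q: "qf N (of_real t \<cdot>\<^sub>m A + of_real (1 - t) \<cdot>\<^sub>m B) u = t * qf N A u + (1 - t) * qf N B u"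
    if "A \<in> carrier_mat N N" "B \<in> carrier_mat N N" for A B u
    using that by (simp add: qf_add[of _ N] qf_smult del: of_real_diff)
  have l: "lsum S (\<lambda>w u. h w * (t * qf N A u + (1 - t) * qf N B u))
      = t * lsum S (\<lambda>w u. h w * qf N A u) + (1 - t) * lsum S (\<lambda>w u. h w * qf N B u)"
    for A B and h :: "real \<Rightarrow> real"
    unfolding lsum_cmult[symmetric] lsum_add[symmetric] by (simp add: algebra_simps)
  show ?thesis unfolding payoff_def q[OF assms(1,2)] q[OF assms(3,4)] l by (simp add: algebra_simps)
qed

definition fun_mat :: "nat \<Rightarrow> (nat \<times> nat \<Rightarrow> complex) \<Rightarrow> complex mat" where
  "fun_mat N x = mat N N x"

lemma fun_mat_mat_fun: "A \<in> carrier_mat N N \<Longrightarrow> fun_mat N (mat_fun N A) = A"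
  by (rule eq_matI) (auto simp: fun_mat_def mat_fun_def)

lemma continuous_payoff: "continuous_on K (\<lambda>z. payoff N S (fun_mat N (fst z)) (fun_mat N (snd z)))"
proof -
  have c: "continuous_on K (\<lambda>z::(nat \<times> nat \<Rightarrow> complex) \<times> (nat \<times> nat \<Rightarrow> complex). fst z ij)"
    "continuous_on K (\<lambda>z::(nat \<times> nat \<Rightarrow> complex) \<times> (nat \<times> nat \<Rightarrow> complex). snd z ij)" for ij
    by (rule continuous_on_product_then_coordinatewise, rule continuous_on_fst continuous_on_snd,
        rule continuous_on_id)+
  have q: "qf N (fun_mat N x) u = Re (\<Sum>i<N. \<Sum>j<N. cnj (u i) * x (i, j) * u j)" for x u
    unfolding qf_def sesq_eq by (simp add: fun_mat_def)
  show ?thesis unfolding payoff_def lsum_nth q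
    by (intro continuous_on_add continuous_on_diff continuous_on_sum continuous_on_mult
        continuous_on_const continuous_on_Re c)
qed

lemma frame_weight_pos:
  assumes f: "frame N S" and w: "\<And>w u. (w, u) \<in> set S \<Longrightarrow> 0 < w" and \<sigma>: "\<sigma> \<in> dens N"
  shows "0 < lsum S (\<lambda>w u. w * qf N \<sigma> u)"
proof (rule ccontr)
  assume neg: "\<not> 0 < lsum S (\<lambda>w u. w * qf N \<sigma> u)"
  have nn: "0 \<le> w * qf N \<sigma> u" if "(w, u) \<in> set S" for w u using w[OF that] dens_qf[OF \<sigma>] by simp
  hence "lsum S (\<lambda>w u. w * qf N \<sigma> u) = 0" using neg lsum_nonneg[of S "\<lambda>w u. w * qf N \<sigma> u"] by auto
  hence "\<forall>p\<in>set S. fst p * qf N \<sigma> (snd p) = 0"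
    unfolding lsum_def using nn by (subst (asm) sum_list_nonneg_eq_0_iff) auto
  hence "qf N \<sigma> u = 0" if "(w, u) \<in> set S" for w u using w that by fastforce
  hence "lsum S (\<lambda>w u. qf N \<sigma> u) = lsum S (\<lambda>w u. 0)" by (intro lsum_cong) auto
  also have "\<dots> = 0" by (induction S) auto
  finally show False using frame_trace[OF f dens_carrier[OF \<sigma>]] dens_trace[OF \<sigma>] by simp
qed

text \<open>Minimax gives one list with payoff above \<open>c\<close> on all pairs. Dividing its
  labels by the supremum \<beta> of their means over \<open>E\<close> normalises them, and
  \<open>ln \<beta> \<le> \<beta> - 1\<close> preserves the bound on \<open>P\<close>.\<close>

lemma uniform_measurement:
  assumes P: "P \<subseteq> dens N" "convex_mat P" "compact_mat N P" "P \<noteq> {}"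
    and E: "E \<subseteq> dens N" "convex_mat E" "compact_mat N E" "E \<noteq> {}"
    and c: "\<And>\<rho> \<sigma>. \<rho> \<in> P \<Longrightarrow> \<sigma> \<in> E \<Longrightarrow>
      \<exists>S. frame N S \<and> (\<forall>w u. (w, u) \<in> set S \<longrightarrow> 0 < w) \<and> c < payoff N S \<rho> \<sigma>"
  shows "\<exists>S. frame N S \<and> (\<forall>w u. (w, u) \<in> set S \<longrightarrow> 0 < w) \<and>
    (\<forall>\<sigma>\<in>E. lsum S (\<lambda>w u. w * qf N \<sigma> u) \<le> 1) \<and> (\<forall>\<rho>\<in>P. c \<le> lsum S (\<lambda>w u. ln w * qf N \<rho> u))"
proof -
  have Pc: "A \<in> carrier_mat N N" if "A \<in> P \<or> A \<in> E" for A using P(1) E(1) that dens_carrier by blast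
  define T where "T = {S. frame N S \<and> (\<forall>w u. (w, u) \<in> set S \<longrightarrow> 0 < w)}"
  define F where "F = (\<lambda>S z. payoff N S (fun_mat N (fst z)) (fun_mat N (snd z))) ` T"
  define K where "K = (mat_fun N ` P) \<times> (mat_fun N ` E)"
  have "\<exists>f\<in>F. \<forall>z\<in>K. c < f z"
  proof (rule convexlike_minimax)
    show "compact K" using P(3) E(3) unfolding K_def compact_mat_def by (rule compact_Times)
    show "K \<noteq> {}" using P(4) E(4) by (auto simp: K_def)
    show "continuous_on K f" if "f \<in> F" for f using that continuous_payoff by (auto simp: F_def)
    show "(\<lambda>z. t * f z + (1 - t) * g z) \<in> F" if fg: "f \<in> F" "g \<in> F" and t: "0 \<le> t" "t \<le> 1" for f g t
    proof -
      obtain S R where S: "S \<in> T" "f = (\<lambda>z. payoff N S (fun_mat N (fst z)) (fun_mat N (snd z)))"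
        and R: "R \<in> T" "g = (\<lambda>z. payoff N R (fun_mat N (fst z)) (fun_mat N (snd z)))"
        using fg by (auto simp: F_def)
      let ?M = "rescale 1 (sqrt t) S @ rescale 1 (sqrt (1 - t)) R"
      have "?M \<in> T" using S(1) R(1) frame_mix[OF _ _ t] by (fastforce simp: T_def dest: set_rescale)
      moreover have "(\<lambda>z. t * f z + (1 - t) * g z) = (\<lambda>z. payoff N ?M (fun_mat N (fst z)) (fun_mat N (snd z)))"
        unfolding S(2) R(2) payoff_mix[OF t] ..
      ultimately show ?thesis unfolding F_def by blast
    qed
    show "\<exists>z\<in>K. \<forall>f\<in>F. f z = t * f x + (1 - t) * f y" if xy: "x \<in> K" "y \<in> K" and t: "0 \<le> t" "t \<le> 1" for x y t
    proof -
      obtain \<rho> \<sigma> where x: "\<rho> \<in> P" "\<sigma> \<in> E" "x = (mat_fun N \<rho>, mat_fun N \<sigma>)" using xy by (auto simp: K_def)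
      obtain \<rho>' \<sigma>' where y: "\<rho>' \<in> P" "\<sigma>' \<in> E" "y = (mat_fun N \<rho>', mat_fun N \<sigma>')" using xy by (auto simp: K_def)
      define \<rho>'' where "\<rho>'' = complex_of_real t \<cdot>\<^sub>m \<rho> + complex_of_real (1 - t) \<cdot>\<^sub>m \<rho>'"
      define \<sigma>'' where "\<sigma>'' = complex_of_real t \<cdot>\<^sub>m \<sigma> + complex_of_real (1 - t) \<cdot>\<^sub>m \<sigma>'"
      have "\<rho>'' \<in> P" "\<sigma>'' \<in> E"
        using P(2) E(2) x y t unfolding convex_mat_def \<rho>''_def \<sigma>''_def by blast+
      moreover have "payoff N S \<rho>'' \<sigma>'' = t * payoff N S \<rho> \<sigma> + (1 - t) * payoff N S \<rho>' \<sigma>'" for S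
        unfolding \<rho>''_def \<sigma>''_def using x y Pc by (intro payoff_convex) auto
      ultimately show ?thesis using x y Pc
        by (intro bexI[of _ "(mat_fun N \<rho>'', mat_fun N \<sigma>'')"]) (auto simp: F_def K_def fun_mat_mat_fun)
    qed
    show "\<exists>f\<in>F. c < f x" if xK: "x \<in> K" for x
    proof -
      obtain \<rho> \<sigma> where x: "\<rho> \<in> P" "\<sigma> \<in> E" "x = (mat_fun N \<rho>, mat_fun N \<sigma>)" using xK by (auto simp: K_def)
      from c[OF x(1,2)] obtain S where "S \<in> T" "c < payoff N S \<rho> \<sigma>" by (auto simp: T_def)
      thus ?thesis using x Pc by (auto simp: F_def fun_mat_mat_fun)
    qed
  qed
  then obtain S where ST: "S \<in> T" and Sc: "\<And>z. z \<in> K \<Longrightarrow> c < payoff N S (fun_mat N (fst z)) (fun_mat N (snd z))"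
    by (auto simp: F_def)
  have S: "frame N S" "\<And>w u. (w, u) \<in> set S \<Longrightarrow> 0 < w" using ST by (auto simp: T_def)
  have pay: "c < payoff N S \<rho> \<sigma>" if "\<rho> \<in> P" "\<sigma> \<in> E" for \<rho> \<sigma>
    using Sc[of "(mat_fun N \<rho>, mat_fun N \<sigma>)"] that Pc by (auto simp: K_def fun_mat_mat_fun)
  define W where "W = (\<lambda>\<sigma>. lsum S (\<lambda>w u. w * qf N \<sigma> u))"
  define V where "V = (\<lambda>\<rho>. lsum S (\<lambda>w u. ln w * qf N \<rho> u))"
  have WV: "W \<sigma> \<le> V \<rho> + 1 - c" if "\<rho> \<in> P" "\<sigma> \<in> E" for \<rho> \<sigma>
    using pay[OF that] by (simp add: payoff_def W_def V_def)
  obtain \<rho>0 \<sigma>0 where 0: "\<rho>0 \<in> P" "\<sigma>0 \<in> E" using P(4) E(4) by blast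
  have bdd: "bdd_above (W ` E)" using WV[OF 0(1)] by (intro bdd_aboveI[of _ "V \<rho>0 + 1 - c"]) auto
  define \<beta> where "\<beta> = Sup (W ` E)"
  have W\<beta>: "W \<sigma> \<le> \<beta>" if "\<sigma> \<in> E" for \<sigma> unfolding \<beta>_def using that bdd by (intro cSup_upper) auto
  have "0 < W \<sigma>0" unfolding W_def using S(2) 0 E(1) by (intro frame_weight_pos[OF S(1)]) auto
  hence \<beta>: "0 < \<beta>" using W\<beta>[OF 0(2)] by simp
  have \<beta>V: "ln \<beta> \<le> V \<rho> - c" if "\<rho> \<in> P" for \<rho>
  proof -
    have "\<beta> \<le> V \<rho> + 1 - c" unfolding \<beta>_def using WV[OF that] 0 by (intro cSup_least) auto
    thus ?thesis using ln_le_minus_one[OF \<beta>] by simp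
  qed
  let ?S = "rescale (1 / \<beta>) 1 S"
  have "frame N ?S" using S(1) by (simp add: frame_iff lsum_rescale)
  moreover have "0 < w" if "(w, u) \<in> set ?S" for w u using set_rescale[OF that] S(2) \<beta> by auto
  moreover have "lsum ?S (\<lambda>w u. w * qf N \<sigma> u) \<le> 1" if "\<sigma> \<in> E" for \<sigma>
  proof -
    have "lsum ?S (\<lambda>w u. w * qf N \<sigma> u) = (1 / \<beta>) * W \<sigma>"
      unfolding W_def lsum_cmult[symmetric] by (simp add: lsum_rescale)
    thus ?thesis using W\<beta>[OF that] \<beta> by simp
  qed
  moreover have "c \<le> lsum ?S (\<lambda>w u. ln w * qf N \<rho> u)" if r: "\<rho> \<in> P" for \<rho>
  proof -
    have "lsum ?S (\<lambda>w u. ln w * qf N \<rho> u) = lsum S (\<lambda>w u. ln w * qf N \<rho> u - ln \<beta> * qf N \<rho> u)"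
      unfolding lsum_rescale
    proof (rule lsum_cong)
      fix w u assume "(w, u) \<in> set S"
      hence "0 < w" by (rule S(2))
      thus "ln (1 / \<beta> * w) * qf N \<rho> (\<lambda>i. complex_of_real 1 * u i) = ln w * qf N \<rho> u - ln \<beta> * qf N \<rho> u"
        using \<beta> by (simp add: ln_div left_diff_distrib)
    qed
    also have "\<dots> = V \<rho> - ln \<beta> * lsum S (\<lambda>w u. qf N \<rho> u)" by (simp add: lsum_diff lsum_cmult V_def)
    also have "lsum S (\<lambda>w u. qf N \<rho> u) = 1"
      using frame_trace[OF S(1) Pc] dens_trace[of \<rho>] r P(1) by auto
    finally show ?thesis using \<beta>V[OF r] by simp
  qed
  ultimately show ?thesis by (intro exI[of _ ?S]) auto
qed

section \<open>Exponential moments and tensor powers\<close>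

lemma exp_le_quadratic:
  fixes x :: real assumes "\<bar>x\<bar> \<le> 1" shows "exp x \<le> 1 + x + x\<^sup>2"
proof (cases "0 \<le> x")
  case True thus ?thesis using assms exp_bound[of x] by simp
next
  case False
  have y: "0 < 1 - x" using False by simp
  have "exp x * (1 - x) \<le> exp x * exp (- x)" using exp_ge_add_one_self[of "-x"] by (intro mult_left_mono) auto
  hence "exp x * (1 - x) \<le> 1" by (simp flip: exp_add)
  also have "1 \<le> (1 + x + x\<^sup>2) * (1 - x)"
  proof -
    have "(1 + x + x\<^sup>2) * (1 - x) = 1 - x ^ 3" by (simp add: algebra_simps power2_eq_square power3_eq_cube)
    moreover have "x ^ 3 \<le> 0" using False by (simp add: power3_eq_cube mult_nonneg_nonpos mult_nonpos_nonpos)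
    ultimately show ?thesis by simp
  qed
  finally show ?thesis using y by simp
qed

text \<open>Second-order expansion of \<open>exp\<close> on a bounded range. The exponent
  \<open>t\<close> depends on \<open>x\<close> and \<eta> only, so the same one serves all
  probability vectors, that is, all states of a set.\<close>

lemma exponential_moment:
  fixes x :: "'i \<Rightarrow> real"
  assumes I: "finite I" and \<eta>: "0 < \<eta>"
  shows "\<exists>t>0. \<forall>c. (\<forall>i\<in>I. 0 \<le> c i) \<longrightarrow> (\<Sum>i\<in>I. c i) = 1 \<longrightarrow>
    (\<Sum>i\<in>I. c i * exp (t * x i)) \<le> exp (t * ((\<Sum>i\<in>I. c i * x i) + \<eta>))"
proof -
  define B where "B = 1 + (\<Sum>i\<in>I. \<bar>x i\<bar>)"
  have B: "1 \<le> B" unfolding B_def by (simp add: sum_nonneg)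
  have xB: "\<bar>x i\<bar> \<le> B" if "i \<in> I" for i
    unfolding B_def using member_le_sum[of i I "\<lambda>i. \<bar>x i\<bar>"] I that by auto
  \<comment> \<open>The first bound keeps \<open>t * x i\<close> in the range of
    \<open>exp_le_quadratic\<close>, the second makes the quadratic term at most
    \<open>t * \<eta>\<close>.\<close>
  define t where "t = min (1 / B) (\<eta> / B\<^sup>2)"
  have t: "0 < t" "t * B \<le> 1" "t * B\<^sup>2 \<le> \<eta>"
  proof -
    show "0 < t" using B \<eta> by (auto simp: t_def)
    have "t \<le> 1 / B" "t \<le> \<eta> / B\<^sup>2" by (auto simp: t_def)
    thus "t * B \<le> 1" "t * B\<^sup>2 \<le> \<eta>" using B by (auto simp: pos_le_divide_eq)
  qed
  have "(\<Sum>i\<in>I. c i * exp (t * x i)) \<le> exp (t * ((\<Sum>i\<in>I. c i * x i) + \<eta>))"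
    if c: "\<forall>i\<in>I. 0 \<le> c i" "(\<Sum>i\<in>I. c i) = 1" for c
  proof -
    have "exp (t * x i) \<le> 1 + t * x i + t * \<eta>" if i: "i \<in> I" for i
    proof -
      have "\<bar>t * x i\<bar> \<le> t * B" using xB[OF i] t by (simp add: abs_mult)
      hence "exp (t * x i) \<le> 1 + t * x i + (t * x i)\<^sup>2" using t by (intro exp_le_quadratic) simp
      moreover have "(t * x i)\<^sup>2 \<le> (t * B)\<^sup>2"
        using \<open>\<bar>t * x i\<bar> \<le> t * B\<close> by (metis abs_ge_zero power2_abs power_mono)
      moreover have "(t * B)\<^sup>2 = t * (t * B\<^sup>2)" by (simp add: power2_eq_square)
      moreover have "t * (t * B\<^sup>2) \<le> t * \<eta>" using t by (intro mult_left_mono) auto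
      ultimately show ?thesis by linarith
    qed
    hence "(\<Sum>i\<in>I. c i * exp (t * x i)) \<le> (\<Sum>i\<in>I. c i * (1 + t * x i + t * \<eta>))"
      using c by (intro sum_mono mult_left_mono) auto
    also have "\<dots> = (\<Sum>i\<in>I. c i) + t * (\<Sum>i\<in>I. c i * x i) + t * \<eta> * (\<Sum>i\<in>I. c i)"
      unfolding sum_distrib_left sum.distrib[symmetric] by (intro sum.cong refl) (simp add: algebra_simps)
    also have "\<dots> = 1 + t * ((\<Sum>i\<in>I. c i * x i) + \<eta>)" using c by (simp add: algebra_simps)
    also have "\<dots> \<le> exp (t * ((\<Sum>i\<in>I. c i * x i) + \<eta>))" by (rule exp_ge_add_one_self)
    finally show ?thesis .
  qed
  thus ?thesis using t(1) by blast
qed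

text \<open>\<open>k\<close> copies of a block of dimension \<open>n\<close> and one last factor of
  dimension \<open>m\<close>, so that lengths not divisible by the block length are covered.\<close>

primrec tpow :: "nat \<Rightarrow> nat \<Rightarrow> (real \<times> (nat \<Rightarrow> complex)) list \<Rightarrow> (real \<times> (nat \<Rightarrow> complex)) list \<Rightarrow> nat
    \<Rightarrow> (real \<times> (nat \<Rightarrow> complex)) list" where
  "tpow n m S T 0 = T"
| "tpow n m S T (Suc k) = tens (n ^ k * m) S (tpow n m S T k)"

primrec kpow :: "complex mat \<Rightarrow> complex mat \<Rightarrow> nat \<Rightarrow> complex mat" where
  "kpow A B 0 = B"
| "kpow A B (Suc k) = kron A (kpow A B k)"

lemma kpow_carrier:
  "A \<in> carrier_mat n n \<Longrightarrow> B \<in> carrier_mat m m \<Longrightarrow> kpow A B k \<in> carrier_mat (n ^ k * m) (n ^ k * m)"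
proof (induction k)
  case (Suc k)
  thus ?case using kron_carrier[of A n "kpow A B k" "n ^ k * m"] by (simp add: mult.assoc)
qed simp

lemma kron_herm:
  assumes A: "A \<in> carrier_mat m m" "herm m A" and B: "B \<in> carrier_mat n n" "herm n B"
  shows "herm (m * n) (kron A B)"
proof -
  obtain a e where a: "spec m A a e" using spec_exists A by blast
  obtain b f where b: "spec n B b f" using spec_exists B by blast
  have "kron A B = opl (m * n) (\<lambda>w. w) (tens n (spec_list m a e) (spec_list n b f))"
    by (subst opl_tens) (auto simp: opl_spec[OF a] opl_spec[OF b])
  thus ?thesis by (simp add: herm_opl)
qed

lemma kpow_herm:
  assumes "A \<in> carrier_mat n n" "herm n A" "B \<in> carrier_mat m m" "herm m B"
  shows "herm (n ^ k * m) (kpow A B k)"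
proof (induction k)
  case (Suc k)
  thus ?case using kron_herm[OF assms(1,2) kpow_carrier[OF assms(1,3)] Suc] by (simp add: mult.assoc)
qed (simp add: assms)

lemma frame_tpow: "frame n S \<Longrightarrow> frame m T \<Longrightarrow> frame (n ^ k * m) (tpow n m S T k)"
proof (induction k)
  case (Suc k)
  thus ?case using frame_tens[of n S "n ^ k * m" "tpow n m S T k"] by (simp add: mult.assoc)
qed simp

lemma tpow_weights:
  assumes "\<And>w u. (w, u) \<in> set S \<Longrightarrow> w \<in> W" "\<And>w u. (w, u) \<in> set T \<Longrightarrow> w \<in> W"
    and "\<And>a b. a \<in> W \<Longrightarrow> b \<in> W \<Longrightarrow> a * b \<in> W"
  shows "(w, u) \<in> set (tpow n m S T k) \<Longrightarrow> w \<in> W"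
proof (induction k arbitrary: w u)
  case 0 thus ?case using assms(2) by simp
next
  case (Suc k)
  from set_tens[OF Suc.prems[simplified]] obtain a v b v' where
    "(a, v) \<in> set S" "(b, v') \<in> set (tpow n m S T k)" "w = a * b" by blast
  thus ?case using assms(1,3) Suc.IH by blast
qed

text \<open>\<open>W\<close> is a multiplicatively closed set of labels on which \<phi> is
  multiplicative; in the applications it consists of the nonnegative or of the positive
  reals.\<close>

lemma opl_tpow:
  assumes S: "\<And>w u. (w, u) \<in> set S \<Longrightarrow> w \<in> W" and T: "\<And>w u. (w, u) \<in> set T \<Longrightarrow> w \<in> W"
    and W: "\<And>a b. a \<in> W \<Longrightarrow> b \<in> W \<Longrightarrow> a * b \<in> W \<and> \<phi> (a * b) = \<phi> a * \<phi> b"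
  shows "opl (n ^ k * m) \<phi> (tpow n m S T k) = kpow (opl n \<phi> S) (opl m \<phi> T) k"
proof (induction k)
  case (Suc k)
  have "opl (n * (n ^ k * m)) \<phi> (tens (n ^ k * m) S (tpow n m S T k))
      = kron (opl n \<phi> S) (opl (n ^ k * m) \<phi> (tpow n m S T k))"
  proof (rule opl_tens)
    fix a u b v assume a: "(a, u) \<in> set S" "(b, v) \<in> set (tpow n m S T k)"
    have "b \<in> W" by (rule tpow_weights[OF S T _ a(2)]) (use W in auto)
    thus "\<phi> (a * b) = \<phi> a * \<phi> b" using S[OF a(1)] W by blast
  qed
  thus ?case using Suc by (simp add: mult.assoc)
qed simp

lemma lsum_kpow:
  assumes A: "A \<in> carrier_mat n n" "herm n A" and B: "B \<in> carrier_mat m m" "herm m B"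
    and S: "\<And>w u. (w, u) \<in> set S \<Longrightarrow> w \<in> W" and T: "\<And>w u. (w, u) \<in> set T \<Longrightarrow> w \<in> W"
    and W: "\<And>a b. a \<in> W \<Longrightarrow> b \<in> W \<Longrightarrow> a * b \<in> W \<and> \<phi> (a * b) = \<phi> a * \<phi> b"
  shows "lsum (tpow n m S T k) (\<lambda>w u. \<phi> w * qf (n ^ k * m) (kpow A B k) u)
    = (lsum S (\<lambda>w u. \<phi> w * qf n A u)) ^ k * lsum T (\<lambda>w u. \<phi> w * qf m B u)"
proof (induction k)
  case (Suc k)
  have "lsum (tens (n ^ k * m) S (tpow n m S T k)) (\<lambda>w u. \<phi> w * qf (n * (n ^ k * m)) (kron A (kpow A B k)) u)
      = lsum S (\<lambda>w u. \<phi> w * qf n A u) * lsum (tpow n m S T k) (\<lambda>w u. \<phi> w * qf (n ^ k * m) (kpow A B k) u)"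
  proof (rule lsum_kron[OF A kpow_carrier[OF A(1) B(1)] kpow_herm[OF A B]])
    fix a u b v assume a: "(a, u) \<in> set S" "(b, v) \<in> set (tpow n m S T k)"
    have "b \<in> W" by (rule tpow_weights[OF S T _ a(2)]) (use W in auto)
    thus "\<phi> (a * b) = \<phi> a * \<phi> b" using S[OF a(1)] W by blast
  qed
  thus ?case using Suc by (simp add: mult.assoc)
qed simp

section \<open>Channels to and from the battery\<close>

definition std :: "nat \<Rightarrow> nat \<Rightarrow> complex" where
  "std k i = (if i = k then 1 else 0)"

lemma onb_std: "onb N std"
proof (rule onbI)
  fix k l assume "k < N" "l < N"
  thus "ip N (std k) (std l) = (if k = l then 1 else 0)"
    by (simp add: ip_def std_def if_distrib[of cnj] if_distrib[of "\<lambda>x. x * _"] cong: if_cong)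
qed

lemma qf_std: "i < N \<Longrightarrow> qf N A (std i) = Re (A $$ (i, i))"
  by (simp add: qf_def sesq_eq std_def if_distrib[of cnj] if_distrib[of "\<lambda>x. x * _"]
      if_distrib[of "\<lambda>x. _ * x"] cong: if_cong)

lemma psd_diag: "A \<in> carrier_mat N N \<Longrightarrow> psd A \<Longrightarrow> i < N \<Longrightarrow> 0 \<le> Re (A $$ (i, i))"
  using psd_qf[of A N "std i"] qf_std by simp

lemma spec_diag: "spec N (mat N N (\<lambda>(i, j). if i = j then of_real (lam i) else 0)) lam std"
proof -
  have "(if i = j then complex_of_real (lam i) else 0) = (\<Sum>k<N. of_real (lam k) * (std k i * cnj (std k j)))"
    if "i < N" for i j
  proof -
    have "(\<Sum>k<N. of_real (lam k) * (std k i * cnj (std k j)))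
        = (\<Sum>k<N. if k = i then if i = j then complex_of_real (lam i) else 0 else 0)"
      by (intro sum.cong refl) (auto simp: std_def)
    thus ?thesis using that by simp
  qed
  thus ?thesis using onb_std by (auto simp: spec_def)
qed

lemma sesq_linear:
  assumes "A \<in> carrier_mat N N" "B \<in> carrier_mat N N"
  shows "sesq N (c \<cdot>\<^sub>m A + B) u v = c * sesq N A u v + sesq N B u v"
  using assms by (simp add: sesq_eq algebra_simps sum.distrib sum_distrib_left)

section \<open>Block matrices and complete positivity\<close>

definition blk :: "nat \<Rightarrow> complex mat \<Rightarrow> nat \<Rightarrow> nat \<Rightarrow> complex mat" where
  "blk N X a b = mat N N (\<lambda>(p, q). X $$ (a * N + p, b * N + q))"

lemma blk_carrier [simp]: "blk N X a b \<in> carrier_mat N N"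
  by (simp add: blk_def)

lemma sesq_blocks:
  "sesq (k * N) X (tv N x u) (tv N y v) = (\<Sum>a<k. \<Sum>b<k. cnj (x a) * sesq N (blk N X a b) u v * y b)"
proof -
  have "sesq (k * N) X (tv N x u) (tv N y v)
    = (\<Sum>i<k * N. \<Sum>j<k * N. cnj (x (i div N)) * cnj (u (i mod N))
        * X $$ ((i div N) * N + i mod N, (j div N) * N + j mod N) * (y (j div N) * v (j mod N)))"
    unfolding sesq_eq by (simp add: tv_def)
  also have "\<dots> = (\<Sum>i<k * N. \<Sum>b<k. \<Sum>q<N. cnj (x (i div N)) * cnj (u (i mod N))
        * X $$ ((i div N) * N + i mod N, b * N + q) * (y b * v q))"
    by (intro sum.cong refl sum_div_mod)
  also have "\<dots> = (\<Sum>a<k. \<Sum>p<N. \<Sum>b<k. \<Sum>q<N. cnj (x a) * cnj (u p) * X $$ (a * N + p, b * N + q) * (y b * v q))"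
    by (rule sum_div_mod)
  also have "\<dots> = (\<Sum>a<k. \<Sum>b<k. \<Sum>p<N. \<Sum>q<N. cnj (x a) * cnj (u p) * X $$ (a * N + p, b * N + q) * (y b * v q))"
    by (intro sum.cong refl sum.swap)
  also have "\<dots> = (\<Sum>a<k. \<Sum>b<k. cnj (x a) * sesq N (blk N X a b) u v * y b)"
    unfolding sesq_eq sum_distrib_left sum_distrib_right
    by (intro sum.cong refl) (simp add: blk_def mult_ac)
  finally show ?thesis .
qed

lemma mul_add_less: "a < k \<Longrightarrow> p < N \<Longrightarrow> a * N + p < k * (N::nat)"
proof -
  assume "a < k" "p < N"
  hence "a * N + p < Suc a * N" by simp
  also have "\<dots> \<le> k * N" using \<open>a < k\<close> by (intro mult_right_mono) auto
  finally show ?thesis .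
qed

lemma sesq_blk_commute:
  assumes h: "herm (k * N) X" and ab: "a < k" "b < k"
  shows "sesq N (blk N X b a) u u = cnj (sesq N (blk N X a b) u u)"
proof -
  have "cnj (sesq N (blk N X a b) u u) = (\<Sum>p<N. \<Sum>q<N. u p * cnj (X $$ (a * N + p, b * N + q)) * cnj (u q))"
    unfolding sesq_eq by (simp add: blk_def)
  also have "\<dots> = (\<Sum>p<N. \<Sum>q<N. u p * X $$ (b * N + q, a * N + p) * cnj (u q))"
  proof (intro sum.cong refl)
    fix p q assume "p \<in> {..<N}" "q \<in> {..<N}"
    hence "X $$ (b * N + q, a * N + p) = cnj (X $$ (a * N + p, b * N + q))"
      using h ab mul_add_less[of a k p N] mul_add_less[of b k q N] unfolding herm_def by blast
    thus "u p * cnj (X $$ (a * N + p, b * N + q)) * cnj (u q) = u p * X $$ (b * N + q, a * N + p) * cnj (u q)"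
      by (simp only:)
  qed
  also have "\<dots> = (\<Sum>q<N. \<Sum>p<N. u p * X $$ (b * N + q, a * N + p) * cnj (u q))" by (rule sum.swap)
  also have "\<dots> = sesq N (blk N X b a) u u"
    unfolding sesq_eq by (intro sum.cong refl) (simp add: blk_def mult_ac)
  finally show ?thesis by simp
qed

lemma ampliate_entry:
  "i < k * K \<Longrightarrow> j < k * K \<Longrightarrow>
    ampliate k N K F X $$ (i, j) = F (blk N X (i div K) (j div K)) $$ (i mod K, j mod K)"
  by (simp add: ampliate_def blk_def)

lemma ampliate_carrier [simp]: "ampliate k N K F X \<in> carrier_mat (k * K) (k * K)"
  by (simp add: ampliate_def)

text \<open>A randomised test: outcome \<open>w\<close> is accepted with probability
  \<open>\<phi> w\<close>, and acceptance is recorded as the excited battery state.\<close>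

definition measure_channel :: "nat \<Rightarrow> (real \<Rightarrow> real) \<Rightarrow> (real \<times> (nat \<Rightarrow> complex)) list \<Rightarrow> complex mat \<Rightarrow> complex mat" where
  "measure_channel N \<phi> S X = mat 2 2 (\<lambda>(i, j).
     if i = j then lsum S (\<lambda>w u. of_real (if i = 1 then \<phi> w else 1 - \<phi> w) * sesq N X u u) else 0)"

lemma sum_lessThan_2: "(\<Sum>i<2. f i) = f 0 + (f (1::nat) :: 'a::comm_monoid_add)"
  by (simp add: numeral_2_eq_2)

lemma cptp_measure_channel:
  assumes f: "frame N S" and \<phi>: "\<And>w u. (w, u) \<in> set S \<Longrightarrow> 0 \<le> \<phi> w \<and> \<phi> w \<le> 1"
  shows "cptp N 2 (measure_channel N \<phi> S)"
proof -
  let ?F = "measure_channel N \<phi> S"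
  define \<psi> where "\<psi> = (\<lambda>o' w. if o' = (1::nat) then \<phi> w else 1 - \<phi> w)"
  have F: "?F X = mat 2 2 (\<lambda>(i, j). if i = j then lsum S (\<lambda>w u. of_real (\<psi> i w) * sesq N X u u) else 0)" for X
    unfolding measure_channel_def \<psi>_def ..
  have \<psi>0: "0 \<le> \<psi> i w" if "(w, u) \<in> set S" for i w u using \<phi>[OF that] by (simp add: \<psi>_def)
  have tr: "mtrace (?F A) = mtrace A" if A: "A \<in> carrier_mat N N" for A
  proof -
    have "mtrace (?F A) = lsum S (\<lambda>w u. of_real (\<psi> 0 w) * sesq N A u u + of_real (\<psi> 1 w) * sesq N A u u)"
      by (simp add: mtrace_def F sum_lessThan_2 lsum_add)
    also have "\<dots> = lsum S (\<lambda>w u. of_real 1 * sesq N A u u)"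
      by (intro lsum_cong) (simp add: \<psi>_def algebra_simps)
    also have "\<dots> = mtrace (opl N (\<lambda>_. 1) S * A)" by (rule mtrace_opl_mult[OF A, symmetric])
    also have "\<dots> = mtrace A" using f A by (simp add: frame_def)
    finally show ?thesis .
  qed
  have lin: "?F (c \<cdot>\<^sub>m A + B) = c \<cdot>\<^sub>m ?F A + ?F B"
    if A: "A \<in> carrier_mat N N" and B: "B \<in> carrier_mat N N" for A B c
  proof (rule eq_matI)
    fix i j assume "i < dim_row (c \<cdot>\<^sub>m ?F A + ?F B)" "j < dim_col (c \<cdot>\<^sub>m ?F A + ?F B)"
    hence ij: "i < 2" "j < 2" by (auto simp: F)
    have "lsum S (\<lambda>w u. of_real (\<psi> i w) * sesq N (c \<cdot>\<^sub>m A + B) u u)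
        = c * lsum S (\<lambda>w u. of_real (\<psi> i w) * sesq N A u u) + lsum S (\<lambda>w u. of_real (\<psi> i w) * sesq N B u u)"
      unfolding sesq_linear[OF A B] lsum_cmult[symmetric] lsum_add[symmetric]
      by (intro lsum_cong) (simp add: algebra_simps)
    thus "?F (c \<cdot>\<^sub>m A + B) $$ (i, j) = (c \<cdot>\<^sub>m ?F A + ?F B) $$ (i, j)"
      using ij by (cases "i = j") (simp_all add: F)
  qed (auto simp: F)
  have cp: "psd (ampliate k N 2 ?F X)" if X: "X \<in> carrier_mat (k * N) (k * N)" "psd X" for k X
  proof -
    let ?Y = "ampliate k N 2 ?F X"
    have hX: "herm (k * N) X" by (rule psd_herm[OF X])
    have ent: "?Y $$ (i, j) = (if i mod 2 = j mod 2
        then lsum S (\<lambda>w u. of_real (\<psi> (i mod 2) w) * sesq N (blk N X (i div 2) (j div 2)) u u) else 0)"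
      if "i < k * 2" "j < k * 2" for i j
      unfolding ampliate_entry[OF that] by (simp add: F)
    have "herm (k * 2) ?Y" unfolding herm_def
    proof (intro allI impI)
      fix i j assume ij: "i < k * 2" "j < k * 2"
      have "lsum S (\<lambda>w u. of_real (\<psi> (j mod 2) w) * sesq N (blk N X (j div 2) (i div 2)) u u)
          = cnj (lsum S (\<lambda>w u. of_real (\<psi> (j mod 2) w) * sesq N (blk N X (i div 2) (j div 2)) u u))"
        using sesq_blk_commute[OF hX, of "i div 2" "j div 2"] div_mod_less[OF ij(1)] div_mod_less[OF ij(2)]
        unfolding lsum_nth by simp
      thus "?Y $$ (j, i) = cnj (?Y $$ (i, j))" unfolding ent[OF ij] ent[OF ij(2,1)] by auto
    qed
    \<comment> \<open>Splitting \<open>v\<close> by the battery index \<open>c\<close> turns the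
      form of the amplified output into a nonnegative combination of forms of \<open>X\<close> at
      elementary tensors.\<close>
    moreover have "0 \<le> qf (k * 2) ?Y v" for v
    proof -
      define x where "x = (\<lambda>c a. v (a * 2 + c))"
      define B where "B = (\<lambda>c a b. lsum S (\<lambda>w u. of_real (\<psi> c w) * sesq N (blk N X a b) u u))"
      define f where "f = (\<lambda>a c b c'. if c = c' then cnj (x c a) * B c a b * x c b else 0)"
      have "sesq (k * 2) ?Y v v = (\<Sum>i<k * 2. \<Sum>j<k * 2. f (i div 2) (i mod 2) (j div 2) (j mod 2))"
        unfolding sesq_eq
      proof (intro sum.cong refl)
        fix i j assume "i \<in> {..<k * 2}" "j \<in> {..<k * 2}"
        hence ij: "i < k * 2" "j < k * 2" by auto
        have xv: "x (i mod 2) (i div 2) = v i" for i unfolding x_def by (metis div_mult_mod_eq)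
        show "cnj (v i) * ?Y $$ (i, j) * v j = f (i div 2) (i mod 2) (j div 2) (j mod 2)"
        proof (cases "i mod 2 = j mod 2")
          case True
          have "x (i mod 2) (j div 2) = v j" unfolding True by (rule xv)
          thus ?thesis unfolding ent[OF ij] f_def B_def using True xv[of i] by (simp only: if_True simp_thms)
        qed (simp add: ent[OF ij] f_def)
      qed
      also have "\<dots> = (\<Sum>i<k * 2. \<Sum>b<k. \<Sum>c'<2. f (i div 2) (i mod 2) b c')"
        by (intro sum.cong refl sum_div_mod)
      also have "\<dots> = (\<Sum>a<k. \<Sum>c<2. \<Sum>b<k. \<Sum>c'<2. f a c b c')"
        by (rule sum_div_mod)
      also have "\<dots> = (\<Sum>a<k. \<Sum>c<2. \<Sum>b<k. cnj (x c a) * B c a b * x c b)"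
        by (intro sum.cong refl) (auto simp: f_def sum_lessThan_2 less_2_cases_iff)
      also have "\<dots> = (\<Sum>c<2. \<Sum>a<k. \<Sum>b<k. cnj (x c a) * B c a b * x c b)" by (rule sum.swap)
      also have "\<dots> = (\<Sum>c<2. lsum S (\<lambda>w u. of_real (\<psi> c w) * sesq (k * N) X (tv N (x c) u) (tv N (x c) u)))"
      proof (intro sum.cong refl)
        fix c
        have "lsum S (\<lambda>w u. of_real (\<psi> c w) * sesq (k * N) X (tv N (x c) u) (tv N (x c) u))
            = (\<Sum>a<k. \<Sum>b<k. lsum S (\<lambda>w u. cnj (x c a) * (of_real (\<psi> c w) * sesq N (blk N X a b) u u) * x c b))"
          unfolding lsum_sum sesq_blocks sum_distrib_left by (simp add: mult_ac)
        thus "(\<Sum>a<k. \<Sum>b<k. cnj (x c a) * B c a b * x c b)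
            = lsum S (\<lambda>w u. of_real (\<psi> c w) * sesq (k * N) X (tv N (x c) u) (tv N (x c) u))"
          unfolding B_def by (simp only: lsum_multc lsum_cmult)
      qed
      finally have "qf (k * 2) ?Y v = (\<Sum>c<2. lsum S (\<lambda>w u. \<psi> c w * qf (k * N) X (tv N (x c) u)))"
        unfolding qf_def[of "k * 2"] by (simp add: Re_lsum qf_def)
      thus ?thesis using psd_qf[OF X] \<psi>0 by (auto intro!: sum_nonneg lsum_nonneg)
    qed
    ultimately show ?thesis by (simp add: psd_iff[of _ "k * 2"])
  qed
  show ?thesis unfolding cptp_def using tr lin cp by (auto simp: F)
qed

text \<open>The battery is measured in its basis; \<sigma> is prepared on ground, \<omega> on
  excited.\<close>

definition prepare_channel :: "complex mat \<Rightarrow> complex mat \<Rightarrow> complex mat \<Rightarrow> complex mat" where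
  "prepare_channel \<sigma> \<omega> X = X $$ (0, 0) \<cdot>\<^sub>m \<sigma> + X $$ (1, 1) \<cdot>\<^sub>m \<omega>"

lemma psd_add: "A \<in> carrier_mat N N \<Longrightarrow> B \<in> carrier_mat N N \<Longrightarrow> psd A \<Longrightarrow> psd B \<Longrightarrow> psd (A + B)"
  by (simp add: psd_iff[of _ N] herm_add qf_add)

lemma psd_smult: "A \<in> carrier_mat N N \<Longrightarrow> psd A \<Longrightarrow> 0 \<le> c \<Longrightarrow> psd (of_real c \<cdot>\<^sub>m A)"
  by (simp add: psd_iff[of _ N] herm_smult qf_smult)

lemma psd_diagonal_blocks:
  assumes X: "X \<in> carrier_mat (k * 2) (k * 2)" "psd X" and c: "c < 2"
  shows "psd (mat k k (\<lambda>(a, b). X $$ (a * 2 + c, b * 2 + c)))" (is "psd ?Z")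
proof -
  have h: "herm (k * 2) X" by (rule psd_herm[OF X])
  have "herm k ?Z"
    unfolding herm_def
  proof (intro allI impI)
    fix i j assume ij: "i < k" "j < k"
    have "X $$ (j * 2 + c, i * 2 + c) = cnj (X $$ (i * 2 + c, j * 2 + c))"
      using h mul_add_less[OF ij(1) c] mul_add_less[OF ij(2) c] unfolding herm_def by blast
    thus "?Z $$ (j, i) = cnj (?Z $$ (i, j))" using ij by (simp only: index_mat case_prod_conv)
  qed
  moreover have "0 \<le> qf k ?Z x" for x
  proof -
    have b: "sesq 2 (blk 2 X a b) (std c) (std c) = X $$ (a * 2 + c, b * 2 + c)" for a b
      using c by (simp add: sesq_eq std_def blk_def if_distrib[of cnj] if_distrib[of "\<lambda>x. x * _"]
        if_distrib[of "\<lambda>x. _ * x"] cong: if_cong)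
    have "sesq (k * 2) X (tv 2 x (std c)) (tv 2 x (std c)) = sesq k ?Z x x"
      unfolding sesq_blocks b by (simp add: sesq_eq)
    thus ?thesis using psd_qf[OF X, of "tv 2 x (std c)"] by (simp add: qf_def)
  qed
  ultimately show ?thesis by (simp add: psd_iff[of _ k])
qed

text \<open>Amplification yields \<open>kron (Z 0) \<sigma> + kron (Z 1) \<omega>\<close>, where the
  \<open>Z c\<close> are principal submatrices of the input and so inherit positivity.\<close>

lemma cptp_prepare_channel:
  assumes s: "\<sigma> \<in> dens N" and w: "\<omega> \<in> dens N"
  shows "cptp 2 N (prepare_channel \<sigma> \<omega>)"
proof -
  note S = dens_carrier[OF s] and W = dens_carrier[OF w]
  let ?F = "prepare_channel \<sigma> \<omega>"
  have FN: "?F A \<in> carrier_mat N N" for A using S W by (simp add: prepare_channel_def)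
  have tr: "mtrace (?F A) = mtrace A" if "A \<in> carrier_mat 2 2" for A
    using that S W dens_trace[OF s] dens_trace[OF w]
    by (simp add: prepare_channel_def mtrace_add[of _ N] mtrace_smult[of _ N])
      (simp add: mtrace_def sum_lessThan_2)
  have lin: "?F (c \<cdot>\<^sub>m A + B) = c \<cdot>\<^sub>m ?F A + ?F B" if "A \<in> carrier_mat 2 2" "B \<in> carrier_mat 2 2" for A B c
    using that S W by (intro eq_matI) (auto simp: prepare_channel_def algebra_simps)
  have cp: "psd (ampliate k 2 N ?F X)" if X: "X \<in> carrier_mat (k * 2) (k * 2)" "psd X" for k X
  proof -
    define Z where "Z = (\<lambda>c. mat k k (\<lambda>(a, b). X $$ (a * 2 + c, b * 2 + c)))"
    have Z: "Z c \<in> carrier_mat k k" for c by (simp add: Z_def)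
    have "ampliate k 2 N ?F X = kron (Z 0) \<sigma> + kron (Z 1) \<omega>"
    proof (rule eq_matI)
      fix i j assume "i < dim_row (kron (Z 0) \<sigma> + kron (Z 1) \<omega>)" "j < dim_col (kron (Z 0) \<sigma> + kron (Z 1) \<omega>)"
      hence ij: "i < k * N" "j < k * N" using kron_carrier[OF Z W, of 1] by auto
      note dm = div_mod_less[OF ij(1)] div_mod_less[OF ij(2)]
      show "ampliate k 2 N ?F X $$ (i, j) = (kron (Z 0) \<sigma> + kron (Z 1) \<omega>) $$ (i, j)"
        unfolding ampliate_entry[OF ij]
        using dm ij S W kron_carrier[OF Z W, of 1] kron_entry[OF Z S ij, of 0] kron_entry[OF Z W ij, of 1]
        by (simp add: prepare_channel_def blk_def Z_def)
    qed (use kron_carrier[OF Z W, of 1] carrier_matD[OF ampliate_carrier[of k 2 N ?F X]] in auto)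
    moreover have "psd (Z 0)" "psd (Z 1)" unfolding Z_def by (rule psd_diagonal_blocks[OF X], simp)+
    ultimately show ?thesis
      using psd_kron[OF Z _ S] psd_kron[OF Z _ W] dens_psd s w
      by (auto intro!: psd_add[of _ "k * N"] kron_carrier Z S W)
  qed
  show ?thesis unfolding cptp_def using FN tr lin cp by blast
qed

lemma cptp_psd:
  assumes F: "cptp N K F" and A: "A \<in> carrier_mat N N" "psd A"
  shows "psd (F A)"
proof -
  have FA: "F A \<in> carrier_mat K K" using F A by (simp add: cptp_def)
  have "blk N A 0 0 = A" using A by (intro eq_matI) (auto simp: blk_def)
  hence "ampliate 1 N K F A = F A"
    using FA by (intro eq_matI) (auto simp: ampliate_entry[where k = 1, simplified] ampliate_def blk_def)
  moreover have "psd (ampliate 1 N K F A)" using F A unfolding cptp_def by (metis mult_1)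
  ultimately show ?thesis by simp
qed

lemma cptp_dens: "cptp N K F \<Longrightarrow> \<rho> \<in> dens N \<Longrightarrow> F \<rho> \<in> dens K"
  using cptp_psd[of N K F \<rho>] by (auto simp: dens_def cptp_def)

lemma cptp_linear:
  "cptp N K F \<Longrightarrow> A \<in> carrier_mat N N \<Longrightarrow> B \<in> carrier_mat N N \<Longrightarrow> F (c \<cdot>\<^sub>m A + B) = c \<cdot>\<^sub>m F A + F B"
  by (simp add: cptp_def)

lemma cptp_carrier: "cptp N K F \<Longrightarrow> A \<in> carrier_mat N N \<Longrightarrow> F A \<in> carrier_mat K K"
  by (simp add: cptp_def)

lemma cptp_trace: "cptp N K F \<Longrightarrow> A \<in> carrier_mat N N \<Longrightarrow> mtrace (F A) = mtrace A"
  by (simp add: cptp_def)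

lemma ket1_dens: "ket1 \<in> dens 2"
proof -
  have "ket1 = smat 2 (\<lambda>i. if i = 1 then 1 else 0) std"
    by (rule eq_matI) (auto simp: ket1_def smat_def std_def sum_lessThan_2 less_2_cases_iff)
  moreover have "mtrace ket1 = 1" by (simp add: mtrace_def ket1_def sum_lessThan_2)
  ultimately show ?thesis using psd_smat[OF onb_std, of 2 "\<lambda>i. if i = 1 then 1 else 0"]
    by (simp add: dens_def ket1_def)
qed

section \<open>Bounds on the battery quantities\<close>

lemma elog_mono: "x \<le> y \<Longrightarrow> elog x \<le> elog y"
  by (cases x; cases y) (auto simp: elog_def)

text \<open>The output on \<sigma> is \<open>battery (1 / x)\<close> with \<open>x\<close> the
  acceptance probability. It must be strictly positive because \<open>battery_set M\<close> does not
  contain the pure ground state.\<close>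

lemma betaW_geI:
  assumes f: "frame N S" and \<phi>: "\<And>w u. (w, u) \<in> set S \<Longrightarrow> 0 \<le> \<phi> w \<and> \<phi> w \<le> 1"
    and P: "P \<subseteq> dens N" and E: "E \<subseteq> dens N" and M: "1 < M"
    and p: "\<And>\<rho>. \<rho> \<in> P \<Longrightarrow> lsum S (\<lambda>w u. (1 - \<phi> w) * qf N \<rho> u) \<le> \<epsilon>"
    and e: "\<And>\<sigma>. \<sigma> \<in> E \<Longrightarrow> 0 < lsum S (\<lambda>w u. \<phi> w * qf N \<sigma> u) \<and> lsum S (\<lambda>w u. \<phi> w * qf N \<sigma> u) \<le> 1 / M"
  shows "ereal (ln M) \<le> betaW N \<epsilon> P E"
proof -
  let ?F = "measure_channel N \<phi> S"
  define x where "x = (\<lambda>\<rho>. lsum S (\<lambda>w u. \<phi> w * qf N \<rho> u))"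
  have one: "lsum S (\<lambda>w u. (1 - \<phi> w) * qf N \<rho> u) = 1 - x \<rho>" if "\<rho> \<in> dens N" for \<rho>
    using frame_trace[OF f dens_carrier[OF that]] dens_trace[OF that]
    by (simp add: x_def left_diff_distrib lsum_diff)
  have F: "?F \<rho> = mat 2 2 (\<lambda>(i, j). if i = j then of_real (if i = 1 then x \<rho> else 1 - x \<rho>) else 0)"
    if r: "\<rho> \<in> dens N" for \<rho>
  proof -
    have "lsum S (\<lambda>w u. of_real (h w) * sesq N \<rho> u u) = of_real (lsum S (\<lambda>w u. h w * qf N \<rho> u))" for h :: "real \<Rightarrow> real"
      by (simp add: sesq_self_real[OF dens_herm[OF r]] flip: lsum_of_real)
    thus ?thesis unfolding measure_channel_def by (intro eq_matI) (auto simp: one[OF r] x_def)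
  qed
  have "tdist (?F \<rho>) ket1 \<le> \<epsilon>" if "\<rho> \<in> P" for \<rho>
  proof -
    have r: "\<rho> \<in> dens N" using that P by auto
    have x: "0 \<le> 1 - x \<rho>" unfolding one[OF r, symmetric] using \<phi> dens_qf[OF r] by (auto intro!: lsum_nonneg)
    have "?F \<rho> - ket1 = mat 2 2 (\<lambda>(i, j). if i = j then of_real (if i = 1 then x \<rho> - 1 else 1 - x \<rho>) else 0)"
      unfolding F[OF r] by (rule eq_matI) (auto simp: ket1_def)
    hence "spec 2 (?F \<rho> - ket1) (\<lambda>i. if i = 1 then x \<rho> - 1 else 1 - x \<rho>) std"
      using spec_diag[of 2 "\<lambda>i. if i = 1 then x \<rho> - 1 else 1 - x \<rho>"] by simp
    hence "tdist (?F \<rho>) ket1 = 1 - x \<rho>"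
      unfolding tdist_def using x by (simp add: trace_norm_spec sum_lessThan_2)
    thus ?thesis using p[OF that] one[OF r] by simp
  qed
  moreover have "?F \<sigma> \<in> battery_set M" if "\<sigma> \<in> E" for \<sigma>
  proof -
    have x: "0 < x \<sigma>" "x \<sigma> \<le> 1 / M" using e[OF that] by (auto simp: x_def)
    have "?F \<sigma> = battery (1 / x \<sigma>)"
      using F[of \<sigma>] that E unfolding battery_def by (intro eq_matI) (auto simp: less_2_cases_iff)
    moreover have "M \<le> 1 / x \<sigma>" using x M by (simp add: field_simps)
    ultimately show ?thesis unfolding battery_set_def by blast
  qed
  moreover have ch: "cptp N 2 ?F" by (rule cptp_measure_channel[OF f]) (use \<phi> in auto)
  ultimately have "ereal M \<in> {ereal M | M. M > 1 \<and> (\<exists>F. cptp N 2 F \<and>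
      (\<forall>\<rho>\<in>P. tdist (F \<rho>) ket1 \<le> \<epsilon>) \<and> (\<forall>\<tau>\<in>E. F \<tau> \<in> battery_set M))}"
    using ch M by blast
  hence "elog (ereal M) \<le> betaW N \<epsilon> P E" unfolding betaW_def by (intro elog_mono Sup_upper)
  thus ?thesis using M by (simp add: elog_def)
qed

text \<open>The gap \<open>M * \<tau> - \<omega>\<close> is positive with trace
  \<open>M - 1\<close>. Its normalisation is the state to prepare on ground, and then
  \<open>battery M\<close> is sent exactly to \<tau>.\<close>

lemma betaC_leI:
  assumes t: "\<tau> \<in> E" "\<tau> \<in> dens N" and w: "\<omega> \<in> dens N" and r: "\<rho> \<in> P" "tdist \<omega> \<rho> \<le> \<epsilon>"
    and M: "1 < M" and le: "\<And>u. qf N \<omega> u \<le> M * qf N \<tau> u"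
  shows "betaC N \<epsilon> P E \<le> ereal (ln M)"
proof -
  note T = dens_carrier[OF t(2)] and W = dens_carrier[OF w]
  define \<sigma> where "\<sigma> = complex_of_real (1 / (M - 1)) \<cdot>\<^sub>m (complex_of_real M \<cdot>\<^sub>m \<tau> - \<omega>)"
  have D: "complex_of_real M \<cdot>\<^sub>m \<tau> - \<omega> \<in> carrier_mat N N" by (rule minus_carrier_mat[OF W])
  have "psd (complex_of_real M \<cdot>\<^sub>m \<tau> - \<omega>)"
    using D T W le by (simp add: psd_iff[of _ N] herm_diff herm_smult dens_herm[OF t(2)] dens_herm[OF w]
        qf_diff[of _ N] qf_smult)
  hence "psd \<sigma>" unfolding \<sigma>_def using D M by (intro psd_smult) auto
  moreover have "mtrace (complex_of_real M \<cdot>\<^sub>m \<tau> - \<omega>) = of_real (M - 1)"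
    using T W dens_trace[OF t(2)] dens_trace[OF w] by (simp add: mtrace_diff[of _ N] mtrace_smult[of _ N])
  hence "mtrace \<sigma> = 1" unfolding \<sigma>_def mtrace_smult[OF D] using M by (simp flip: of_real_mult of_real_diff)
  ultimately have s: "\<sigma> \<in> dens N" using D by (simp add: dens_def \<sigma>_def)
  let ?F = "prepare_channel \<sigma> \<omega>"
  have "?F ket1 = \<omega>" using s W dens_carrier[OF s]
    by (intro eq_matI) (auto simp: prepare_channel_def ket1_def)
  moreover have "?F (battery M) = \<tau>"
  proof (rule eq_matI)
    fix i j assume "i < dim_row \<tau>" "j < dim_col \<tau>"
    hence ij: "i < N" "j < N" using T by auto
    have c: "complex_of_real (1 - 1 / M) * complex_of_real (1 / (M - 1)) = complex_of_real (1 / M)"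
      using M unfolding of_real_mult[symmetric] by (intro arg_cong[where f = of_real]) (simp add: field_simps)
    have m: "complex_of_real (1 / M) * complex_of_real M = 1"
      using M unfolding of_real_mult[symmetric] by simp
    have "?F (battery M) $$ (i, j) = complex_of_real (1 - 1 / M) * (complex_of_real (1 / (M - 1)) *
        (complex_of_real M * \<tau> $$ (i, j) - \<omega> $$ (i, j))) + complex_of_real (1 / M) * \<omega> $$ (i, j)"
      using ij T W by (simp add: prepare_channel_def battery_def \<sigma>_def)
    also have "\<dots> = complex_of_real (1 / M) * (complex_of_real M * \<tau> $$ (i, j) - \<omega> $$ (i, j))
        + complex_of_real (1 / M) * \<omega> $$ (i, j)"
      by (simp only: mult.assoc[symmetric] c)
    also have "\<dots> = (complex_of_real (1 / M) * complex_of_real M) * \<tau> $$ (i, j)" by (simp only: ring_distribs) simp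
    finally show "?F (battery M) $$ (i, j) = \<tau> $$ (i, j)" unfolding m by simp
  qed (use T W dens_carrier[OF s] in \<open>auto simp: prepare_channel_def\<close>)
  ultimately have "ereal M \<in> {ereal M | M. M > 1 \<and> (\<exists>F. cptp 2 N F \<and>
      (\<exists>\<rho>\<in>P. \<exists>\<tau>\<in>E. tdist (F ket1) \<rho> \<le> \<epsilon> \<and> F (battery M) = \<tau>))}"
    using cptp_prepare_channel[OF s w] M r t(1) unfolding mem_Collect_eq
    by (intro exI[of _ M] conjI exI[of _ ?F] bexI[of _ \<rho>] bexI[of _ \<tau>] refl) auto
  hence "betaC N \<epsilon> P E \<le> elog (ereal M)" unfolding betaC_def by (intro elog_mono Inf_lower)
  thus ?thesis using M by (simp add: elog_def)
qed

text \<open>Distillation after formation is a channel on the battery itself: it sends \<open>\<pi>\<^sub>M\<^sub>'\<close> into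
  \<open>\<Pi>\<^sub>M\<close> while keeping weight at least \<open>1 - \<epsilon> - \<epsilon>'\<close> of the excited state.\<close>
lemma distill_form_bound:
  assumes P: "P \<subseteq> dens N" and E: "E \<subseteq> dens N" and eps: "\<epsilon> + \<epsilon>' < 1"
    and F: "cptp N 2 F" "\<And>\<rho>. \<rho> \<in> P \<Longrightarrow> tdist (F \<rho>) ket1 \<le> \<epsilon>" "\<And>\<tau>. \<tau> \<in> E \<Longrightarrow> F \<tau> \<in> battery_set M" and M: "1 < M"
    and G: "cptp 2 N G" and r: "\<rho> \<in> P" "tdist (G ket1) \<rho> \<le> \<epsilon>'" and t: "G (battery M') \<in> E" and M': "1 < M'"
  shows "M \<le> M' / (1 - \<epsilon> - \<epsilon>')"
proof -
  have rd: "\<rho> \<in> dens N" using r P by auto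
  have w: "G ket1 \<in> dens N" by (rule cptp_dens[OF G ket1_dens])
  define \<phi> where "\<phi> = (\<lambda>X. Re (F X $$ (1, 1)))"
  have tr2: "Re (mtrace Y) = Re (Y $$ (0, 0)) + Re (Y $$ (1, 1))" if "Y \<in> carrier_mat 2 2" for Y
    using that by (simp add: mtrace_def sum_lessThan_2)
  have add: "\<phi> (A + B) = \<phi> A + \<phi> B" if "A \<in> carrier_mat N N" "B \<in> carrier_mat N N" for A B
  proof -
    have "F (1 \<cdot>\<^sub>m A + B) = 1 \<cdot>\<^sub>m F A + F B" by (rule cptp_linear[OF F(1) that])
    moreover have "1 \<cdot>\<^sub>m A = A" using that by (intro eq_matI) auto
    ultimately show ?thesis using cptp_carrier[OF F(1) that(1)] cptp_carrier[OF F(1) that(2)] by (simp add: \<phi>_def)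
  qed
  have pos: "0 \<le> \<phi> A \<and> \<phi> A \<le> Re (mtrace A)" if "A \<in> carrier_mat N N" "psd A" for A
    using psd_diag[OF cptp_carrier[OF F(1) that(1)] cptp_psd[OF F(1) that], of 0]
      psd_diag[OF cptp_carrier[OF F(1) that(1)] cptp_psd[OF F(1) that], of 1]
      tr2[OF cptp_carrier[OF F(1) that(1)]] cptp_trace[OF F(1) that(1)] by (simp add: \<phi>_def)
  \<comment> \<open>The complementary effect is used because
    \<open>\<phi> \<rho> - \<phi> (G ket1)\<close> is to be bounded while the distance is given in
    the opposite order.\<close>
  have "(\<lambda>X. Re (mtrace X) - \<phi> X) (G ket1) - (\<lambda>X. Re (mtrace X) - \<phi> X) \<rho> \<le> tdist (G ket1) \<rho>"
  proof (rule effect_diff_le_tdist[OF w rd])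
    show "Re (mtrace (A + B)) - \<phi> (A + B) = Re (mtrace A) - \<phi> A + (Re (mtrace B) - \<phi> B)"
      if "A \<in> carrier_mat N N" "B \<in> carrier_mat N N" for A B
      using add[OF that] mtrace_add[OF that] by simp
    show "0 \<le> Re (mtrace A) - \<phi> A \<and> Re (mtrace A) - \<phi> A \<le> Re (mtrace A)"
      if "A \<in> carrier_mat N N" "psd A" for A using pos[OF that] by simp
  qed
  hence 1: "\<phi> \<rho> - \<phi> (G ket1) \<le> \<epsilon>'" using r(2) dens_trace[OF w] dens_trace[OF rd] by simp
  have "(\<lambda>Y. Re (Y $$ (0, 0))) (F \<rho>) - (\<lambda>Y. Re (Y $$ (0, 0))) ket1 \<le> tdist (F \<rho>) ket1"
  proof (rule effect_diff_le_tdist[OF cptp_dens[OF F(1) rd] ket1_dens])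
    show "0 \<le> Re (A $$ (0, 0)) \<and> Re (A $$ (0, 0)) \<le> Re (mtrace A)" if "A \<in> carrier_mat 2 2" "psd A" for A
      using psd_diag[OF that, of 0] psd_diag[OF that, of 1] tr2[OF that(1)] by simp
  qed auto
  hence "Re (F \<rho> $$ (0, 0)) \<le> \<epsilon>" using F(2)[OF r(1)] by (simp add: ket1_def)
  hence 2: "1 - \<epsilon> \<le> \<phi> \<rho>"
    using tr2[OF dens_carrier[OF cptp_dens[OF F(1) rd]]] dens_trace[OF cptp_dens[OF F(1) rd]] by (simp add: \<phi>_def)
  \<comment> \<open>The ground part of the battery state; its contribution is nonnegative and is
    dropped.\<close>
  define B where "B = smat 2 (\<lambda>i. if i = 0 then 1 - 1 / M' else 0) std"
  have B: "B \<in> carrier_mat 2 2" "psd B" unfolding B_def using M' by (auto intro!: psd_smat onb_std)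
  have K: "ket1 \<in> carrier_mat 2 2" by (simp add: ket1_def)
  have "battery M' = complex_of_real (1 / M') \<cdot>\<^sub>m ket1 + B"
    by (rule eq_matI) (auto simp: battery_def ket1_def B_def smat_def std_def sum_lessThan_2 less_2_cases_iff)
  hence "G (battery M') = complex_of_real (1 / M') \<cdot>\<^sub>m G ket1 + G B" using cptp_linear[OF G K B(1)] by simp
  hence "F (G (battery M')) = complex_of_real (1 / M') \<cdot>\<^sub>m F (G ket1) + F (G B)"
    using cptp_linear[OF F(1) cptp_carrier[OF G K] cptp_carrier[OF G B(1)]] by simp
  hence "\<phi> (G (battery M')) = Re (complex_of_real (1 / M') * F (G ket1) $$ (1, 1)) + \<phi> (G B)"
    using cptp_carrier[OF F(1) cptp_carrier[OF G K]] cptp_carrier[OF F(1) cptp_carrier[OF G B(1)]]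
    by (simp add: \<phi>_def)
  hence "\<phi> (G (battery M')) = 1 / M' * \<phi> (G ket1) + \<phi> (G B)" unfolding \<phi>_def by (simp only: Re_complex_of_real times_complex.simps Im_complex_of_real)
  moreover have "0 \<le> \<phi> (G B)" using pos[OF cptp_carrier[OF G B(1)] cptp_psd[OF G B]] by simp
  moreover have "(1 - \<epsilon> - \<epsilon>') / M' \<le> 1 / M' * \<phi> (G ket1)" using 1 2 M' by (simp add: divide_right_mono)
  moreover obtain M2 where M2: "M \<le> M2" "F (G (battery M')) = battery M2"
    using F(3)[OF t] by (auto simp: battery_set_def)
  hence "\<phi> (G (battery M')) = 1 / M2" by (simp add: \<phi>_def battery_def)
  ultimately have "(1 - \<epsilon> - \<epsilon>') / M' \<le> 1 / M2" by simp
  also have "\<dots> \<le> 1 / M" using M M2 by (intro divide_left_mono) auto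
  finally have "(1 - \<epsilon> - \<epsilon>') * M \<le> M'" using M M' by (simp add: field_simps)
  thus ?thesis using eps by (simp add: pos_le_divide_eq mult.commute)
qed

text \<open>The errors enter only through an additive constant, which disappears in the rate; this
  is what makes the limits independent of \<epsilon>. If no formation channel exists, the right-hand
  side is infinite.\<close>

lemma betaW_le_betaC:
  assumes P: "P \<subseteq> dens N" and E: "E \<subseteq> dens N" and eps: "\<epsilon> + \<epsilon>' < 1"
  shows "betaW N \<epsilon> P E \<le> betaC N \<epsilon>' P E + ereal (- ln (1 - \<epsilon> - \<epsilon>'))"
proof -
  define A where "A = {M. M > 1 \<and> (\<exists>F. cptp N 2 F \<and>
      (\<forall>\<rho>\<in>P. tdist (F \<rho>) ket1 \<le> \<epsilon>) \<and> (\<forall>\<tau>\<in>E. F \<tau> \<in> battery_set M))}"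
  define B where "B = {M. M > 1 \<and> (\<exists>F. cptp 2 N F \<and>
      (\<exists>\<rho>\<in>P. \<exists>\<tau>\<in>E. tdist (F ket1) \<rho> \<le> \<epsilon>' \<and> F (battery M) = \<tau>))}"
  have W: "betaW N \<epsilon> P E = elog (Sup (ereal ` A))"
    unfolding betaW_def A_def by (simp add: setcompr_eq_image)
  have C: "betaC N \<epsilon>' P E = elog (Inf (ereal ` B))"
    unfolding betaC_def B_def by (simp add: setcompr_eq_image)
  have le: "M \<le> M' / (1 - \<epsilon> - \<epsilon>')" if "M \<in> A" "M' \<in> B" for M M'
    using that unfolding A_def B_def by (auto intro!: distill_form_bound[OF P E eps])
  show ?thesis
  proof (cases "B = {}")
    case True thus ?thesis by (simp add: C elog_def top_ereal_def)
  next
    case False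
    define m where "m = Inf B"
    have bb: "bdd_below B" unfolding B_def by (intro bdd_belowI[of _ 1]) auto
    have Im: "Inf (ereal ` B) = ereal m"
      using ereal_Inf'[OF bb False] by (simp add: m_def)
    have m1: "1 \<le> m" unfolding m_def using False by (intro cInf_greatest) (auto simp: B_def)
    have "M \<le> m / (1 - \<epsilon> - \<epsilon>')" if "M \<in> A" for M
    proof -
      have "M * (1 - \<epsilon> - \<epsilon>') \<le> m" unfolding m_def
        using le[OF that] eps False by (intro cInf_greatest) (auto simp: pos_le_divide_eq)
      thus ?thesis using eps by (simp add: pos_le_divide_eq)
    qed
    hence "Sup (ereal ` A) \<le> ereal (m / (1 - \<epsilon> - \<epsilon>'))" by (auto intro!: Sup_least)
    hence "betaW N \<epsilon> P E \<le> elog (ereal (m / (1 - \<epsilon> - \<epsilon>')))" unfolding W by (rule elog_mono)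
    also have "\<dots> = ereal (ln m - ln (1 - \<epsilon> - \<epsilon>'))" using m1 eps by (simp add: elog_def ln_div)
    also have "\<dots> = betaC N \<epsilon>' P E + ereal (- ln (1 - \<epsilon> - \<epsilon>'))" unfolding C Im using m1 by (simp add: elog_def)
    finally show ?thesis .
  qed
qed

section \<open>Smoothing product states\<close>

lemma lsum_swap: "lsum S (\<lambda>w u. lsum T (\<lambda>w' u'. f w u w' u')) = lsum T (\<lambda>w' u'. lsum S (\<lambda>w u. f w u w' u'))"
proof (induction S)
  case Nil
  show ?case by (induction T) auto
qed (simp add: lsum_add)

text \<open>Young's inequality with a free parameter: a small \<kappa> keeps the leading factor near
  1 at the price of \<open>1 / \<kappa>\<close> on the error.\<close>

lemma cmod_square_split:
  assumes "0 < \<kappa>"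
  shows "(cmod a)\<^sup>2 \<le> (1 + \<kappa>) * (cmod b)\<^sup>2 + (1 + 1 / \<kappa>) * (cmod (a - b))\<^sup>2"
proof -
  define x y where "x = cmod b" and "y = cmod (a - b)"
  have "cmod a \<le> x + y" unfolding x_def y_def using norm_triangle_sub[of a b] by simp
  hence "(cmod a)\<^sup>2 \<le> (x + y)\<^sup>2" by (intro power_mono) auto
  moreover have "0 \<le> (\<kappa> * x - y)\<^sup>2 / \<kappa>" using assms by simp
  hence "2 * x * y \<le> \<kappa> * x\<^sup>2 + 1 / \<kappa> * y\<^sup>2" using assms by (simp add: field_simps power2_eq_square)
  ultimately show ?thesis unfolding x_def[symmetric] y_def[symmetric]
    by (simp add: power2_sum algebra_simps)
qed

lemma nsq_split:
  assumes "0 < \<kappa>"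
  shows "nsq N u \<le> (1 + \<kappa>) * nsq N v + (1 + 1 / \<kappa>) * nsq N (\<lambda>i. u i - v i)"
  unfolding nsq_def sum_distrib_left sum.distrib[symmetric]
  by (intro sum_mono cmod_square_split assms)

text \<open>An operator between 0 and 1 dominates its square. The proof rests on Parseval's
  identity, so lists of tensor powers qualify as soon as they are frames.\<close>

lemma nsq_opl_le:
  assumes f: "frame N S" and \<phi>: "\<And>w u. (w, u) \<in> set S \<Longrightarrow> 0 \<le> \<phi> w \<and> \<phi> w \<le> 1"
  shows "nsq N (mv N (opl N \<phi> S) x) \<le> qf N (opl N \<phi> S) x"
proof -
  define y where "y = mv N (opl N \<phi> S) x"
  have "complex_of_real (nsq N y) = sesq N (opl N \<phi> S) y x"
    unfolding sesq_def y_def[symmetric] by (rule ip_self[symmetric])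
  hence "nsq N y = Re (sesq N (opl N \<phi> S) y x)" by (metis Re_complex_of_real)
  also have "\<dots> = lsum S (\<lambda>w u. \<phi> w * Re (ip N y u * ip N u x))" by (simp add: sesq_opl Re_lsum)
  also have "\<dots> \<le> lsum S (\<lambda>w u. (1/2) * (cmod (ip N u y))\<^sup>2 + (1/2) * (\<phi> w * (cmod (ip N u x))\<^sup>2))"
  proof (rule lsum_mono)
    fix w u assume wu: "(w, u) \<in> set S"
    define a b where "a = cmod (ip N u y)" and "b = cmod (ip N u x)"
    have "Re (ip N y u * ip N u x) \<le> cmod (ip N y u * ip N u x)" by (rule complex_Re_le_cmod)
    also have "\<dots> = a * b" by (simp add: norm_mult a_def b_def cmod_ip_commute[of N y])
    also have "\<dots> \<le> (1/2) * a\<^sup>2 + (1/2) * b\<^sup>2"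
      using zero_le_power2[of "a - b"] by (simp add: power2_diff)
    finally have "\<phi> w * Re (ip N y u * ip N u x) \<le> \<phi> w * ((1/2) * a\<^sup>2 + (1/2) * b\<^sup>2)"
      using \<phi>[OF wu] by (intro mult_left_mono) auto
    also have "\<dots> \<le> (1/2) * a\<^sup>2 + (1/2) * (\<phi> w * b\<^sup>2)"
      using \<phi>[OF wu] mult_right_mono[of "\<phi> w" 1 "a\<^sup>2"] by (simp add: algebra_simps)
    finally show "\<phi> w * Re (ip N y u * ip N u x) \<le> (1/2) * (cmod (ip N u y))\<^sup>2 + (1/2) * (\<phi> w * (cmod (ip N u x))\<^sup>2)"
      by (simp add: a_def b_def)
  qed
  also have "\<dots> = (1/2) * nsq N y + (1/2) * qf N (opl N \<phi> S) x"
    unfolding lsum_add lsum_cmult frame_parseval[OF f] qf_opl ..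
  finally show ?thesis by (simp add: y_def)
qed

lemma opl_complement:
  assumes f: "frame N S" and i: "i < N"
  shows "mv N (opl N (\<lambda>w. 1 - \<phi> w) S) x i = x i - mv N (opl N \<phi> S) x i"
proof -
  have e: "mv N (opl N \<psi> S) x i = lsum S (\<lambda>w u. of_real (\<psi> w) * (u i * ip N u x))" for \<psi>
  proof -
    have "mv N (opl N \<psi> S) x i = (\<Sum>j<N. lsum S (\<lambda>w u. (of_real (\<psi> w) * (u i * cnj (u j))) * x j))"
      using i by (simp add: mv_def opl_def lsum_multc)
    thus ?thesis by (simp add: lsum_sum ip_def sum_distrib_left mult.assoc)
  qed
  have "mv N (opl N (\<lambda>_. 1) S) x i = x i"
    using f i by (simp add: frame_def mv_def if_distrib[of "\<lambda>x. x * _"] cong: if_cong)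
  moreover have "lsum S (\<lambda>w u. of_real (1 - \<phi> w) * (u i * ip N u x))
      = lsum S (\<lambda>w u. of_real 1 * (u i * ip N u x)) - lsum S (\<lambda>w u. of_real (\<phi> w) * (u i * ip N u x))"
    unfolding lsum_diff[symmetric] by (intro lsum_cong) (simp add: left_diff_distrib)
  ultimately show ?thesis unfolding e by simp
qed

lemma bessel_inequality:
  assumes "onb N e" "J \<subseteq> {..<N}"
  shows "(\<Sum>k\<in>J. (cmod (ip N u (e k)))\<^sup>2) \<le> nsq N u"
proof -
  have "(\<Sum>k\<in>J. (cmod (ip N u (e k)))\<^sup>2) \<le> (\<Sum>k<N. (cmod (ip N u (e k)))\<^sup>2)"
    using assms(2) by (intro sum_mono2) auto
  also have "\<dots> = nsq N u" unfolding parseval[OF assms(1)] by (simp add: cmod_ip_commute[of N u])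
  finally show ?thesis .
qed

text \<open>The smoothed state is \<open>\<Pi> \<rho>\<^sub>\<le>\<^sub>\<mu> \<Pi>\<close>, with \<open>\<rho>\<^sub>\<le>\<^sub>\<mu>\<close> the part of \<open>\<rho>\<close> of eigenvalues at most \<open>\<mu>\<close>
  and \<open>\<Pi>\<close> the projector onto eigenvalues of \<open>\<sigma>\<close> at least \<open>s\<close>; so it is at most \<open>\<mu> \<Pi> \<le> (\<mu>/s) \<sigma>\<close>.
  The lost mass is refilled with \<open>\<sigma>\<close>.\<close>
lemma smoothing_bound:
  assumes \<rho>: "\<rho> \<in> dens N" and \<sigma>: "\<sigma> \<in> dens N"
    and S: "frame N S" "\<And>w u. (w, u) \<in> set S \<Longrightarrow> 0 \<le> w" "opl N (\<lambda>w. w) S = \<rho>"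
    and T: "frame N T" "\<And>w u. (w, u) \<in> set T \<Longrightarrow> 0 \<le> w" "opl N (\<lambda>w. w) T = \<sigma>"
    and \<mu>: "0 < \<mu>" and s: "0 < s" and \<kappa>: "0 < \<kappa>"
    and h1: "lsum T (\<lambda>q g. (if q < s then 1 else 0) * qf N \<rho> g) \<le> h1"
    and h2: "lsum S (\<lambda>w f. (if \<mu> < w then w else 0) * nsq N f) \<le> h2"
  shows "\<exists>\<omega>\<in>dens N. tdist \<omega> \<rho> \<le> 2 * \<kappa> + 2 * (1 + 1 / \<kappa>) * h1 + h2 \<and>
    (\<forall>u. qf N \<omega> u \<le> (\<mu> / s + 1) * qf N \<sigma> u)"
proof -
  define \<phi> where "\<phi> = (\<lambda>q::real. if s \<le> q then 1 else (0::real))"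
  have \<phi>01: "0 \<le> \<phi> q \<and> \<phi> q \<le> 1" for q by (simp add: \<phi>_def)
  define Q where "Q = opl N \<phi> T"
  have hQ: "herm N Q" unfolding Q_def by (rule herm_opl)
  define g where "g = (\<lambda>f. mv N Q f)"
  have gq: "nsq N (g f) \<le> qf N Q f" for f
    unfolding g_def Q_def by (rule nsq_opl_le[OF T(1)]) (use \<phi>01 in auto)
  have Qle: "qf N Q f \<le> nsq N f" for f
    unfolding Q_def qf_opl frame_parseval[OF T(1), of f, symmetric]
    using \<phi>01 by (intro lsum_mono) (simp add: mult_left_le_one_le)
  have gle: "nsq N (g f) \<le> nsq N f" for f using gq[of f] Qle[of f] by simp
  have gc: "nsq N (\<lambda>i. f i - g f i) \<le> lsum T (\<lambda>q v. (if q < s then 1 else 0) * (cmod (ip N v f))\<^sup>2)" for f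
  proof -
    have "nsq N (\<lambda>i. f i - g f i) = nsq N (mv N (opl N (\<lambda>w. 1 - \<phi> w) T) f)"
      unfolding g_def Q_def by (rule nsq_cong) (simp add: opl_complement[OF T(1)])
    also have "\<dots> \<le> qf N (opl N (\<lambda>w. 1 - \<phi> w) T) f"
      by (rule nsq_opl_le[OF T(1)]) (use \<phi>01 in auto)
    also have "\<dots> = lsum T (\<lambda>q v. (if q < s then 1 else 0) * (cmod (ip N v f))\<^sup>2)"
      unfolding qf_opl by (intro lsum_cong) (auto simp: \<phi>_def)
    finally show ?thesis .
  qed
  define c where "c = (\<lambda>w. if w \<le> \<mu> then w else (0::real))"
  have c: "0 \<le> c w \<and> c w \<le> w \<and> c w \<le> \<mu>" if "(w, u) \<in> set S" for w u
    using S(2)[OF that] \<mu> by (simp add: c_def)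
  define S' where "S' = map (\<lambda>p. (fst p, g (snd p))) S"
  have lS': "lsum S' h = lsum S (\<lambda>w f. h w (g f))" for h :: "real \<Rightarrow> (nat \<Rightarrow> complex) \<Rightarrow> real"
    by (simp add: S'_def lsum_def comp_def)
  define \<omega>0 where "\<omega>0 = opl N c S'"
  have w0: "\<omega>0 \<in> carrier_mat N N" by (simp add: \<omega>0_def)
  have psd0: "psd \<omega>0" unfolding \<omega>0_def
  proof (rule psd_opl)
    fix w u assume "(w, u) \<in> set S'"
    then obtain f where "(w, f) \<in> set S" by (auto simp: S'_def)
    thus "0 \<le> c w" using c by blast
  qed
  have q0: "qf N \<omega>0 v = lsum S (\<lambda>w f. c w * (cmod (ip N (g f) v))\<^sup>2)" for v
    by (simp add: \<omega>0_def qf_opl lS')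
  have one: "lsum S (\<lambda>w f. w * nsq N f) = 1"
  proof -
    have "complex_of_real (lsum S (\<lambda>w f. w * nsq N f)) = 1"
      using mtrace_opl[of N "\<lambda>w. w" S] S(3) dens_trace[OF \<rho>] by simp
    thus ?thesis by (simp only: of_real_eq_1_iff)
  qed
  define t0 where "t0 = lsum S (\<lambda>w f. c w * nsq N (g f))"
  have tr0: "mtrace \<omega>0 = of_real t0" by (simp add: \<omega>0_def mtrace_opl lS' t0_def)
  have t0le: "t0 \<le> 1"
    unfolding t0_def one[symmetric] using c gle by (intro lsum_mono mult_mono) (auto intro: nsq_nonneg S(2))
  have t0ge: "0 \<le> t0" unfolding t0_def using c nsq_nonneg by (intro lsum_nonneg mult_nonneg_nonneg) auto
  \<comment> \<open>Moving \<open>Q\<close> onto \<open>v\<close> allows the truncated labels to be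
    bounded by \<mu> and the frame \<open>S\<close> to be summed out; then \<open>Q\<close> is
    bounded by \<sigma> divided by \<open>s\<close>.\<close>
  have below: "qf N \<omega>0 v \<le> \<mu> / s * qf N \<sigma> v" for v
  proof -
    have "qf N \<omega>0 v = lsum S (\<lambda>w f. c w * (cmod (ip N f (g v)))\<^sup>2)"
      unfolding q0 g_def herm_mv[OF hQ] ..
    also have "\<dots> \<le> lsum S (\<lambda>w f. \<mu> * (cmod (ip N f (g v)))\<^sup>2)"
      using c by (intro lsum_mono mult_right_mono) auto
    also have "\<dots> = \<mu> * nsq N (g v)" by (simp add: lsum_cmult frame_parseval[OF S(1)])
    also have "\<dots> \<le> \<mu> * qf N Q v" using gq \<mu> by (intro mult_left_mono) auto
    also have "\<dots> \<le> \<mu> * (1 / s * qf N \<sigma> v)"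
    proof (rule mult_left_mono)
      have "qf N Q v \<le> lsum T (\<lambda>q x. 1 / s * (q * (cmod (ip N x v))\<^sup>2))"
        unfolding Q_def qf_opl
      proof (rule lsum_mono)
        fix q x assume "(q, x) \<in> set T"
        hence "\<phi> q \<le> 1 / s * q" using T(2) s by (simp add: \<phi>_def)
        thus "\<phi> q * (cmod (ip N x v))\<^sup>2 \<le> 1 / s * (q * (cmod (ip N x v))\<^sup>2)"
          by (metis mult.assoc mult_right_mono zero_le_power2)
      qed
      also have "\<dots> = 1 / s * qf N \<sigma> v" unfolding T(3)[symmetric] qf_opl lsum_cmult ..
      finally show "qf N Q v \<le> 1 / s * qf N \<sigma> v" .
    qed (use \<mu> in simp)
    finally show ?thesis by simp
  qed
  \<comment> \<open>The disturbance of \<rho> by the cut. Exchanging the two lists turns it into the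
    weight of \<rho> on labels of \<sigma> below \<open>s\<close>, which \<open>h1\<close>
    bounds.\<close>
  define H where "H = lsum S (\<lambda>w f. w * nsq N (\<lambda>i. f i - g f i))"
  have Hh: "H \<le> h1"
  proof -
    have "H \<le> lsum S (\<lambda>w f. w * lsum T (\<lambda>q v. (if q < s then 1 else 0) * (cmod (ip N v f))\<^sup>2))"
      unfolding H_def using gc S(2) by (intro lsum_mono mult_left_mono) auto
    also have "\<dots> = lsum S (\<lambda>w f. lsum T (\<lambda>q v. w * ((if q < s then 1 else 0) * (cmod (ip N v f))\<^sup>2)))"
      by (simp only: lsum_cmult)
    also have "\<dots> = lsum T (\<lambda>q v. lsum S (\<lambda>w f. w * ((if q < s then 1 else 0) * (cmod (ip N v f))\<^sup>2)))"
      by (rule lsum_swap)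
    also have "\<dots> = lsum T (\<lambda>q v. (if q < s then 1 else 0) * qf N \<rho> v)"
      unfolding S(3)[symmetric] qf_opl lsum_cmult[symmetric]
      by (intro lsum_cong) (simp add: cmod_ip_commute)
    finally show ?thesis using h1 by simp
  qed
  \<comment> \<open>The Young errors summed over \<rho>. They enter once through the lost mass and
    once through the distance, hence the factors 2 in the conclusion.\<close>
  define K where "K = \<kappa> + (1 + 1 / \<kappa>) * H"
  have K: "lsum S (\<lambda>w f. c w * (\<kappa> * nsq N f + (1 + 1 / \<kappa>) * nsq N (\<lambda>i. f i - g f i))) \<le> K"
  proof -
    have "lsum S (\<lambda>w f. c w * (\<kappa> * nsq N f + (1 + 1 / \<kappa>) * nsq N (\<lambda>i. f i - g f i)))
      \<le> lsum S (\<lambda>w f. w * (\<kappa> * nsq N f + (1 + 1 / \<kappa>) * nsq N (\<lambda>i. f i - g f i)))"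
      using c \<kappa> nsq_nonneg by (intro lsum_mono mult_right_mono add_nonneg_nonneg mult_nonneg_nonneg) auto
    also have "\<dots> = lsum S (\<lambda>w f. \<kappa> * (w * nsq N f) + (1 + 1 / \<kappa>) * (w * nsq N (\<lambda>i. f i - g f i)))"
      by (intro lsum_cong) (simp add: algebra_simps)
    also have "\<dots> = K" unfolding lsum_add lsum_cmult one by (simp add: K_def H_def)
    finally show ?thesis .
  qed
  have loss: "1 - t0 \<le> h2 + K"
  proof -
    have "1 - t0 = lsum S (\<lambda>w f. w * nsq N f - c w * nsq N (g f))" by (simp add: lsum_diff one t0_def)
    also have "\<dots> \<le> lsum S (\<lambda>w f. (if \<mu> < w then w else 0) * nsq N f
        + c w * (\<kappa> * nsq N f + (1 + 1 / \<kappa>) * nsq N (\<lambda>i. f i - g f i)))"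
    proof (rule lsum_mono)
      fix w f assume wf: "(w, f) \<in> set S"
      have "nsq N f \<le> (1 + \<kappa>) * nsq N (g f) + (1 + 1 / \<kappa>) * nsq N (\<lambda>i. f i - g f i)"
        by (rule nsq_split[OF \<kappa>])
      moreover have "\<kappa> * nsq N (g f) \<le> \<kappa> * nsq N f" using gle \<kappa> by (intro mult_left_mono) auto
      ultimately have "nsq N f - nsq N (g f) \<le> \<kappa> * nsq N f + (1 + 1 / \<kappa>) * nsq N (\<lambda>i. f i - g f i)"
        by (simp add: distrib_right)
      hence "c w * (nsq N f - nsq N (g f)) \<le> c w * (\<kappa> * nsq N f + (1 + 1 / \<kappa>) * nsq N (\<lambda>i. f i - g f i))"
        using c[OF wf] by (intro mult_left_mono) auto
      moreover have "w * nsq N f = (if \<mu> < w then w else 0) * nsq N f + c w * nsq N f"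
        by (simp add: c_def)
      ultimately show "w * nsq N f - c w * nsq N (g f) \<le> (if \<mu> < w then w else 0) * nsq N f
        + c w * (\<kappa> * nsq N f + (1 + 1 / \<kappa>) * nsq N (\<lambda>i. f i - g f i))"
        by (simp add: right_diff_distrib)
    qed
    also have "\<dots> \<le> h2 + K" unfolding lsum_add using h2 K by simp
    finally show ?thesis .
  qed
  note sN = dens_carrier[OF \<sigma>]
  define \<omega> where "\<omega> = \<omega>0 + complex_of_real (1 - t0) \<cdot>\<^sub>m \<sigma>"
  have sc: "complex_of_real (1 - t0) \<cdot>\<^sub>m \<sigma> \<in> carrier_mat N N" using sN by simp
  have "psd \<omega>" unfolding \<omega>_def
    using psd0 psd_smult[OF sN dens_psd[OF \<sigma>], of "1 - t0"] t0le by (intro psd_add[OF w0 sc]) auto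
  moreover have "mtrace \<omega> = 1"
    unfolding \<omega>_def mtrace_add[OF w0 sc] mtrace_smult[OF sN] tr0 dens_trace[OF \<sigma>] by simp
  ultimately have w: "\<omega> \<in> dens N" using w0 sc by (simp add: dens_def \<omega>_def)
  have qw: "qf N \<omega> v = qf N \<omega>0 v + (1 - t0) * qf N \<sigma> v" for v
    unfolding \<omega>_def qf_add[OF w0 sc] qf_smult[OF sN] ..
  have "qf N \<omega> v \<le> (\<mu> / s + 1) * qf N \<sigma> v" for v
  proof -
    have "(1 - t0) * qf N \<sigma> v \<le> 1 * qf N \<sigma> v" using t0ge dens_qf[OF \<sigma>] by (intro mult_right_mono) auto
    thus ?thesis using below[of v] unfolding qw by (simp add: distrib_right)
  qed
  \<comment> \<open>Only the excess of \<omega> over \<rho> counts. Truncating labels lowers the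
    form and adds nothing to it; the refill adds at most its trace \<open>1 - t0\<close>.\<close>
  moreover have "tdist \<omega> \<rho> \<le> K + (1 - t0)"
  proof (rule tdist_leI[OF w \<rho>])
    fix e J assume e: "onb N e" and J: "J \<subseteq> {..<N}"
    have fJ: "finite J" using J finite_subset by blast
    have "(\<Sum>k\<in>J. qf N \<sigma> (e k)) \<le> (\<Sum>k<N. qf N \<sigma> (e k))"
      using J dens_qf[OF \<sigma>] by (intro sum_mono2) auto
    also have "\<dots> = 1"
      using frame_trace[OF frame_spec_list[OF e] sN] dens_trace[OF \<sigma>] by (simp add: lsum_spec_list)
    finally have sig: "(1 - t0) * (\<Sum>k\<in>J. qf N \<sigma> (e k)) \<le> (1 - t0) * 1" using t0le by (intro mult_left_mono) auto
    have "qf N \<omega>0 v - qf N \<rho> v \<le> lsum S (\<lambda>w f. c w * (\<kappa> * (cmod (ip N f v))\<^sup>2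
        + (1 + 1 / \<kappa>) * (cmod (ip N (\<lambda>i. f i - g f i) v))\<^sup>2))" for v
    proof -
      have "qf N \<omega>0 v - qf N \<rho> v = lsum S (\<lambda>w f. c w * (cmod (ip N (g f) v))\<^sup>2 - w * (cmod (ip N f v))\<^sup>2)"
        unfolding q0 S(3)[symmetric] qf_opl lsum_diff ..
      also have "\<dots> \<le> lsum S (\<lambda>w f. c w * (\<kappa> * (cmod (ip N f v))\<^sup>2
          + (1 + 1 / \<kappa>) * (cmod (ip N (\<lambda>i. f i - g f i) v))\<^sup>2))"
      proof (rule lsum_mono)
        fix w f assume wf: "(w, f) \<in> set S"
        have "cmod (ip N (g f) v - ip N f v) = cmod (ip N (\<lambda>i. f i - g f i) v)"
          unfolding ip_diff_left by (rule norm_minus_commute)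
        hence "(cmod (ip N (g f) v))\<^sup>2 - (cmod (ip N f v))\<^sup>2
            \<le> \<kappa> * (cmod (ip N f v))\<^sup>2 + (1 + 1 / \<kappa>) * (cmod (ip N (\<lambda>i. f i - g f i) v))\<^sup>2"
          using cmod_square_split[OF \<kappa>, of "ip N (g f) v" "ip N f v"] by (simp add: distrib_right)
        hence "c w * ((cmod (ip N (g f) v))\<^sup>2 - (cmod (ip N f v))\<^sup>2)
            \<le> c w * (\<kappa> * (cmod (ip N f v))\<^sup>2 + (1 + 1 / \<kappa>) * (cmod (ip N (\<lambda>i. f i - g f i) v))\<^sup>2)"
          using c[OF wf] by (intro mult_left_mono) auto
        moreover have "c w * (cmod (ip N f v))\<^sup>2 \<le> w * (cmod (ip N f v))\<^sup>2"
          using c[OF wf] by (intro mult_right_mono) auto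
        ultimately show "c w * (cmod (ip N (g f) v))\<^sup>2 - w * (cmod (ip N f v))\<^sup>2
            \<le> c w * (\<kappa> * (cmod (ip N f v))\<^sup>2 + (1 + 1 / \<kappa>) * (cmod (ip N (\<lambda>i. f i - g f i) v))\<^sup>2)"
          by (simp add: right_diff_distrib)
      qed
      finally show ?thesis .
    qed
    hence "(\<Sum>k\<in>J. qf N \<omega>0 (e k) - qf N \<rho> (e k)) \<le> (\<Sum>k\<in>J. lsum S (\<lambda>w f. c w * (\<kappa> * (cmod (ip N f (e k)))\<^sup>2
        + (1 + 1 / \<kappa>) * (cmod (ip N (\<lambda>i. f i - g f i) (e k)))\<^sup>2)))" by (intro sum_mono)
    also have "\<dots> = lsum S (\<lambda>w f. c w * (\<kappa> * (\<Sum>k\<in>J. (cmod (ip N f (e k)))\<^sup>2)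
        + (1 + 1 / \<kappa>) * (\<Sum>k\<in>J. (cmod (ip N (\<lambda>i. f i - g f i) (e k)))\<^sup>2)))"
      by (simp add: lsum_sum sum_distrib_left[symmetric] sum.distrib)
    also have "\<dots> \<le> lsum S (\<lambda>w f. c w * (\<kappa> * nsq N f + (1 + 1 / \<kappa>) * nsq N (\<lambda>i. f i - g f i)))"
      using c \<kappa> bessel_inequality[OF e J] by (intro lsum_mono mult_left_mono add_mono) auto
    also have "\<dots> \<le> K" by (rule K)
    finally have "(\<Sum>k\<in>J. qf N \<omega>0 (e k) - qf N \<rho> (e k)) \<le> K" .
    moreover have "(\<Sum>k\<in>J. qf N \<omega> (e k) - qf N \<rho> (e k))
        = (\<Sum>k\<in>J. qf N \<omega>0 (e k) - qf N \<rho> (e k)) + (1 - t0) * (\<Sum>k\<in>J. qf N \<sigma> (e k))"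
      unfolding qw sum_distrib_left sum.distrib[symmetric] by (intro sum.cong refl) simp
    ultimately show "(\<Sum>k\<in>J. qf N \<omega> (e k) - qf N \<rho> (e k)) \<le> K + (1 - t0)" using sig by simp
  qed
  moreover have "K + (1 - t0) \<le> 2 * \<kappa> + 2 * (1 + 1 / \<kappa>) * h1 + h2"
  proof -
    have "(1 + 1 / \<kappa>) * H \<le> (1 + 1 / \<kappa>) * h1" using Hh \<kappa> by (intro mult_left_mono) auto
    thus ?thesis using loss unfolding K_def by linarith
  qed
  ultimately show ?thesis using w by (intro bexI[of _ \<omega>]) auto
qed

section \<open>Klein's inequality and smoothing of tensor powers\<close>

text \<open>\<open>ln x \<le> x - 1\<close> averaged with the doubly stochastic matrix of squared
  overlaps of the two eigenbases. It serves to make the rate in \<open>betaC_upper\<close>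
  positive.\<close>

lemma klein_inequality:
  assumes \<rho>: "\<rho> \<in> dens N" and \<sigma>: "\<sigma> \<in> dens N" shows "0 \<le> rel_ent \<rho> \<sigma>"
proof (cases "supp_le \<rho> \<sigma>")
  case True
  obtain r f where sr: "spec N \<rho> r f" and r: "\<And>k. k < N \<Longrightarrow> 0 \<le> r k" "(\<Sum>k<N. r k) = 1" using dens_spec[OF \<rho>] by metis
  obtain q v where sq: "spec N \<sigma> q v" and q: "\<And>k. k < N \<Longrightarrow> 0 \<le> q k" "(\<Sum>k<N. q k) = 1" using dens_spec[OF \<sigma>] by metis
  define D where "D = (\<lambda>i j. (cmod (ip N (f j) (v i)))\<^sup>2)"
  have c: "qf N \<rho> (v i) = (\<Sum>j<N. r j * D i j)" for i unfolding D_def by (rule qf_spec[OF sr])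
  have D1: "(\<Sum>j<N. D i j) = 1" if "i < N" for i
    using parseval[OF spec_onb[OF sr], of "v i"] onb_nsq[OF spec_onb[OF sq] that] by (simp add: D_def)
  have D2: "(\<Sum>i<N. D i j) = 1" if "j < N" for j
    using parseval[OF spec_onb[OF sq], of "f j"] onb_nsq[OF spec_onb[OF sr] that]
    by (simp add: D_def cmod_ip_commute[of N "f j"])
  have "0 = (\<Sum>j<N. r j * (\<Sum>i<N. D i j)) - (\<Sum>i<N. q i * (\<Sum>j<N. D i j))"
    using D1 D2 r q by simp
  also have "\<dots> = (\<Sum>i<N. \<Sum>j<N. D i j * (r j - q i))"
    unfolding sum_distrib_left
    by (subst sum.swap) (simp add: sum_subtractf[symmetric] algebra_simps)
  also have "\<dots> \<le> (\<Sum>i<N. \<Sum>j<N. r j * D i j * (log0 (r j) - log0 (q i)))"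
  proof (intro sum_mono)
    fix i j assume "i \<in> {..<N}" "j \<in> {..<N}"
    hence ij: "i < N" "j < N" by auto
    have D0: "0 \<le> D i j" by (simp add: D_def)
    show "D i j * (r j - q i) \<le> r j * D i j * (log0 (r j) - log0 (q i))"
    proof (cases "r j * D i j = 0")
      case True
      thus ?thesis using D0 q(1)[OF ij(1)] by (auto simp: mult_nonneg_nonneg)
    next
      case False
      hence rp: "0 < r j" "0 < D i j" using r(1)[OF ij(2)] D0 by (auto simp: less_le)
      have "r j * D i j \<le> qf N \<rho> (v i)" unfolding c using ij r(1)
        by (intro member_le_sum) (auto simp: D_def)
      hence "qf N \<rho> (v i) \<noteq> 0" using False rp by (smt (verit) mult_pos_pos)
      hence "q i \<noteq> 0" using supp_le_iff[OF \<rho> sq] \<open>supp_le \<rho> \<sigma>\<close> ij by blast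
      hence qp: "0 < q i" using q(1)[OF ij(1)] by simp
      have "ln (q i / r j) \<le> q i / r j - 1" using rp qp by (intro ln_le_minus_one) simp
      hence "r j * ln (q i / r j) \<le> r j * (q i / r j - 1)" using rp by (intro mult_left_mono) auto
      hence "r j - q i \<le> r j * (ln (r j) - ln (q i))" using rp qp by (simp add: ln_div algebra_simps)
      hence "D i j * (r j - q i) \<le> D i j * (r j * (ln (r j) - ln (q i)))" using D0 by (rule mult_left_mono)
      thus ?thesis using rp qp by (simp add: log0_def mult_ac)
    qed
  qed
  also have "\<dots> = (\<Sum>j<N. r j * log0 (r j) * (\<Sum>i<N. D i j)) - (\<Sum>i<N. (\<Sum>j<N. r j * D i j) * log0 (q i))"
    unfolding sum_distrib_left sum_distrib_right
    by (subst (2) sum.swap) (simp add: sum_subtractf[symmetric] algebra_simps)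
  also have "\<dots> = (\<Sum>j<N. r j * log0 (r j)) - (\<Sum>i<N. qf N \<rho> (v i) * log0 (q i))"
    using D2 by (simp add: c)
  finally show ?thesis unfolding rel_ent_eq[OF \<rho> sr sq True] by simp
qed (simp add: rel_ent_def)

text \<open>As \<open>0 powr (- t)\<close> is 0 rather than infinite, label 0 of the list of
  \<sigma> escapes the Markov estimate; its vectors have to be seen to carry no weight of
  \<rho>.\<close>

lemma tpow_null:
  assumes A: "A \<in> carrier_mat n n" "herm n A" and B: "B \<in> carrier_mat m m" "herm m B"
    and S: "\<And>w u. (w, u) \<in> set S \<Longrightarrow> w = 0 \<Longrightarrow> qf n A u = 0"
    and T: "\<And>w u. (w, u) \<in> set T \<Longrightarrow> w = 0 \<Longrightarrow> qf m B u = 0"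
  shows "(w, u) \<in> set (tpow n m S T k) \<Longrightarrow> w = 0 \<Longrightarrow> qf (n ^ k * m) (kpow A B k) u = 0"
proof (induction k arbitrary: w u)
  case 0 thus ?case using T by simp
next
  case (Suc k)
  obtain a v b v' where ab: "(a, v) \<in> set S" "(b, v') \<in> set (tpow n m S T k)" "w = a * b" "u = tv (n ^ k * m) v v'"
    using set_tens[OF Suc.prems(1)[simplified]] by blast
  have "a = 0 \<or> b = 0" using ab Suc.prems by simp
  hence "qf n A v * qf (n ^ k * m) (kpow A B k) v' = 0" using S[OF ab(1)] Suc.IH[OF ab(2)] by auto
  thus ?case using qf_kron[OF A(1) kpow_carrier[OF A(1) B(1)] A(2) kpow_herm[OF A B], of k v v'] ab
    by (simp add: mult.assoc)
qed

lemma kpow_one: "kpow (1\<^sub>m n) (1\<^sub>m m) k = 1\<^sub>m (n ^ k * m)"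
  by (induction k) (auto simp: kron_one mult.assoc)

lemma qf_null_powr_moment:
  assumes "\<rho> \<in> dens n" and t: "spec n \<sigma> q v" and q: "\<And>k. k < n \<Longrightarrow> 0 \<le> q k"
    and su: "\<And>k. k < n \<Longrightarrow> q k = 0 \<Longrightarrow> qf n \<rho> (v k) = 0" and \<eta>: "0 < \<eta>"
  shows "\<exists>t>0. (\<Sum>i<n. q i powr (- t) * qf n \<rho> (v i)) \<le> exp (t * (\<eta> - (\<Sum>i<n. qf n \<rho> (v i) * log0 (q i))))"
proof -
  define I where "I = {i\<in>{..<n}. q i \<noteq> 0}"
  define c where "c = (\<lambda>i. qf n \<rho> (v i))"
  have out: "(\<Sum>i\<in>I. c i * h i) = (\<Sum>i<n. c i * h i)" for h
    by (rule sum.mono_neutral_left) (auto simp: I_def c_def su)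
  obtain t where t0: "0 < t" and m: "\<forall>c. (\<forall>i\<in>I. 0 \<le> c i) \<longrightarrow> (\<Sum>i\<in>I. c i) = 1 \<longrightarrow>
    (\<Sum>i\<in>I. c i * exp (t * - ln (q i))) \<le> exp (t * ((\<Sum>i\<in>I. c i * - ln (q i)) + \<eta>))"
    using exponential_moment[of I \<eta> "\<lambda>i. - ln (q i)"] \<eta> unfolding I_def by auto
  have "(\<Sum>i\<in>I. c i) = 1"
    using out[of "\<lambda>_. 1"] frame_trace[OF frame_spec_list[OF spec_onb[OF t]] dens_carrier[OF assms(1)]]
      dens_trace[OF assms(1)] by (simp add: c_def lsum_spec_list)
  hence "(\<Sum>i\<in>I. c i * exp (t * - ln (q i))) \<le> exp (t * ((\<Sum>i\<in>I. c i * - ln (q i)) + \<eta>))"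
    using m dens_qf[OF assms(1)] by (auto simp: c_def)
  moreover have "(\<Sum>i\<in>I. c i * exp (t * - ln (q i))) = (\<Sum>i<n. q i powr (- t) * c i)"
  proof -
    have "(\<Sum>i\<in>I. c i * exp (t * - ln (q i))) = (\<Sum>i\<in>I. c i * q i powr (- t))"
      by (intro sum.cong refl) (auto simp: I_def powr_def)
    thus ?thesis unfolding out by (simp add: mult.commute)
  qed
  moreover have "(\<Sum>i\<in>I. c i * - ln (q i)) = - (\<Sum>i<n. c i * log0 (q i))"
  proof -
    have "(\<Sum>i\<in>I. c i * - ln (q i)) = (\<Sum>i\<in>I. c i * - log0 (q i))"
      using q by (intro sum.cong refl) (force simp: I_def log0_def)
    thus ?thesis unfolding out by (simp add: sum_negf)
  qed
  ultimately show ?thesis using t0 unfolding c_def by (intro exI[of _ t]) (auto simp: algebra_simps)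
qed

text \<open>Chernoff bounds: the moments \<open>w powr a\<close> for \<rho> and
  \<open>w powr (- t)\<close> for \<sigma> factor over the copies, so both tails in
  \<open>smoothing_bound\<close> decay exponentially. The last factor contributes only the constants
  \<open>C1\<close> and \<open>C2\<close>.\<close>

lemma iid_smoothing:
  assumes \<rho>: "\<rho> \<in> dens n" and \<sigma>: "\<sigma> \<in> dens n" and c0: "rel_ent \<rho> \<sigma> < ereal c0"
    and \<rho>': "\<rho>' \<in> dens m" and \<sigma>': "\<sigma>' \<in> dens m" and su': "supp_le \<rho>' \<sigma>'"
    and dk: "\<And>k. kpow \<rho> \<rho>' k \<in> dens (n ^ k * m)" "\<And>k. kpow \<sigma> \<sigma>' k \<in> dens (n ^ k * m)"
    and \<delta>: "0 < \<delta>" and \<epsilon>: "0 < \<epsilon>"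
  shows "\<forall>\<^sub>F k in sequentially. \<exists>\<omega>\<in>dens (n ^ k * m). tdist \<omega> (kpow \<rho> \<rho>' k) \<le> \<epsilon> \<and>
    (\<forall>u. qf (n ^ k * m) \<omega> u \<le> (exp (real k * (c0 + \<delta>)) + 1) * qf (n ^ k * m) (kpow \<sigma> \<sigma>' k) u)"
proof -
  have su: "supp_le \<rho> \<sigma>" using c0 unfolding rel_ent_def by (auto split: if_splits)
  obtain r f where sr: "spec n \<rho> r f" and r: "\<And>k. k < n \<Longrightarrow> 0 \<le> r k" using dens_spec[OF \<rho>] by metis
  obtain q v where sq: "spec n \<sigma> q v" and q: "\<And>k. k < n \<Longrightarrow> 0 \<le> q k" using dens_spec[OF \<sigma>] by metis
  obtain r' f' where sr': "spec m \<rho>' r' f'" and r': "\<And>k. k < m \<Longrightarrow> 0 \<le> r' k" using dens_spec[OF \<rho>'] by metis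
  obtain q' v' where sq': "spec m \<sigma>' q' v'" and q': "\<And>k. k < m \<Longrightarrow> 0 \<le> q' k" using dens_spec[OF \<sigma>'] by metis
  have nul: "qf n \<rho> (v k) = 0" if "k < n" "q k = 0" for k using supp_le_iff[OF \<rho> sq] su that by blast
  have nul': "qf m \<rho>' (v' k) = 0" if "k < m" "q' k = 0" for k using supp_le_iff[OF \<rho>' sq'] su' that by blast
  define H1 where "H1 = (\<Sum>k<n. r k * log0 (r k))"
  define H2 where "H2 = (\<Sum>k<n. qf n \<rho> (v k) * log0 (q k))"
  have H: "H1 - H2 < c0" using c0 unfolding rel_ent_eq[OF \<rho> sr sq su] H1_def H2_def by simp
  \<comment> \<open>Each threshold lies \<open>2 * \<eta>\<close> per copy from its mean: one \<eta>
    is spent on the moment estimate, the other remains as decay. Together the thresholds cost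
    \<open>4 * \<eta> = \<delta>\<close>.\<close>
  define \<eta> where "\<eta> = \<delta> / 4"
  have \<eta>: "0 < \<eta>" using \<delta> by (simp add: \<eta>_def)
  define S where "S = spec_list n r f"
  define T where "T = spec_list n q v"
  define S' where "S' = spec_list m r' f'"
  define T' where "T' = spec_list m q' v'"
  have wS: "w \<in> {0..}" if "(w, u) \<in> set S" for w u using that r by (auto simp: S_def set_spec_list)
  have wT: "w \<in> {0..}" if "(w, u) \<in> set T" for w u using that q by (auto simp: T_def set_spec_list)
  have wS': "w \<in> {0..}" if "(w, u) \<in> set S'" for w u using that r' by (auto simp: S'_def set_spec_list)
  have wT': "w \<in> {0..}" if "(w, u) \<in> set T'" for w u using that q' by (auto simp: T'_def set_spec_list)
  have mulW: "a * b \<in> {0..} \<and> (a * b) powr x = a powr x * b powr x" if "a \<in> {0..}" "b \<in> {0..}" for a b x :: real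
    using that by (auto simp: powr_mult)
  have mulI: "a * b \<in> {0..} \<and> a * b = a * b" if "a \<in> {0..}" "b \<in> {0..}" for a b :: real
    using that by auto
  define D where "D = (\<lambda>k. n ^ k * m)"
  define X where "X = (\<lambda>k. tpow n m S S' k)"
  define Y where "Y = (\<lambda>k. tpow n m T T' k)"
  have X: "frame (D k) (X k)" "\<And>w u. (w, u) \<in> set (X k) \<Longrightarrow> 0 \<le> w" "opl (D k) (\<lambda>w. w) (X k) = kpow \<rho> \<rho>' k" for k
  proof -
    show "frame (D k) (X k)" unfolding D_def X_def S_def S'_def
      by (intro frame_tpow frame_spec_list spec_onb[OF sr] spec_onb[OF sr'])
    show "0 \<le> w" if "(w, u) \<in> set (X k)" for w u
      using tpow_weights[of S "{0..}" S' w u n m k, OF wS wS'] that unfolding X_def by auto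
    show "opl (D k) (\<lambda>w. w) (X k) = kpow \<rho> \<rho>' k" unfolding D_def X_def
      by (subst opl_tpow[where W = "{0..}", OF wS wS' mulI])
        (auto simp: S_def S'_def opl_spec[OF sr] opl_spec[OF sr'])
  qed
  have Y: "frame (D k) (Y k)" "\<And>w u. (w, u) \<in> set (Y k) \<Longrightarrow> 0 \<le> w" "opl (D k) (\<lambda>w. w) (Y k) = kpow \<sigma> \<sigma>' k" for k
  proof -
    show "frame (D k) (Y k)" unfolding D_def Y_def T_def T'_def
      by (intro frame_tpow frame_spec_list spec_onb[OF sq] spec_onb[OF sq'])
    show "0 \<le> w" if "(w, u) \<in> set (Y k)" for w u
      using tpow_weights[of T "{0..}" T' w u n m k, OF wT wT'] that unfolding Y_def by auto
    show "opl (D k) (\<lambda>w. w) (Y k) = kpow \<sigma> \<sigma>' k" unfolding D_def Y_def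
      by (subst opl_tpow[where W = "{0..}", OF wT wT' mulI])
        (auto simp: T_def T'_def opl_spec[OF sq] opl_spec[OF sq'])
  qed
  note \<rho>c = dens_carrier[OF \<rho>] dens_herm[OF \<rho>] dens_carrier[OF \<rho>'] dens_herm[OF \<rho>']
  have one: "(1\<^sub>m N :: complex mat) \<in> carrier_mat N N" "herm N (1\<^sub>m N)" for N by (auto simp: herm_def)
  \<comment> \<open>The nonzero eigenvalues serve as probabilities and, through their logarithms, as
    the random variable of \<open>exponential_moment\<close>.\<close>
  obtain a where a: "0 < a" and ma: "(\<Sum>j<n. r j powr (1 + a)) \<le> exp (a * (H1 + \<eta>))"
  proof -
    define I where "I = {j\<in>{..<n}. r j \<noteq> 0}"
    have out: "(\<Sum>i\<in>I. r i * h i) = (\<Sum>i<n. r i * h i)" for h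
      by (rule sum.mono_neutral_left) (auto simp: I_def)
    obtain a where a: "0 < a" and m: "\<forall>c. (\<forall>i\<in>I. 0 \<le> c i) \<longrightarrow> (\<Sum>i\<in>I. c i) = 1 \<longrightarrow>
      (\<Sum>i\<in>I. c i * exp (a * ln (r i))) \<le> exp (a * ((\<Sum>i\<in>I. c i * ln (r i)) + \<eta>))"
      using exponential_moment[of I \<eta> "\<lambda>i. ln (r i)"] \<eta> unfolding I_def by auto
    have "(\<Sum>i<n. r i) = 1" using spec_trace[OF sr] dens_trace[OF \<rho>] by (metis of_real_eq_1_iff)
    hence "(\<Sum>i\<in>I. r i * exp (a * ln (r i))) \<le> exp (a * ((\<Sum>i\<in>I. r i * ln (r i)) + \<eta>))"
      using m r out[of "\<lambda>_. 1"] by (auto simp: I_def)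
    moreover have "(\<Sum>i\<in>I. r i * ln (r i)) = H1"
      unfolding out H1_def using r by (intro sum.cong refl) (force simp: log0_def)
    moreover have "(\<Sum>i\<in>I. r i * exp (a * ln (r i))) = (\<Sum>j<n. r j powr (1 + a))"
      unfolding out
    proof (intro sum.cong refl)
      fix j assume "j \<in> {..<n}"
      hence "r j = 0 \<or> 0 < r j" using r[of j] by auto
      thus "r j * exp (a * ln (r j)) = r j powr (1 + a)" by (auto simp: powr_def distrib_right exp_add)
    qed
    ultimately show ?thesis using that[of a] a by simp
  qed
  obtain t where t: "0 < t" and mt: "(\<Sum>i<n. q i powr (- t) * qf n \<rho> (v i)) \<le> exp (t * (\<eta> - H2))"
    using qf_null_powr_moment[OF \<rho> sq q nul \<eta>] unfolding H2_def by blast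
  define C1 where "C1 = lsum S' (\<lambda>w u. w powr (1 + a) * qf m (1\<^sub>m m) u)"
  define C2 where "C2 = lsum T' (\<lambda>w u. w powr (- t) * qf m \<rho>' u)"
  have C0: "0 \<le> C1" "0 \<le> C2" unfolding C1_def C2_def qf_one
    using nsq_nonneg dens_qf[OF \<rho>'] by (auto intro!: lsum_nonneg)
  define \<mu> where "\<mu> = (\<lambda>k. exp (real k * (H1 + 2 * \<eta>)))"
  define s where "s = (\<lambda>k. exp (real k * (H2 - 2 * \<eta>)))"
  \<comment> \<open>Markov's inequality with \<open>1 \<le> (w / \<mu> k) powr a\<close> on the
    cut-off labels. The squared norm is written as the form of a power of identities so that
    \<open>lsum_kpow\<close> applies.\<close>
  have h2: "lsum (X k) (\<lambda>w u. (if \<mu> k < w then w else 0) * nsq (D k) u) \<le> C1 * exp (- (a * \<eta>)) ^ k" for k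
  proof -
    have \<mu>0: "0 < \<mu> k" by (simp add: \<mu>_def)
    have "lsum (X k) (\<lambda>w u. (if \<mu> k < w then w else 0) * nsq (D k) u)
        \<le> lsum (X k) (\<lambda>w u. \<mu> k powr (- a) * (w powr (1 + a) * qf (D k) (kpow (1\<^sub>m n) (1\<^sub>m m) k) u))"
    proof (rule lsum_mono)
      fix w u assume wu: "(w, u) \<in> set (X k)"
      have "(if \<mu> k < w then w else 0) \<le> \<mu> k powr (- a) * w powr (1 + a)"
      proof (cases "\<mu> k < w")
        case True
        hence w: "0 < w" using \<mu>0 by simp
        have "w * 1 \<le> w * (w powr a / \<mu> k powr a)"
          using True \<mu>0 w a by (intro mult_left_mono) (auto intro!: powr_mono2)
        also have "\<dots> = \<mu> k powr (- a) * w powr (1 + a)" using w by (simp add: powr_add powr_minus field_simps)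
        finally show ?thesis using True by simp
      qed simp
      hence "(if \<mu> k < w then w else 0) * nsq (D k) u \<le> (\<mu> k powr (- a) * w powr (1 + a)) * nsq (D k) u"
        using nsq_nonneg by (intro mult_right_mono)
      thus "(if \<mu> k < w then w else 0) * nsq (D k) u
          \<le> \<mu> k powr (- a) * (w powr (1 + a) * qf (D k) (kpow (1\<^sub>m n) (1\<^sub>m m) k) u)"
        by (simp add: kpow_one qf_one D_def mult.assoc)
    qed
    also have "\<dots> = \<mu> k powr (- a) * ((\<Sum>j<n. r j powr (1 + a)) ^ k * C1)"
    proof -
      have "lsum (X k) (\<lambda>w u. w powr (1 + a) * qf (D k) (kpow (1\<^sub>m n) (1\<^sub>m m) k) u)
          = (lsum S (\<lambda>w u. w powr (1 + a) * qf n (1\<^sub>m n) u)) ^ k * C1"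
        unfolding X_def D_def C1_def by (rule lsum_kpow[where W = "{0..}", OF one one wS wS' mulW])
      moreover have "lsum S (\<lambda>w u. w powr (1 + a) * qf n (1\<^sub>m n) u) = (\<Sum>j<n. r j powr (1 + a))"
        unfolding S_def lsum_spec_list qf_one using onb_nsq[OF spec_onb[OF sr]] by simp
      ultimately show ?thesis by (simp add: lsum_cmult)
    qed
    also have "\<dots> \<le> \<mu> k powr (- a) * (exp (a * (H1 + \<eta>)) ^ k * C1)"
      using ma C0 by (intro mult_left_mono mult_right_mono power_mono sum_nonneg) auto
    also have "\<dots> = C1 * exp (- (a * \<eta>)) ^ k"
    proof -
      have "\<mu> k powr (- a) * exp (a * (H1 + \<eta>)) ^ k = exp (- (a * \<eta>)) ^ k"
        unfolding \<mu>_def powr_def by (simp add: exp_of_nat_mult[symmetric] exp_add[symmetric] algebra_simps)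
      thus ?thesis by (metis mult.assoc mult.commute)
    qed
    finally show ?thesis .
  qed
  have h1: "lsum (Y k) (\<lambda>w u. (if w < s k then 1 else 0) * qf (D k) (kpow \<rho> \<rho>' k) u) \<le> C2 * exp (- (t * \<eta>)) ^ k" for k
  proof -
    have s0: "0 < s k" by (simp add: s_def)
    have "lsum (Y k) (\<lambda>w u. (if w < s k then 1 else 0) * qf (D k) (kpow \<rho> \<rho>' k) u)
        \<le> lsum (Y k) (\<lambda>w u. s k powr t * (w powr (- t) * qf (D k) (kpow \<rho> \<rho>' k) u))"
    proof (rule lsum_mono)
      fix w u assume wu: "(w, u) \<in> set (Y k)"
      have q0: "0 \<le> qf (D k) (kpow \<rho> \<rho>' k) u" using dens_qf[OF dk(1)] by (simp add: D_def)
      show "(if w < s k then 1 else 0) * qf (D k) (kpow \<rho> \<rho>' k) u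
          \<le> s k powr t * (w powr (- t) * qf (D k) (kpow \<rho> \<rho>' k) u)"
      proof (cases "w = 0")
        case True
        have "qf (D k) (kpow \<rho> \<rho>' k) u = 0" unfolding D_def
          by (rule tpow_null[OF \<rho>c(1,2,3,4) _ _ wu[unfolded Y_def] True])
            (auto simp: T_def T'_def set_spec_list nul nul')
        thus ?thesis by simp
      next
        case False
        hence w: "0 < w" using Y(2)[OF wu] by simp
        have "(if w < s k then 1 else 0) \<le> s k powr t * w powr (- t)"
          using w t s0 by (auto simp: powr_minus divide_simps intro!: powr_mono2)
        hence "(if w < s k then 1 else 0) * qf (D k) (kpow \<rho> \<rho>' k) u
            \<le> (s k powr t * w powr (- t)) * qf (D k) (kpow \<rho> \<rho>' k) u" using q0 by (rule mult_right_mono)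
        thus ?thesis by (simp add: mult.assoc)
      qed
    qed
    also have "\<dots> = s k powr t * ((\<Sum>i<n. q i powr (- t) * qf n \<rho> (v i)) ^ k * C2)"
    proof -
      have "lsum (Y k) (\<lambda>w u. w powr (- t) * qf (D k) (kpow \<rho> \<rho>' k) u)
          = (lsum T (\<lambda>w u. w powr (- t) * qf n \<rho> u)) ^ k * C2"
        unfolding Y_def D_def C2_def by (rule lsum_kpow[where W = "{0..}", OF \<rho>c(1,2,3,4) wT wT' mulW])
      moreover have "lsum T (\<lambda>w u. w powr (- t) * qf n \<rho> u) = (\<Sum>i<n. q i powr (- t) * qf n \<rho> (v i))"
        unfolding T_def lsum_spec_list ..
      ultimately show ?thesis by (simp add: lsum_cmult)
    qed
    also have "\<dots> \<le> s k powr t * (exp (t * (\<eta> - H2)) ^ k * C2)"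
      using mt C0 dens_qf[OF \<rho>] by (intro mult_left_mono mult_right_mono power_mono sum_nonneg) auto
    also have "\<dots> = C2 * exp (- (t * \<eta>)) ^ k"
    proof -
      have "s k powr t * exp (t * (\<eta> - H2)) ^ k = exp (- (t * \<eta>)) ^ k"
        unfolding s_def powr_def by (simp add: exp_of_nat_mult[symmetric] exp_add[symmetric] algebra_simps)
      thus ?thesis by (metis mult.assoc mult.commute)
    qed
    finally show ?thesis .
  qed
  \<comment> \<open>The error bound then tends to \<open>2 * \<kappa>\<close>, half of
    \<epsilon>.\<close>
  define \<kappa> where "\<kappa> = \<epsilon> / 4"
  have \<kappa>: "0 < \<kappa>" using \<epsilon> by (simp add: \<kappa>_def)
  define B where "B = (\<lambda>k. 2 * \<kappa> + 2 * (1 + 1 / \<kappa>) * (C2 * exp (- (t * \<eta>)) ^ k) + C1 * exp (- (a * \<eta>)) ^ k)"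
  have "B \<longlonglongrightarrow> 2 * \<kappa> + 2 * (1 + 1 / \<kappa>) * (C2 * 0) + C1 * 0"
    unfolding B_def using a t \<eta> by (intro tendsto_intros LIMSEQ_realpow_zero) auto
  hence "B \<longlonglongrightarrow> 2 * \<kappa>" by simp
  hence "\<forall>\<^sub>F k in sequentially. B k < \<epsilon>" by (rule order_tendstoD) (use \<epsilon> in \<open>simp add: \<kappa>_def\<close>)
  thus ?thesis
  proof eventually_elim
    case (elim k)
    have "\<exists>\<omega>\<in>dens (D k). tdist \<omega> (kpow \<rho> \<rho>' k) \<le> B k \<and>
        (\<forall>u. qf (D k) \<omega> u \<le> (\<mu> k / s k + 1) * qf (D k) (kpow \<sigma> \<sigma>' k) u)"
      unfolding B_def
      by (rule smoothing_bound[OF _ _ X Y _ _ \<kappa> h1 h2])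
        (use dk in \<open>auto simp: D_def \<mu>_def s_def\<close>)
    then obtain \<omega> where w: "\<omega> \<in> dens (D k)" "tdist \<omega> (kpow \<rho> \<rho>' k) \<le> B k"
      "\<And>u. qf (D k) \<omega> u \<le> (\<mu> k / s k + 1) * qf (D k) (kpow \<sigma> \<sigma>' k) u" by blast
    have "\<mu> k / s k = exp (real k * (H1 - H2 + \<delta>))"
      unfolding \<mu>_def s_def \<eta>_def by (simp add: exp_diff[symmetric] algebra_simps)
    also have "\<dots> \<le> exp (real k * (c0 + \<delta>))" using H by (simp add: mult_left_mono)
    finally have ms: "\<mu> k / s k + 1 \<le> exp (real k * (c0 + \<delta>)) + 1" by simp
    have "qf (D k) \<omega> u \<le> (exp (real k * (c0 + \<delta>)) + 1) * qf (D k) (kpow \<sigma> \<sigma>' k) u" for u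
    proof -
      have "0 \<le> qf (D k) (kpow \<sigma> \<sigma>' k) u" using dens_qf[OF dk(2)] by (simp add: D_def)
      from mult_right_mono[OF ms this] show ?thesis using w(3)[of u] by linarith
    qed
    thus ?case using w elim unfolding D_def by (intro bexI[of _ \<omega>]) auto
  qed
qed

section \<open>Rates\<close>

lemma good_family_basic:
  assumes "good_family d S" "1 \<le> n"
  shows "S n \<subseteq> dens (d ^ n)" "convex_mat (S n)" "compact_mat (d ^ n) (S n)"
  using assms unfolding good_family_def by auto

lemma good_family_kron:
  assumes "good_family d S" "1 \<le> m" "1 \<le> k" "a \<in> S m" "b \<in> S k"
  shows "kron a b \<in> S (m + k)"
proof -
  have "set_tensor (S m) (S k) \<subseteq> S (m + k)" using assms unfolding good_family_def by blast
  thus ?thesis using assms(4,5) unfolding set_tensor_def by blast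
qed

lemma good_family_polar:
  assumes "good_family d S" "1 \<le> m" "1 \<le> k" "a \<in> polar_plus (d ^ m) (S m)" "b \<in> polar_plus (d ^ k) (S k)"
  shows "kron a b \<in> polar_plus (d ^ (m + k)) (S (m + k))"
proof -
  have "set_tensor (polar_plus (d ^ m) (S m)) (polar_plus (d ^ k) (S k)) \<subseteq> polar_plus (d ^ (m + k)) (S (m + k))"
    using assms unfolding good_family_def by blast
  thus ?thesis using assms(4,5) unfolding set_tensor_def by blast
qed

lemma kpow_mem:
  assumes "good_family d S" "1 \<le> m" "1 \<le> r" "a \<in> S m" "b \<in> S r"
  shows "kpow a b k \<in> S (m * k + r)"
proof (induction k)
  case (Suc k)
  have eq: "m * Suc k + r = m + (m * k + r)" by simp
  show ?case unfolding kpow.simps eq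
    by (rule good_family_kron[OF assms(1,2) _ assms(4) Suc]) (use assms(3) in simp)
qed (simp add: assms)

lemma kpow_polar:
  assumes "good_family d S" "1 \<le> m" "1 \<le> r" "a \<in> polar_plus (d ^ m) (S m)" "b \<in> polar_plus (d ^ r) (S r)"
  shows "kpow a b k \<in> polar_plus (d ^ (m * k + r)) (S (m * k + r))"
proof (induction k)
  case (Suc k)
  have eq: "m * Suc k + r = m + (m * k + r)" by simp
  show ?case unfolding kpow.simps eq
    by (rule good_family_polar[OF assms(1,2) _ assms(4) Suc]) (use assms(3) in simp)
qed (simp add: assms)

lemma tdist_0_imp_eq:
  assumes w: "\<omega> \<in> dens N" and r: "\<rho> \<in> dens N" and t: "tdist \<omega> \<rho> \<le> 0"
  shows "\<omega> = \<rho>"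
proof -
  obtain lam e where s: "spec N (\<omega> - \<rho>) lam e" using dens_diff_spec[OF w r] .
  have "(\<Sum>k<N. \<bar>lam k\<bar>) \<le> 0" using t by (simp add: tdist_def trace_norm_spec[OF s])
  hence "(\<Sum>k<N. \<bar>lam k\<bar>) = 0" by (simp add: antisym sum_nonneg)
  hence z: "lam k = 0" if "k < N" for k using that by (subst (asm) sum_nonneg_eq_0_iff) auto
  have "(\<omega> - \<rho>) $$ (i, j) = 0" if "i < N" "j < N" for i j
    using s that z by (simp add: spec_def del: index_minus_mat)
  thus ?thesis using dens_carrier[OF w] dens_carrier[OF r] by (intro eq_matI) auto
qed

text \<open>Smoothing with radius 0 leaves the state unchanged, so a finite value exhibits a pair
  with nested supports. Such pairs fill the last block of a length, and they show that the sets are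
  nonempty.\<close>

lemma Dmax_finite_supp:
  assumes P: "P \<subseteq> dens N" and E: "E \<subseteq> dens N" and D: "Dmax N P E \<le> ereal c"
  shows "\<exists>\<rho>\<in>P. \<exists>\<tau>\<in>E. supp_le \<rho> \<tau>"
proof -
  let ?A = "{ereal M | M. M > 1 \<and> (\<exists>\<tau>\<in>E. \<exists>\<omega>\<in>eps_ball N 0 P. loewner_ge (complex_of_real M \<cdot>\<^sub>m \<tau>) \<omega>)}"
  have "?A \<noteq> {}"
  proof
    assume emp: "?A = {}"
    have "Dmax N P E = \<infinity>" unfolding Dmax_def Dmax_eps_def emp by (simp add: elog_def top_ereal_def)
    thus False using D by simp
  qed
  then obtain M \<tau> \<omega> where M: "\<tau> \<in> E" "\<omega> \<in> eps_ball N 0 P" "loewner_ge (complex_of_real M \<cdot>\<^sub>m \<tau>) \<omega>" by blast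
  then obtain \<rho> where \<rho>: "\<omega> \<in> dens N" "\<rho> \<in> P" "tdist \<omega> \<rho> \<le> 0" unfolding eps_ball_def by blast
  have r: "\<rho> \<in> dens N" and t: "\<tau> \<in> dens N" using \<rho>(2) M(1) P E by auto
  have eq: "\<omega> = \<rho>" by (rule tdist_0_imp_eq[OF \<rho>(1) r \<rho>(3)])
  obtain q v where sq: "spec N \<tau> q v" using dens_spec[OF t] by metis
  have "qf N \<rho> (v k) = 0" if k: "k < N" "q k = 0" for k
  proof -
    have "psd (complex_of_real M \<cdot>\<^sub>m \<tau> - \<rho>)" using M(3) eq by (simp add: loewner_ge_def)
    hence "0 \<le> qf N (complex_of_real M \<cdot>\<^sub>m \<tau> - \<rho>) (v k)"
      using dens_carrier[OF r] by (intro psd_qf) (auto intro: minus_carrier_mat)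
    also have "\<dots> = M * qf N \<tau> (v k) - qf N \<rho> (v k)"
      using dens_carrier[OF r] dens_carrier[OF t] by (simp add: qf_diff[of _ N] qf_smult)
    also have "qf N \<tau> (v k) = 0" using qf_spec_vec[OF sq k(1)] k by simp
    finally show ?thesis using dens_qf[OF r, of "v k"] by simp
  qed
  hence "supp_le \<rho> \<tau>" using supp_le_iff[OF r sq] by blast
  thus ?thesis using \<rho>(2) M(1) by blast
qed

text \<open>The remainder runs from 1 to \<open>m\<close> and not from 0, since the families are
  constrained only at positive lengths; hence \<open>n - 1\<close>.\<close>

lemma block_split:
  fixes n m :: nat
  assumes "1 \<le> m" "1 \<le> n"
  obtains k r where "n = m * k + r" "1 \<le> r" "r \<le> m" "k = (n - 1) div m"
proof -
  have "n = m * ((n - 1) div m) + ((n - 1) mod m + 1)" using assms mult_div_mod_eq[of m "n - 1"] by simp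
  moreover have "(n - 1) mod m + 1 \<le> m" using assms by (simp add: Suc_le_eq)
  ultimately show ?thesis by (intro that[of "(n - 1) div m" "(n - 1) mod m + 1"]) auto
qed

lemma block_dim: "((d::nat) ^ m) ^ k * d ^ r = d ^ (m * k + r)"
  by (simp add: power_add power_mult)

section \<open>Upper bound on the formation cost\<close>

lemma betaC_upper:
  assumes gP: "good_family d P" and gE: "good_family d E"
    and D: "\<And>n. 1 \<le> n \<Longrightarrow> Dmax (d ^ n) (P n) (E n) \<le> ereal (c * real n)"
    and m: "1 \<le> m" and c0: "rel_ent_set (P m) (E m) < ereal c0" and \<eta>: "0 < \<eta>" and \<epsilon>: "0 < \<epsilon>"
  shows "\<forall>\<^sub>F n in sequentially. betaC (d ^ n) \<epsilon> (P n) (E n) \<le> ereal (real n * (c0 / real m + \<eta>))"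
proof -
  note bP = good_family_basic[OF gP] and bE = good_family_basic[OF gE]
  obtain \<rho> \<sigma> where rs: "\<rho> \<in> P m" "\<sigma> \<in> E m" "rel_ent \<rho> \<sigma> < ereal c0"
    using c0 unfolding rel_ent_set_def INF_less_iff by blast
  have dr: "\<rho> \<in> dens (d ^ m)" and ds: "\<sigma> \<in> dens (d ^ m)" using rs bP(1)[OF m] bE(1)[OF m] by auto
  \<comment> \<open>Positivity permits absorbing the \<open>+ 1\<close> of the smoothing bound into
    a factor 2 and replacing \<open>k\<close> by \<open>n / m\<close>.\<close>
  have c00: "0 < c0" using klein_inequality[OF dr ds] rs(3) by (metis ereal_less(2) le_less_trans)
  have "\<exists>\<rho>'\<in>P r. \<exists>\<sigma>'\<in>E r. supp_le \<rho>' \<sigma>'" if "1 \<le> r" for r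
    using Dmax_finite_supp[OF bP(1)[OF that] bE(1)[OF that] D[OF that]] .
  then obtain \<rho>' \<sigma>' where rs': "\<And>r. 1 \<le> r \<Longrightarrow> \<rho>' r \<in> P r \<and> \<sigma>' r \<in> E r \<and> supp_le (\<rho>' r) (\<sigma>' r)" by metis
  \<comment> \<open>Half of the allowance \<open>\<eta> * m\<close> per block; the other half
    absorbs \<open>ln 2\<close>.\<close>
  define \<delta> where "\<delta> = \<eta> * real m / 2"
  have \<delta>: "0 < \<delta>" using \<eta> m by (simp add: \<delta>_def)
  define Q where "Q = (\<lambda>r k. \<exists>\<omega>\<in>dens ((d ^ m) ^ k * d ^ r). tdist \<omega> (kpow \<rho> (\<rho>' r) k) \<le> \<epsilon> \<and>
    (\<forall>u. qf ((d ^ m) ^ k * d ^ r) \<omega> u \<le> (exp (real k * (c0 + \<delta>)) + 1) * qf ((d ^ m) ^ k * d ^ r) (kpow \<sigma> (\<sigma>' r) k) u))"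
  have "\<forall>\<^sub>F k in sequentially. Q r k" if r: "r \<in> {1..m}" for r
    unfolding Q_def
  proof (rule iid_smoothing[OF dr ds rs(3) _ _ _ _ _ \<delta> \<epsilon>])
    have r1: "1 \<le> r" using r by simp
    show "\<rho>' r \<in> dens (d ^ r)" "\<sigma>' r \<in> dens (d ^ r)" "supp_le (\<rho>' r) (\<sigma>' r)"
      using rs'[OF r1] bP(1)[OF r1] bE(1)[OF r1] by auto
    show "kpow \<rho> (\<rho>' r) k \<in> dens ((d ^ m) ^ k * d ^ r)" for k
      using kpow_mem[OF gP m r1 rs(1), of "\<rho>' r" k] rs'[OF r1] bP(1)[of "m * k + r"] r1 by (auto simp: block_dim)
    show "kpow \<sigma> (\<sigma>' r) k \<in> dens ((d ^ m) ^ k * d ^ r)" for k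
      using kpow_mem[OF gE m r1 rs(2), of "\<sigma>' r" k] rs'[OF r1] bE(1)[of "m * k + r"] r1 by (auto simp: block_dim)
  qed
  \<comment> \<open>Only finitely many remainders occur, so one threshold for \<open>k\<close>
    serves all of them.\<close>
  hence "\<forall>\<^sub>F k in sequentially. \<forall>r\<in>{1..m}. Q r k" by (intro eventually_ball_finite) auto
  then obtain K where K: "\<forall>k\<ge>K. \<forall>r\<in>{1..m}. Q r k" unfolding eventually_sequentially by blast
  obtain L :: nat where L: "2 * ln 2 / \<eta> \<le> real L" using real_arch_simple by blast
  show ?thesis
  proof (rule eventually_sequentiallyI[of "max (m * K + 1) L"])
    fix n assume n: "max (m * K + 1) L \<le> n"
    hence n1: "1 \<le> n" by simp
    obtain k r where kr: "n = m * k + r" "1 \<le> r" "r \<le> m" "k = (n - 1) div m" using block_split[OF m n1] .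
    have "m * K + 1 \<le> n" using n by simp
    hence "m * K div m \<le> (n - 1) div m" by (intro div_le_mono) linarith
    hence "K \<le> k" unfolding kr(4) using m by simp
    hence "Q r k" using K kr(2,3) by simp
    then obtain \<omega> where w: "\<omega> \<in> dens (d ^ n)" "tdist \<omega> (kpow \<rho> (\<rho>' r) k) \<le> \<epsilon>"
      "\<And>u. qf (d ^ n) \<omega> u \<le> (exp (real k * (c0 + \<delta>)) + 1) * qf (d ^ n) (kpow \<sigma> (\<sigma>' r) k) u"
      unfolding Q_def block_dim kr(1)[symmetric] by blast
    have PM: "kpow \<rho> (\<rho>' r) k \<in> P n" unfolding kr(1) using rs'[OF kr(2)] by (intro kpow_mem[OF gP m kr(2) rs(1)]) auto
    have EM: "kpow \<sigma> (\<sigma>' r) k \<in> E n" unfolding kr(1) using rs'[OF kr(2)] by (intro kpow_mem[OF gE m kr(2) rs(2)]) auto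
    have "betaC (d ^ n) \<epsilon> (P n) (E n) \<le> ereal (ln (exp (real k * (c0 + \<delta>)) + 1))"
      by (rule betaC_leI[OF EM _ w(1) PM w(2) _ w(3)]) (use EM bE(1)[OF n1] in auto)
    also have "ln (exp (real k * (c0 + \<delta>)) + 1) \<le> real n * (c0 / real m + \<eta>)"
    proof -
      have "exp (real k * (c0 + \<delta>)) + 1 \<le> 2 * exp (real k * (c0 + \<delta>))" using c00 \<delta> by simp
      hence "ln (exp (real k * (c0 + \<delta>)) + 1) \<le> ln (2 * exp (real k * (c0 + \<delta>)))"
        by (subst ln_le_cancel_iff) (auto simp: add_pos_pos)
      also have "\<dots> = ln 2 + real k * (c0 + \<delta>)" by (simp add: ln_mult)
      also have "real k * (c0 + \<delta>) \<le> real n / real m * (c0 + \<delta>)"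
      proof (rule mult_right_mono)
        have "real k * real m \<le> real n" using kr(1) by (simp add: mult.commute flip: of_nat_mult)
        thus "real k \<le> real n / real m" using m by (simp add: pos_le_divide_eq)
      qed (use c00 \<delta> in simp)
      also have "real n / real m * (c0 + \<delta>) = real n * (c0 / real m) + real n * \<eta> / 2"
        using m by (simp add: \<delta>_def field_simps)
      also have "ln 2 \<le> real n * \<eta> / 2"
      proof -
        have "2 * ln 2 / \<eta> \<le> real n" using L n by linarith
        thus ?thesis using \<eta> by (simp add: pos_divide_le_eq)
      qed
      finally show ?thesis by (simp add: algebra_simps)
    qed
    finally show "betaC (d ^ n) \<epsilon> (P n) (E n) \<le> ereal (real n * (c0 / real m + \<eta>))" by simp
  qed
qed

section \<open>Lower bound on the extractable work\<close>

lemma frame_std: "frame N (spec_list N (\<lambda>_. 1) std)"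
  by (rule frame_spec_list[OF onb_std])

text \<open>Accepting always with probability \<open>1 - \<epsilon>\<close> is an admissible test.
  The case matters because an empty supremum would make \<open>elog\<close> return
  \<open>-\<infinity>\<close>.\<close>

lemma betaW_nonneg:
  assumes P: "P \<subseteq> dens N" and E: "E \<subseteq> dens N" and \<epsilon>: "0 < \<epsilon>" "\<epsilon> < 1"
  shows "0 \<le> betaW N \<epsilon> P E"
proof -
  have tr: "lsum (spec_list N (\<lambda>_. 1) std) (\<lambda>w u. qf N \<rho> u) = 1" if "\<rho> \<in> dens N" for \<rho>
    using frame_trace[OF frame_std dens_carrier[OF that]] dens_trace[OF that] by simp
  have "ereal (ln (1 / (1 - \<epsilon>))) \<le> betaW N \<epsilon> P E"
    by (rule betaW_geI[OF frame_std, where \<phi> = "\<lambda>_. 1 - \<epsilon>"])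
      (use P E \<epsilon> tr in \<open>auto simp: lsum_cmult\<close>)
  moreover have "0 \<le> ln (1 / (1 - \<epsilon>))" using \<epsilon> by (intro ln_ge_zero) simp
  ultimately show ?thesis by (metis ereal_less_eq(5) order_trans)
qed

lemma opl_smult: "opl N (\<lambda>w. c * \<phi> w) S = complex_of_real c \<cdot>\<^sub>m opl N \<phi> S"
  by (rule eq_matI) (auto simp: opl_def lsum_cmult[symmetric] mult.assoc)

lemma kpow_smult:
  assumes "A \<in> carrier_mat n n" "B \<in> carrier_mat m m"
  shows "kpow (complex_of_real c \<cdot>\<^sub>m A) B k = complex_of_real (c ^ k) \<cdot>\<^sub>m kpow A B k"
proof (induction k)
  case 0
  show ?case using assms by (intro eq_matI) auto
next
  case (Suc k)
  thus ?case using kron_smult[OF assms(1) kpow_carrier[OF assms], of "of_real c" "of_real (c ^ k)"] by simp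
qed

lemma opl_std: "opl N \<phi> (spec_list N (\<lambda>_. 1) std) = complex_of_real (\<phi> 1) \<cdot>\<^sub>m 1\<^sub>m N"
proof -
  have "opl N (\<lambda>_. 1) (spec_list N (\<lambda>_. 1) std) = 1\<^sub>m N" using frame_std by (simp add: frame_def)
  moreover have "opl N \<phi> (spec_list N (\<lambda>_. 1) std) = opl N (\<lambda>_. \<phi> 1 * 1) (spec_list N (\<lambda>_. 1) std)"
    by (simp add: opl_spec_list)
  ultimately show ?thesis by (simp only: opl_smult)
qed

text \<open>Passes from moment bounds of a measurement to members of the polar set, the form in
  which the bounds tensorise.\<close>

lemma polar_plus_opl:
  assumes S: "S \<subseteq> dens N" and "\<And>w u. (w, u) \<in> set L \<Longrightarrow> 0 \<le> \<phi> w"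
    and "\<And>\<rho>. \<rho> \<in> S \<Longrightarrow> lsum L (\<lambda>w u. \<phi> w * qf N \<rho> u) \<le> 1"
  shows "opl N \<phi> L \<in> polar_plus N S"
  using assms psd_opl[of L \<phi> N] trace_opl_mult dens_carrier by (auto simp: polar_plus_def subset_iff)

text \<open>Markov's inequality for the moments \<open>w\<close> and \<open>w\<^sup>-\<^sup>s\<close> of the product measurement, which the
  multiplicativity of the polar sets bounds on all of \<open>E\<^sub>n\<close> and \<open>P\<^sub>n\<close>, gives both error probabilities.\<close>
lemma betaW_block:
  assumes gP: "good_family d P" and gE: "good_family d E" and m: "1 \<le> m" and r: "1 \<le> r" and \<epsilon>: "0 < \<epsilon>" "\<epsilon> < 1"
    and S: "frame (d ^ m) S" "\<And>w u. (w, u) \<in> set S \<Longrightarrow> 0 < w"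
    and e: "\<And>\<sigma>. \<sigma> \<in> E m \<Longrightarrow> lsum S (\<lambda>w u. w * qf (d ^ m) \<sigma> u) \<le> 1"
    and s: "0 < s" and p: "\<And>\<rho>. \<rho> \<in> P m \<Longrightarrow> lsum S (\<lambda>w u. w powr (- s) * qf (d ^ m) \<rho> u) \<le> exp (- s * b)"
  shows "ereal (real k * b + ln \<epsilon> / s - ln 2) \<le> betaW (d ^ (m * k + r)) \<epsilon> (P (m * k + r)) (E (m * k + r))"
proof -
  define n where "n = m * k + r"
  have n1: "1 \<le> n" using r by (simp add: n_def)
  note bP = good_family_basic[OF gP] and bE = good_family_basic[OF gE]
  \<comment> \<open>On the remainder, a measurement with constant label 1 leaves the products of
    labels unchanged; its operator is the identity, which lies in the polar set of any set of
    states.\<close>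
  define T where "T = spec_list (d ^ r) (\<lambda>_. 1) std"
  have one: "1\<^sub>m (d ^ r) \<in> polar_plus (d ^ r) F" if F: "F \<subseteq> dens (d ^ r)" for F
  proof -
    have "opl (d ^ r) (\<lambda>_. 1) T \<in> polar_plus (d ^ r) F"
    proof (rule polar_plus_opl[OF F])
      show "lsum T (\<lambda>w u. 1 * qf (d ^ r) \<rho> u) \<le> 1" if "\<rho> \<in> F" for \<rho>
        using frame_trace[OF frame_std, of \<rho>] dens_carrier dens_trace F that unfolding T_def by fastforce
    qed simp
    thus ?thesis using frame_std unfolding T_def frame_def by simp
  qed
  define X where "X = tpow (d ^ m) (d ^ r) S T k"
  have wT: "w \<in> {0<..}" if "(w, u) \<in> set T" for w u using that by (auto simp: T_def set_spec_list)
  have wS: "w \<in> {0<..}" if "(w, u) \<in> set S" for w u using S(2)[OF that] by simp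
  have fX: "frame (d ^ n) X"
    unfolding X_def n_def block_dim[symmetric] T_def by (intro frame_tpow S frame_std)
  have wX: "0 < w" if "(w, u) \<in> set X" for w u
    using tpow_weights[of S "{0<..}" T w u "d ^ m" "d ^ r" k, OF wS wT] that unfolding X_def by auto
  have opX: "opl (d ^ n) \<phi> X = kpow (opl (d ^ m) \<phi> S) (1\<^sub>m (d ^ r)) k"
    if "\<And>a b. 0 < a \<Longrightarrow> 0 < b \<Longrightarrow> \<phi> (a * b) = \<phi> a * \<phi> b" "\<phi> 1 = 1" for \<phi>
  proof -
    have "opl (d ^ n) \<phi> X = kpow (opl (d ^ m) \<phi> S) (opl (d ^ r) \<phi> T) k"
      unfolding X_def n_def block_dim[symmetric] by (rule opl_tpow[where W = "{0<..}", OF wS wT]) (use that in auto)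
    moreover have "opl (d ^ r) \<phi> T = 1\<^sub>m (d ^ r)" unfolding T_def opl_std that(2) by (intro eq_matI) auto
    ultimately show ?thesis by simp
  qed
  have Pn: "P n \<subseteq> dens (d ^ n)" and En: "E n \<subseteq> dens (d ^ n)" using bP(1)[OF n1] bE(1)[OF n1] .
  have eX: "lsum X (\<lambda>w u. w * qf (d ^ n) \<sigma> u) \<le> 1" if "\<sigma> \<in> E n" for \<sigma>
  proof -
    have "opl (d ^ m) (\<lambda>w. w) S \<in> polar_plus (d ^ m) (E m)"
      by (rule polar_plus_opl[OF bE(1)[OF m]]) (use S(2) e in \<open>auto intro: less_imp_le\<close>)
    hence "kpow (opl (d ^ m) (\<lambda>w. w) S) (1\<^sub>m (d ^ r)) k \<in> polar_plus (d ^ n) (E n)"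
      unfolding n_def by (rule kpow_polar[OF gE m r _ one[OF bE(1)[OF r]]])
    hence "Re (mtrace (opl (d ^ n) (\<lambda>w. w) X * \<sigma>)) \<le> 1" using that by (subst opX) (auto simp: polar_plus_def)
    moreover have "\<sigma> \<in> carrier_mat (d ^ n) (d ^ n)" using dens_carrier En that by blast
    ultimately show ?thesis by (simp only: trace_opl_mult)
  qed
  have pX: "lsum X (\<lambda>w u. w powr (- s) * qf (d ^ n) \<rho> u) \<le> exp (- s * b) ^ k" if "\<rho> \<in> P n" for \<rho>
  proof -
    \<comment> \<open>Dividing the moment operator by its bound puts it into the polar set; the
      factor reappears as a \<open>k\<close>-th power.\<close>
    define a where "a = exp (- s * b)"
    have a: "0 < a" by (simp add: a_def)
    have "opl (d ^ m) (\<lambda>w. (1 / a) * w powr (- s)) S \<in> polar_plus (d ^ m) (P m)"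
    proof (rule polar_plus_opl[OF bP(1)[OF m]])
      show "0 \<le> 1 / a * w powr - s" for w using a by simp
      show "lsum S (\<lambda>w u. 1 / a * w powr - s * qf (d ^ m) \<rho> u) \<le> 1" if "\<rho> \<in> P m" for \<rho>
        using p[OF that] a unfolding mult.assoc lsum_cmult by (simp add: a_def divide_le_eq)
    qed
    hence "kpow (complex_of_real (1 / a) \<cdot>\<^sub>m opl (d ^ m) (\<lambda>w. w powr (- s)) S) (1\<^sub>m (d ^ r)) k \<in> polar_plus (d ^ n) (P n)"
      unfolding n_def opl_smult by (rule kpow_polar[OF gP m r _ one[OF bP(1)[OF r]]])
    hence "complex_of_real ((1 / a) ^ k) \<cdot>\<^sub>m kpow (opl (d ^ m) (\<lambda>w. w powr (- s)) S) (1\<^sub>m (d ^ r)) k \<in> polar_plus (d ^ n) (P n)"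
      by (subst (asm) kpow_smult[OF opl_carrier one_carrier_mat])
    hence "opl (d ^ n) (\<lambda>w. (1 / a) ^ k * w powr (- s)) X \<in> polar_plus (d ^ n) (P n)"
      unfolding opl_smult by (subst opX) (auto simp: powr_mult)
    hence "Re (mtrace (opl (d ^ n) (\<lambda>w. (1 / a) ^ k * w powr (- s)) X * \<rho>)) \<le> 1" using that by (auto simp: polar_plus_def)
    moreover have "\<rho> \<in> carrier_mat (d ^ n) (d ^ n)" using dens_carrier Pn that by blast
    ultimately have "(1 / a) ^ k * lsum X (\<lambda>w u. w powr (- s) * qf (d ^ n) \<rho> u) \<le> 1"
      by (simp only: trace_opl_mult mult.assoc lsum_cmult)
    thus ?thesis using a unfolding a_def[symmetric] by (simp add: power_divide divide_le_eq)
  qed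
  \<comment> \<open>Chosen so that the Markov bound on the first error is exactly
    \<epsilon>.\<close>
  define \<theta> where "\<theta> = exp (real k * b + ln \<epsilon> / s)"
  have \<theta>0: "0 < \<theta>" by (simp add: \<theta>_def)
  have \<theta>s: "\<theta> powr s * exp (- s * b) ^ k = \<epsilon>"
  proof -
    have "\<theta> powr s = exp (s * (real k * b + ln \<epsilon> / s))" unfolding \<theta>_def by (simp add: powr_def)
    hence "\<theta> powr s * exp (- s * b) ^ k = exp (s * (real k * b + ln \<epsilon> / s) + real k * (- s * b))"
      unfolding exp_add exp_of_nat_mult by simp
    also have "s * (real k * b + ln \<epsilon> / s) + real k * (- s * b) = ln \<epsilon>" using s by (simp add: field_simps)
    finally show ?thesis using \<epsilon> by simp
  qed
  have "ereal (ln (\<theta> / 2)) \<le> betaW (d ^ n) \<epsilon> (P n) (E n)"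
  proof (cases "2 < \<theta>")
    case True
    \<comment> \<open>Below the threshold the test accepts with probability
      \<open>1 / \<theta>\<close>, not 0, to keep acceptance on \<open>E n\<close> strictly
      positive. This adds at most \<open>1 / \<theta>\<close>, hence the value
      \<open>\<theta> / 2\<close>.\<close>
    define \<phi> where "\<phi> = (\<lambda>w. if \<theta> \<le> w then 1 else 1 / \<theta>)"
    show ?thesis
    proof (rule betaW_geI[OF fX _ Pn En, where \<phi> = \<phi>])
      show "0 \<le> \<phi> w \<and> \<phi> w \<le> 1" for w using True by (simp add: \<phi>_def)
      show "1 < \<theta> / 2" using True by simp
    next
      fix \<rho> assume rn: "\<rho> \<in> P n"
      have "lsum X (\<lambda>w u. (1 - \<phi> w) * qf (d ^ n) \<rho> u) \<le> lsum X (\<lambda>w u. \<theta> powr s * (w powr (- s) * qf (d ^ n) \<rho> u))"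
      proof (rule lsum_mono)
        fix w u assume wu: "(w, u) \<in> set X"
        have "1 - \<phi> w \<le> \<theta> powr s * w powr (- s)"
        proof (cases "\<theta> \<le> w")
          case False
          have "1 - \<phi> w \<le> 1" using \<theta>0 by (simp add: \<phi>_def)
          also have "1 \<le> \<theta> powr s / w powr s" using False wX[OF wu] s by (simp add: powr_mono2)
          finally show ?thesis by (simp add: powr_minus divide_inverse)
        qed (simp add: \<phi>_def)
        hence "(1 - \<phi> w) * qf (d ^ n) \<rho> u \<le> (\<theta> powr s * w powr (- s)) * qf (d ^ n) \<rho> u"
          using dens_qf Pn rn by (intro mult_right_mono) auto
        thus "(1 - \<phi> w) * qf (d ^ n) \<rho> u \<le> \<theta> powr s * (w powr (- s) * qf (d ^ n) \<rho> u)" by (simp add: mult.assoc)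
      qed
      also have "\<dots> \<le> \<theta> powr s * exp (- s * b) ^ k"
        unfolding lsum_cmult using pX[OF rn] by (intro mult_left_mono) auto
      finally show "lsum X (\<lambda>w u. (1 - \<phi> w) * qf (d ^ n) \<rho> u) \<le> \<epsilon>" unfolding \<theta>s .
    next
      fix \<sigma> assume sn: "\<sigma> \<in> E n"
      hence sd: "\<sigma> \<in> dens (d ^ n)" using En by auto
      have tr: "lsum X (\<lambda>w u. qf (d ^ n) \<sigma> u) = 1"
        using frame_trace[OF fX dens_carrier[OF sd]] dens_trace[OF sd] by simp
      have "1 / \<theta> = lsum X (\<lambda>w u. 1 / \<theta> * qf (d ^ n) \<sigma> u)" unfolding lsum_cmult tr by simp
      also have "\<dots> \<le> lsum X (\<lambda>w u. \<phi> w * qf (d ^ n) \<sigma> u)"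
        using dens_qf[OF sd] True by (intro lsum_mono mult_right_mono) (auto simp: \<phi>_def)
      finally have "0 < lsum X (\<lambda>w u. \<phi> w * qf (d ^ n) \<sigma> u)" using \<theta>0 by (smt (verit) divide_pos_pos)
      moreover have "lsum X (\<lambda>w u. \<phi> w * qf (d ^ n) \<sigma> u)
          \<le> lsum X (\<lambda>w u. 1 / \<theta> * (w * qf (d ^ n) \<sigma> u) + 1 / \<theta> * qf (d ^ n) \<sigma> u)"
      proof (rule lsum_mono)
        fix w u assume wu: "(w, u) \<in> set X"
        have "\<phi> w \<le> 1 / \<theta> * w + 1 / \<theta>" using wX[OF wu] \<theta>0 by (auto simp: \<phi>_def field_simps)
        hence "\<phi> w * qf (d ^ n) \<sigma> u \<le> (1 / \<theta> * w + 1 / \<theta>) * qf (d ^ n) \<sigma> u"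
          using dens_qf[OF sd] by (intro mult_right_mono)
        thus "\<phi> w * qf (d ^ n) \<sigma> u \<le> 1 / \<theta> * (w * qf (d ^ n) \<sigma> u) + 1 / \<theta> * qf (d ^ n) \<sigma> u"
          by (simp only: distrib_right mult.assoc)
      qed
      moreover have "\<dots> \<le> 1 / \<theta> * 1 + 1 / \<theta> * 1"
        unfolding lsum_add lsum_cmult tr using eX[OF sn] \<theta>0 by (intro add_mono mult_left_mono) auto
      ultimately show "0 < lsum X (\<lambda>w u. \<phi> w * qf (d ^ n) \<sigma> u) \<and> lsum X (\<lambda>w u. \<phi> w * qf (d ^ n) \<sigma> u) \<le> 1 / (\<theta> / 2)"
        by simp
    qed
  next
    case False
    hence "ln (\<theta> / 2) \<le> 0" using \<theta>0 by simp
    thus ?thesis using betaW_nonneg[OF Pn En \<epsilon>] by (metis ereal_less_eq(4) order_trans)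
  qed
  thus ?thesis unfolding \<theta>_def n_def by (simp add: ln_div)
qed

text \<open>The uniform measurement has mean log label at least \<open>b\<close> on all of
  \<open>P m\<close>. \<open>exponential_moment\<close> converts this into a bound on
  \<open>w powr (- s)\<close> with one \<open>s\<close> for all states, as the polar condition
  requires.\<close>

lemma betaW_lower:
  fixes d m :: nat and c0 \<Delta> :: real
  defines "b \<equiv> (1 - ln 2 / \<Delta>) * c0 - ln 2 / \<Delta> * (real m * ln (real d)) - \<Delta> - ln 2 - 1"
  assumes gP: "good_family d P" and gE: "good_family d E" and ne: "P m \<noteq> {}" "E m \<noteq> {}"
    and m: "1 \<le> m" and c0: "ereal c0 < rel_ent_set (P m) (E m)" and \<Delta>: "ln 2 < \<Delta>"
    and \<eta>: "0 < \<eta>" and \<epsilon>: "0 < \<epsilon>" "\<epsilon> < 1"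
  shows "\<forall>\<^sub>F n in sequentially. ereal (real n * (b / real m - \<eta>)) \<le> betaW (d ^ n) \<epsilon> (P n) (E n)"
proof -
  note bP = good_family_basic[OF gP m] and bE = good_family_basic[OF gE m]
  have "\<exists>S. frame (d ^ m) S \<and> (\<forall>w u. (w, u) \<in> set S \<longrightarrow> 0 < w) \<and> b < payoff (d ^ m) S \<rho> \<sigma>"
    if rs: "\<rho> \<in> P m" "\<sigma> \<in> E m" for \<rho> \<sigma>
  proof -
    have "rel_ent_set (P m) (E m) \<le> rel_ent \<rho> \<sigma>" unfolding rel_ent_set_def
      by (rule INF_lower2[OF rs(1) INF_lower[OF rs(2)]])
    hence "ereal c0 < rel_ent \<rho> \<sigma>" using c0 by (rule less_le_trans[rotated])
    moreover have "ln (real (d ^ m)) = real m * ln (real d)" by (simp add: ln_realpow)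
    ultimately show ?thesis
      using measured_payoff[of \<rho> "d ^ m" \<sigma> c0 \<Delta>] rs bP(1) bE(1) \<Delta> unfolding payoff_def b_def by auto
  qed
  from uniform_measurement[OF bP ne(1) bE ne(2) this]
  obtain S where S1: "frame (d ^ m) S" and S2: "\<forall>w u. (w, u) \<in> set S \<longrightarrow> 0 < w"
    and e': "\<forall>\<sigma>\<in>E m. lsum S (\<lambda>w u. w * qf (d ^ m) \<sigma> u) \<le> 1"
    and p': "\<forall>\<rho>\<in>P m. b \<le> lsum S (\<lambda>w u. ln w * qf (d ^ m) \<rho> u)" by blast
  note S = S1 S2[rule_format] and e = e'[rule_format] and p = p'[rule_format]
  \<comment> \<open>Half of the allowance \<open>\<eta> * m\<close> per block goes into the moment;
    the other half absorbs the remainder and the constants collected in \<open>C\<close>.\<close>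
  define \<eta>' where "\<eta>' = \<eta> * real m / 2"
  have \<eta>': "0 < \<eta>'" using \<eta> m by (simp add: \<eta>'_def)
  obtain s where s: "0 < s" and mom: "\<forall>c. (\<forall>i\<in>{..<length S}. 0 \<le> c i) \<longrightarrow> (\<Sum>i<length S. c i) = 1 \<longrightarrow>
    (\<Sum>i<length S. c i * exp (s * - ln (fst (S ! i)))) \<le> exp (s * ((\<Sum>i<length S. c i * - ln (fst (S ! i))) + \<eta>'))"
    using exponential_moment[of "{..<length S}" \<eta>' "\<lambda>i. - ln (fst (S ! i))"] \<eta>' by auto
  have ps: "lsum S (\<lambda>w u. w powr (- s) * qf (d ^ m) \<rho> u) \<le> exp (- s * (b - \<eta>'))" if r: "\<rho> \<in> P m" for \<rho>
  proof -
    have rd: "\<rho> \<in> dens (d ^ m)" using r bP(1) by auto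
    define c where "c = (\<lambda>i. qf (d ^ m) \<rho> (snd (S ! i)))"
    have c1: "(\<Sum>i<length S. c i) = 1"
      using frame_trace[OF S(1) dens_carrier[OF rd]] dens_trace[OF rd] by (simp add: lsum_nth c_def)
    have "lsum S (\<lambda>w u. w powr (- s) * qf (d ^ m) \<rho> u) = (\<Sum>i<length S. c i * exp (s * - ln (fst (S ! i))))"
      unfolding lsum_nth
    proof (intro sum.cong refl)
      fix i assume "i \<in> {..<length S}"
      hence "S ! i \<in> set S" by simp
      hence "0 < fst (S ! i)" using S(2)[of "fst (S ! i)" "snd (S ! i)"] by simp
      thus "fst (S ! i) powr - s * qf (d ^ m) \<rho> (snd (S ! i)) = c i * exp (s * - ln (fst (S ! i)))"
        by (simp add: powr_def c_def)
    qed
    also have "\<dots> \<le> exp (s * ((\<Sum>i<length S. c i * - ln (fst (S ! i))) + \<eta>'))"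
      using mom c1 dens_qf[OF rd] by (simp add: c_def)
    also have "(\<Sum>i<length S. c i * - ln (fst (S ! i))) = - lsum S (\<lambda>w u. ln w * qf (d ^ m) \<rho> u)"
      by (simp add: lsum_nth c_def sum_negf mult.commute)
    also have "exp (s * (- lsum S (\<lambda>w u. ln w * qf (d ^ m) \<rho> u) + \<eta>')) \<le> exp (s * (- b + \<eta>'))"
      using p[OF r] s by (simp add: mult_left_mono)
    also have "s * (- b + \<eta>') = - s * (b - \<eta>')" by (simp add: algebra_simps)
    finally show ?thesis .
  qed
  define C where "C = \<bar>b - \<eta>'\<bar> - ln \<epsilon> / s + ln 2"
  obtain L :: nat where L: "2 * C / \<eta> \<le> real L" using real_arch_simple by blast
  show ?thesis
  proof (rule eventually_sequentiallyI[of "max 1 L"])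
    fix n assume n: "max 1 L \<le> n"
    hence n1: "1 \<le> n" by simp
    obtain k r where kr: "n = m * k + r" "1 \<le> r" "r \<le> m" using block_split[OF m n1] by metis
    have "real n * (b / real m - \<eta>) \<le> real k * (b - \<eta>') + ln \<epsilon> / s - ln 2"
    proof -
      have "real n = real m * real k + real r" using kr(1) by simp
      hence "real n / real m = real k + real r / real m" using m by (simp add: field_simps)
      hence f1: "real n / real m * (b - \<eta>') = real k * (b - \<eta>') + real r / real m * (b - \<eta>')"
        by (simp only: distrib_right)
      have f2: "real r / real m * (b - \<eta>') \<le> \<bar>b - \<eta>'\<bar>"
      proof -
        have "real r / real m * (b - \<eta>') \<le> real r / real m * \<bar>b - \<eta>'\<bar>" by (intro mult_left_mono) auto
        also have "\<dots> \<le> 1 * \<bar>b - \<eta>'\<bar>" using kr m by (intro mult_right_mono) auto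
        finally show ?thesis by simp
      qed
      have f3: "real n / real m * (b - \<eta>') = real n * (b / real m - \<eta>) + real n * \<eta> / 2"
        using m by (simp add: \<eta>'_def field_simps)
      have "C \<le> real n * \<eta> / 2"
      proof -
        have "2 * C / \<eta> \<le> real n" using L n by linarith
        thus ?thesis using \<eta> by (simp add: pos_divide_le_eq)
      qed
      hence f4: "\<bar>b - \<eta>'\<bar> - ln \<epsilon> / s + ln 2 \<le> real n * \<eta> / 2" unfolding C_def .
      have "x \<le> k' + E - l" if "A = k' + R" "R \<le> Z" "A = x + y" "Z - E + l \<le> y" for A k' R x y Z E l :: real
        using that by linarith
      from this[OF f1 f2 f3 f4] show ?thesis .
    qed
    moreover have "ereal (real k * (b - \<eta>') + ln \<epsilon> / s - ln 2) \<le> betaW (d ^ n) \<epsilon> (P n) (E n)"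
      unfolding kr(1) by (rule betaW_block[OF gP gE m kr(2) \<epsilon> S e s ps])
    ultimately show "ereal (real n * (b / real m - \<eta>)) \<le> betaW (d ^ n) \<epsilon> (P n) (E n)"
      by (meson ereal_less_eq(3) order_trans)
  qed
qed

section \<open>Comparison of the limits\<close>

lemma good_family_dim_pos:
  assumes "good_family d P" "P 1 \<noteq> {}" shows "1 \<le> d"
  using assms good_family_basic(1)[OF assms(1), of 1] dens_dim_pos by fastforce

lemma ereal_divide_le: "0 < n \<Longrightarrow> x \<le> ereal (real n * y) \<Longrightarrow> x / ereal (real n) \<le> ereal y"
  by (cases x) (auto simp: field_simps)

lemma ereal_le_divide: "0 < n \<Longrightarrow> ereal (real n * y) \<le> x \<Longrightarrow> ereal y \<le> x / ereal (real n)"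
  by (cases x) (auto simp: field_simps)

text \<open>Takes the place of Fekete's lemma: a gap between infimum and limsup would force
  \<open>h\<close> to lie eventually below \<open>x\<close> and above some
  \<open>y > x\<close>.\<close>

lemma limsup_eq_Inf_of_rates:
  fixes R h :: "nat \<Rightarrow> ereal"
  assumes up: "\<And>y. (INF n\<in>{1..}. R n) < ereal y \<Longrightarrow> \<forall>\<^sub>F n in sequentially. h n \<le> ereal y"
    and low: "\<And>y. ereal y < limsup R \<Longrightarrow> \<forall>\<^sub>F n in sequentially. ereal y \<le> h n"
  shows "limsup R = (INF n\<in>{1..}. R n)" "R \<longlonglongrightarrow> (INF n\<in>{1..}. R n)"
proof -
  let ?L = "INF n\<in>{1..}. R n"
  have RL: "\<forall>\<^sub>F n in sequentially. ?L \<le> R n"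
    by (rule eventually_sequentiallyI[of 1]) (auto intro: INF_lower)
  hence "?L \<le> liminf R" by (rule Liminf_bounded)
  hence ge: "?L \<le> limsup R" using Liminf_le_Limsup[of sequentially R] by (meson order_trans sequentially_bot)
  have "limsup R \<le> ?L"
  proof (rule ccontr)
    assume "\<not> limsup R \<le> ?L"
    hence "?L < limsup R" by simp
    then obtain x where x: "?L < ereal x" "ereal x < limsup R" using ereal_dense2 by blast
    then obtain y where y: "ereal x < ereal y" "ereal y < limsup R" using ereal_dense2 by blast
    have "\<forall>\<^sub>F n in sequentially. False"
      using up[OF x(1)] low[OF y(2)]
    proof eventually_elim
      case (elim n)
      hence "ereal y \<le> ereal x" by (rule order_trans[rotated])
      thus ?case using y(1) by simp
    qed
    thus False by simp
  qed
  thus eq: "limsup R = ?L" using ge by simp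
  show "R \<longlonglongrightarrow> ?L"
  proof (rule order_tendstoI)
    show "\<forall>\<^sub>F n in sequentially. a < R n" if "a < ?L" for a
      using RL by eventually_elim (rule less_le_trans[OF that])
    show "\<forall>\<^sub>F n in sequentially. R n < a" if "?L < a" for a
      using that eq by (intro Limsup_lessD) simp
  qed
qed

lemma tendsto_ereal_sandwich:
  fixes L :: ereal
  assumes up: "\<And>y. L < ereal y \<Longrightarrow> \<forall>\<^sub>F n in sequentially. h n \<le> ereal y"
    and low: "\<And>y. ereal y < L \<Longrightarrow> \<forall>\<^sub>F n in sequentially. ereal y \<le> h n"
  shows "h \<longlonglongrightarrow> L"
proof (rule order_tendstoI)
  fix a assume "a < L"
  then obtain y where y: "a < ereal y" "ereal y < L" using ereal_dense2 by blast
  show "\<forall>\<^sub>F n in sequentially. a < h n"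
    using low[OF y(2)] by eventually_elim (rule less_le_trans[OF y(1)])
next
  fix a assume "L < a"
  then obtain y where y: "L < ereal y" "ereal y < a" using ereal_dense2 by blast
  show "\<forall>\<^sub>F n in sequentially. h n < a"
    using up[OF y(1)] by eventually_elim (rule le_less_trans[OF _ y(2)])
qed

theorem theoremS4:
  fixes d :: nat and P E :: "nat \<Rightarrow> complex mat set"
  assumes "good_family d P" and "good_family d E"
    and "\<exists>c>0. \<forall>n\<ge>1. Dmax (d ^ n) (P n) (E n) \<le> ereal (c * real n)"
    and "0 < \<epsilon>" and "\<epsilon> < 1"
  shows "\<exists>L::ereal.
     (\<lambda>n. rel_ent_set (P n) (E n) / ereal (real n)) \<longlonglongrightarrow> L \<and>
     (\<lambda>n. betaW (d ^ n) \<epsilon> (P n) (E n) / ereal (real n)) \<longlonglongrightarrow> L \<and>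
     (\<lambda>n. betaC (d ^ n) \<epsilon> (P n) (E n) / ereal (real n)) \<longlonglongrightarrow> L"
proof -
  note gP = assms(1) and gE = assms(2)
  obtain c where D: "\<And>n. 1 \<le> n \<Longrightarrow> Dmax (d ^ n) (P n) (E n) \<le> ereal (c * real n)" using assms(3) by blast
  have sub: "P n \<subseteq> dens (d ^ n)" "E n \<subseteq> dens (d ^ n)" if "1 \<le> n" for n
    using good_family_basic(1)[OF gP that] good_family_basic(1)[OF gE that] .
  have ne: "P n \<noteq> {}" "E n \<noteq> {}" if "1 \<le> n" for n
    using Dmax_finite_supp[OF sub[OF that] D[OF that]] by auto
  have d: "1 \<le> d" by (rule good_family_dim_pos[OF gP ne(1)]) simp
  define R where "R = (\<lambda>n. rel_ent_set (P n) (E n) / ereal (real n))"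
  define W where "W = (\<lambda>e n. betaW (d ^ n) e (P n) (E n))"
  define C where "C = (\<lambda>e n. betaC (d ^ n) e (P n) (E n))"
  define L where "L = (INF n\<in>{1..}. R n)"
  have pos: "\<forall>\<^sub>F n :: nat in sequentially. 0 < n" by (rule eventually_gt_at_top)
  have Cup: "\<forall>\<^sub>F n in sequentially. C e n / ereal (real n) \<le> ereal y"
    if e: "0 < e" and y: "L < ereal y" for e y
  proof -
    obtain m where m: "1 \<le> m" "R m < ereal y" using y unfolding L_def INF_less_iff by auto
    then obtain x where x: "R m < ereal x" "ereal x < ereal y" using ereal_dense2 by blast
    have "rel_ent_set (P m) (E m) < ereal (real m * x)"
      using x(1) m(1) unfolding R_def by (cases "rel_ent_set (P m) (E m)") (auto simp: field_simps)
    from betaC_upper[OF gP gE D m(1) this _ e, of "y - x"]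
    have "\<forall>\<^sub>F n in sequentially. C e n \<le> ereal (real n * y)" using x(2) m(1) by (simp add: C_def)
    thus ?thesis using pos by eventually_elim (rule ereal_divide_le)
  qed
  have Wlow: "\<forall>\<^sub>F n in sequentially. ereal y \<le> W e n / ereal (real n)"
    if e: "0 < e" "e < 1" and y: "ereal y < limsup R" for e y
  proof -
    obtain x where x: "ereal y < ereal x" "ereal x < limsup R" using ereal_dense2[OF y] by blast
    \<comment> \<open>Three losses of at most \<open>g\<close> each: the fraction
      \<open>ln 2 / \<Delta>\<close>, the constants of one block, and the margin in
      \<open>betaW_lower\<close>. \<Delta> is fixed first, from \<open>x\<close> and
      \<open>d\<close>; only then is \<open>m\<close> chosen.\<close>
    define g where "g = (x - y) / 4"
    have g: "0 < g" and g4: "4 * g = x - y" using x by (simp_all add: g_def)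
    have ld: "0 \<le> ln (real d)" using d by simp
    define a where "a = ln 2 * (\<bar>x\<bar> + ln (real d)) / g"
    define \<Delta> where "\<Delta> = 1 + a"
    have a0: "0 \<le> a" using g ld by (simp add: a_def)
    have \<Delta>: "ln 2 < \<Delta>" using a0 ln_2_less_1 by (simp add: \<Delta>_def)
    have D0: "0 < \<Delta>" using a0 by (simp add: \<Delta>_def)
    have "ln 2 * (\<bar>x\<bar> + ln (real d)) = a * g" using g by (simp add: a_def)
    also have "\<dots> \<le> \<Delta> * g" using g by (intro mult_right_mono) (auto simp: \<Delta>_def)
    finally have small: "ln 2 / \<Delta> * (\<bar>x\<bar> + ln (real d)) \<le> g" using D0 by (simp add: pos_divide_le_eq mult.commute)
    obtain M :: nat where M: "(\<Delta> + ln 2 + 1) / g \<le> real M" using real_arch_simple by blast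
    \<comment> \<open>A limsup above \<open>x\<close> provides good block lengths beyond any bound,
      in particular beyond \<open>M\<close>.\<close>
    have "\<exists>\<^sub>F n in sequentially. ereal x < R n"
    proof (rule ccontr)
      assume "\<not> (\<exists>\<^sub>F n in sequentially. ereal x < R n)"
      hence "\<forall>\<^sub>F n in sequentially. R n \<le> ereal x" by (simp add: not_frequently not_less)
      hence "limsup R \<le> ereal x" by (rule Limsup_bounded)
      thus False using x by simp
    qed
    then obtain m where m: "max 1 M \<le> m" "ereal x < R m" unfolding frequently_sequentially by blast
    have m1: "1 \<le> m" using m by simp
    have c0: "ereal (real m * x) < rel_ent_set (P m) (E m)"
      using m(2) m1 unfolding R_def by (cases "rel_ent_set (P m) (E m)") (auto simp: field_simps)
    define b where "b = (1 - ln 2 / \<Delta>) * (real m * x) - ln 2 / \<Delta> * (real m * ln (real d)) - \<Delta> - ln 2 - 1"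
    have f1: "b / real m - g = (1 - ln 2 / \<Delta>) * x - ln 2 / \<Delta> * ln (real d) - (\<Delta> + ln 2 + 1) / real m - g"
      unfolding b_def using m1 by (simp add: diff_divide_distrib add_divide_distrib)
    have f2: "(\<Delta> + ln 2 + 1) / real m \<le> g"
    proof -
      have "(\<Delta> + ln 2 + 1) / g \<le> real m" using M m(1) by linarith
      thus ?thesis using g m1 by (simp add: pos_divide_le_eq mult.commute)
    qed
    have f3: "x - g \<le> (1 - ln 2 / \<Delta>) * x - ln 2 / \<Delta> * ln (real d)"
    proof -
      have "ln 2 / \<Delta> * x \<le> ln 2 / \<Delta> * \<bar>x\<bar>" using D0 by (intro mult_left_mono) auto
      thus ?thesis using small by (simp only: left_diff_distrib distrib_left mult_1)
    qed
    have "y \<le> B" if "B = u - v - w - g" "w \<le> g" "x - g \<le> u - v" for B u v w :: real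
      using that g g4 by linarith
    from this[OF f1 f2 f3] have yb: "y \<le> b / real m - g" .
    have "\<forall>\<^sub>F n in sequentially. ereal (real n * (b / real m - g)) \<le> W e n"
      using betaW_lower[OF gP gE ne(1)[OF m1] ne(2)[OF m1] m1 c0 \<Delta> g e] unfolding W_def b_def .
    thus ?thesis using pos
    proof eventually_elim
      case (elim n)
      have "ereal (real n * y) \<le> ereal (real n * (b / real m - g))" using yb by (simp add: mult_left_mono)
      hence "ereal (real n * y) \<le> W e n" using elim(1) by (rule order_trans)
      thus ?case by (rule ereal_le_divide[OF elim(2)])
    qed
  qed
  have WC: "W e n \<le> C e' n + ereal (- ln (1 - e - e'))" if "e + e' < 1" "1 \<le> n" for e e' n
    unfolding W_def C_def by (rule betaW_le_betaC[OF sub[OF that(2)] that(1)])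
  \<comment> \<open>The companion error level: added to \<epsilon> it gives
    \<open>(1 + \<epsilon>) / 2 < 1\<close>, so \<open>WC\<close> compares work and cost in either
    order of the two levels.\<close>
  have half: "0 < (1 - \<epsilon>) / 2" "(1 - \<epsilon>) / 2 < 1" "\<epsilon> + (1 - \<epsilon>) / 2 < 1" "(1 - \<epsilon>) / 2 + \<epsilon> < 1"
    using assms(4,5) by (auto simp: field_simps)
  have const: "\<forall>\<^sub>F n in sequentially. k \<le> real n * g" if "0 < g" for k g :: real
  proof -
    obtain N :: nat where "k / g \<le> real N" using real_arch_simple by blast
    hence "k \<le> real n * g" if "N \<le> n" for n
      using \<open>0 < g\<close> that by (simp add: pos_divide_le_eq) (smt (verit) mult_right_mono of_nat_mono)
    thus ?thesis by (rule eventually_sequentiallyI)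
  qed
  have Wup: "\<forall>\<^sub>F n in sequentially. W \<epsilon> n / ereal (real n) \<le> ereal y" if y: "L < ereal y" for y
  proof -
    obtain x where x: "L < ereal x" "ereal x < ereal y" using ereal_dense2[OF y] by blast
    have g: "0 < y - x" using x by simp
    show ?thesis
      using Cup[OF half(1) x(1)] const[OF g, of "- ln (1 - \<epsilon> - (1 - \<epsilon>) / 2)"] pos
    proof eventually_elim
      case (elim n)
      let ?k = "- ln (1 - \<epsilon> - (1 - \<epsilon>) / 2)"
      have "C ((1 - \<epsilon>) / 2) n \<le> ereal (real n * x)"
        using elim(1,3) by (cases "C ((1 - \<epsilon>) / 2) n") (auto simp: field_simps)
      hence "C ((1 - \<epsilon>) / 2) n + ereal ?k \<le> ereal (real n * x) + ereal ?k" by (rule add_right_mono)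
      moreover have "1 \<le> n" using elim(3) by simp
      ultimately have "W \<epsilon> n \<le> ereal (real n * x) + ereal ?k"
        using order_trans[OF WC[OF half(3)]] by blast
      also have "\<dots> \<le> ereal (real n * y)" using elim(2) by (simp add: algebra_simps)
      finally show ?case using elim(3) by (intro ereal_divide_le)
    qed
  qed
  \<comment> \<open>The work rate at level \<epsilon> is the sequence squeezed between the infimum
    and the limsup of \<open>R\<close>.\<close>
  have gap: "limsup R = L" "R \<longlonglongrightarrow> L"
    using limsup_eq_Inf_of_rates[of R "\<lambda>n. W \<epsilon> n / ereal (real n)"] Wup Wlow[OF assms(4,5)] unfolding L_def by blast+
  have Clow: "\<forall>\<^sub>F n in sequentially. ereal y \<le> C \<epsilon> n / ereal (real n)" if y: "ereal y < L" for y
  proof -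
    obtain x where x: "ereal y < ereal x" "ereal x < L" using ereal_dense2[OF y] by blast
    have g: "0 < x - y" using x by simp
    have xl: "ereal x < limsup R" using x(2) gap(1) by simp
    show ?thesis
      using Wlow[OF half(1,2) xl] const[OF g, of "- ln (1 - (1 - \<epsilon>) / 2 - \<epsilon>)"] pos
    proof eventually_elim
      case (elim n)
      let ?k = "- ln (1 - (1 - \<epsilon>) / 2 - \<epsilon>)"
      have "ereal (real n * x) \<le> W ((1 - \<epsilon>) / 2) n"
        using elim(1,3) by (cases "W ((1 - \<epsilon>) / 2) n") (auto simp: field_simps)
      moreover have "1 \<le> n" using elim(3) by simp
      ultimately have "ereal (real n * x) \<le> C \<epsilon> n + ereal ?k"
        using order_trans[OF _ WC[OF half(4)]] by blast
      hence "ereal (real n * x - ?k) \<le> C \<epsilon> n" by (cases "C \<epsilon> n") auto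
      moreover have "ereal (real n * y) \<le> ereal (real n * x - ?k)" using elim(2) by (simp add: algebra_simps)
      ultimately have "ereal (real n * y) \<le> C \<epsilon> n" by (rule order_trans[rotated])
      thus ?case by (rule ereal_le_divide[OF elim(3)])
    qed
  qed
  have "(\<lambda>n. W \<epsilon> n / ereal (real n)) \<longlonglongrightarrow> L"
    using Wlow[OF assms(4,5)] unfolding gap(1) by (intro tendsto_ereal_sandwich Wup)
  moreover have "(\<lambda>n. C \<epsilon> n / ereal (real n)) \<longlonglongrightarrow> L"
    by (rule tendsto_ereal_sandwich[OF Cup[OF assms(4)] Clow])
  ultimately show ?thesis using gap(2) unfolding R_def W_def C_def by blast
qed

end
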